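(* Let $\mathcal{M}$ be a commutative von Neumann algebra with a faithful normal semi-finite trace $\tau$. The following conditions are equivalent: (i) the lattice $P(\mathcal{M})$ of projections in $\mathcal{M}$ is not atomic; (ii) the algebra $S(\mathcal{M})$ (respectively $S(\mathcal{M},\tau)$) admits a non-inner derivation; (iii) the algebra $S(\mathcal{M})$ (respectively $S(\mathcal{M},\tau)$) admits a non-zero local derivation; (iv) the algebra $S(\mathcal{M})$ (respectively $S(\mathcal{M},\tau)$) admits a local derivation which is not a derivation. That is, (i)–(iv) are equivalent when (ii)–(iv) are read for $S(\mathcal{M})$, and also when (ii)–(iv) are read for $S(\mathcal{M},\tau)$.
   Context: Let $\mathcal{M}\subseteq B(H)$ be a von Neumann algebra on a Hilbert space $H$ with identity $\mathbf{1}$, commutant $\mathcal{M}'$, lattice of projections $P(\mathcal{M})$, and a faithful normal semi-finite trace $\tau$. For $p\in P(\mathcal{M})$ write $p^\perp=\mathbf{1}-p$. An atom is a nonzero projection $q$ such that $0\ne e\le q$, $e\in P(\mathcal{M})$, implies $e=q$; $P(\mathcal{M})$ is atomic if every nonzero projection majorizes an atom. A linear subspace $\mathcal{D}\subseteq H$ is affiliated with $\mathcal{M}$ if $u(\mathcal{D})\subseteq\mathcal{D}$ for each unitary $u\in\mathcal{M}'$. A linear operator $x$ in $H$ with domain $\mathcal{D}(x)$ is affiliated with $\mathcal{M}$ if $\mathcal{D}(x)$ is affiliated with $\mathcal{M}$ and $ux(\xi)=xu(\xi)$ for all $u\in\mathcal{M}'$, $\xi\in\mathcal{D}(x)$. A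 subspace $\mathcal{D}$ is strongly dense with respect to $\mathcal{M}$ if it is affiliated with $\mathcal{M}$ and there is a sequence $p_n\in P(\mathcal{M})$ with $p_n\uparrow\mathbf{1}$, $p_n(H)\subset\mathcal{D}$ and $p_n^\perp$ a finite projection in $\mathcal{M}$ for all $n$. A subspace $\mathcal{D}$ is $\tau$-dense if it is affiliated with $\mathcal{M}$ and for every $\varepsilon>0$ there is a projection $p\in\mathcal{M}$ with $p(H)\subset\mathcal{D}$ and $\tau(p^\perp)<\varepsilon$. A closed linear operator affiliated with $\mathcal{M}$ is measurable (respectively $\tau$-measurable) if its domain is strongly dense (respectively $\tau$-dense). $S(\mathcal{M})$ and $S(\mathcal{M},\tau)$ are the $*$-algebras of all measurable, respectively $\tau$-measurable, operators, with sum and product the closures of the algebraic sum and product. For commutative $\mathcal{M}$: $\mathcal{M}\cong L^\infty(\Omega,\Sigma,\mu)$ for a localizable measure space with $\tau(f)=\int_\Omega f\,d\mu$; then $S(\mathcal{M})$ is identified with the algebra $L^0(\Omega,\Sigma,\mu)$ of (classes of) measurable functions, and $S(\mathcal{M},\tau)$ with $\{f\in L^0(\Omega):\exists F\in\Sigma,\ \mu(\Omega\setminus F)<+\infty,\ \chi_F f\in L^\infty(\Omega)\}$, where $\chi_F$ is the characteristic function of $F$. A derivation on an algebra $A$ is a linear operator $D:A\to A$ with $D(xy)=D(x)y+xD(y)$ for all $x,y\in A$; it is inner if there is $a\in A$ with $D(x)=ax-xa$ for all $x\in A$ (so on a commutative algebra the only inner derivation is zero). A local derivation on $A$ is a linear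 operator $\Delta:A\to A$ such that for each $x\in A$ there is a derivation $D$ on $A$ (depending on $x$) with $\Delta(x)=D(x)$. *)

theory Defs
  imports "HOL-Analysis.Analysis"
begin

section \<open>Complex Hilbert spaces\<close>

text \<open>
  The norm and the topology are those of the underlying real Hilbert space, whose inner
  product is the real part of the complex one.  The complex inner product is linear in its
  first argument.
\<close>

class complex_hilbert_space = real_inner + complete_space +
  fixes scaleC :: "complex \<Rightarrow> 'a \<Rightarrow> 'a" (infixr "*\<^sub>C" 75)
    and cinner :: "'a \<Rightarrow> 'a \<Rightarrow> complex"
  assumes scaleC_of_real: "complex_of_real r *\<^sub>C x = r *\<^sub>R x"
    and scaleC_add_right: "c *\<^sub>C (x + y) = c *\<^sub>C x + c *\<^sub>C y"
    and scaleC_add_left: "(c + d) *\<^sub>C x = c *\<^sub>C x + d *\<^sub>C x"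
    and scaleC_scaleC: "c *\<^sub>C d *\<^sub>C x = (c * d) *\<^sub>C x"
    and cinner_add_left: "cinner (x + y) z = cinner x z + cinner y z"
    and cinner_scaleC_left: "cinner (c *\<^sub>C x) y = c * cinner x y"
    and cinner_commute: "cinner x y = cnj (cinner y x)"
    and Re_cinner: "Re (cinner x y) = inner x y"

instantiation complex :: complex_hilbert_space
begin

definition scaleC_complex :: "complex \<Rightarrow> complex \<Rightarrow> complex" where
  "scaleC_complex c x = c * x"

definition cinner_complex :: "complex \<Rightarrow> complex \<Rightarrow> complex" where
  "cinner_complex x y = x * cnj y"

instance
  by standard
    (simp_all add: scaleC_complex_def cinner_complex_def algebra_simps scaleR_conv_of_real
      inner_complex_def)

end


section \<open>Von Neumann algebras\<close>

definition bounded_ops :: "('h::complex_hilbert_space \<Rightarrow> 'h) set" where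
  "bounded_ops = {T. bounded_linear T \<and> (\<forall>c \<xi>. T (c *\<^sub>C \<xi>) = c *\<^sub>C T \<xi>)}"

definition is_adjoint ::
    "('h::complex_hilbert_space \<Rightarrow> 'h) \<Rightarrow> ('h \<Rightarrow> 'h) \<Rightarrow> bool" where
  "is_adjoint T S \<longleftrightarrow> (\<forall>\<xi> \<eta>. cinner (T \<xi>) \<eta> = cinner \<xi> (S \<eta>))"

definition commutant ::
    "('h::complex_hilbert_space \<Rightarrow> 'h) set \<Rightarrow> ('h \<Rightarrow> 'h) set" where
  "commutant M = {S \<in> bounded_ops. \<forall>T\<in>M. S \<circ> T = T \<circ> S}"

text \<open>
  A self-adjoint set of bounded operators that equals its bicommutant; it is then a
  subalgebra containing the identity of \<open>H\<close>.
\<close>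

definition von_neumann_algebra :: "('h::complex_hilbert_space \<Rightarrow> 'h) set \<Rightarrow> bool" where
  "von_neumann_algebra M \<longleftrightarrow>
     M \<subseteq> bounded_ops \<and> (\<forall>T\<in>M. \<exists>S\<in>M. is_adjoint T S) \<and> commutant (commutant M) = M"

definition commutative :: "('h::complex_hilbert_space \<Rightarrow> 'h) set \<Rightarrow> bool" where
  "commutative M \<longleftrightarrow> (\<forall>S\<in>M. \<forall>T\<in>M. S \<circ> T = T \<circ> S)"

definition unitary_op :: "('h::complex_hilbert_space \<Rightarrow> 'h) \<Rightarrow> bool" where
  "unitary_op u \<longleftrightarrow> u \<in> bounded_ops \<and> (\<exists>v. is_adjoint u v \<and> v \<circ> u = id \<and> u \<circ> v = id)"

definition positive_op :: "('h::complex_hilbert_space \<Rightarrow> 'h) \<Rightarrow> bool" where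
  "positive_op T \<longleftrightarrow> (\<forall>\<xi>. cinner (T \<xi>) \<xi> \<in> \<real>\<^sub>\<ge>\<^sub>0)"

definition op_le :: "('h::complex_hilbert_space \<Rightarrow> 'h) \<Rightarrow> ('h \<Rightarrow> 'h) \<Rightarrow> bool"
    (infix "\<le>\<^sub>o\<^sub>p" 50) where
  "S \<le>\<^sub>o\<^sub>p T \<longleftrightarrow> positive_op (\<lambda>\<xi>. T \<xi> - S \<xi>)"

definition positive_part ::
    "('h::complex_hilbert_space \<Rightarrow> 'h) set \<Rightarrow> ('h \<Rightarrow> 'h) set" where
  "positive_part M = {T \<in> M. positive_op T}"

definition is_lub_in ::
    "('h::complex_hilbert_space \<Rightarrow> 'h) set \<Rightarrow> ('h \<Rightarrow> 'h) set \<Rightarrow> ('h \<Rightarrow> 'h) \<Rightarrow> bool" where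
  "is_lub_in L X s \<longleftrightarrow>
     s \<in> L \<and> (\<forall>x\<in>X. x \<le>\<^sub>o\<^sub>p s) \<and> (\<forall>z\<in>L. (\<forall>x\<in>X. x \<le>\<^sub>o\<^sub>p z) \<longrightarrow> s \<le>\<^sub>o\<^sub>p z)"


subsection \<open>Projections\<close>

definition projections ::
    "('h::complex_hilbert_space \<Rightarrow> 'h) set \<Rightarrow> ('h \<Rightarrow> 'h) set" where
  "projections M = {p \<in> M. p \<circ> p = p \<and> is_adjoint p p}"

definition perp :: "('h::complex_hilbert_space \<Rightarrow> 'h) \<Rightarrow> 'h \<Rightarrow> 'h" where
  "perp p = (\<lambda>\<xi>. \<xi> - p \<xi>)"

definition atom :: "('h::complex_hilbert_space \<Rightarrow> 'h) set \<Rightarrow> ('h \<Rightarrow> 'h) \<Rightarrow> bool" where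
  "atom M q \<longleftrightarrow> q \<in> projections M \<and> q \<noteq> (\<lambda>_. 0) \<and>
     (\<forall>e\<in>projections M. e \<noteq> (\<lambda>_. 0) \<and> e \<le>\<^sub>o\<^sub>p q \<longrightarrow> e = q)"

definition atomic_projections :: "('h::complex_hilbert_space \<Rightarrow> 'h) set \<Rightarrow> bool" where
  "atomic_projections M \<longleftrightarrow>
     (\<forall>p\<in>projections M. p \<noteq> (\<lambda>_. 0) \<longrightarrow> (\<exists>q. atom M q \<and> q \<le>\<^sub>o\<^sub>p p))"

text \<open>Murray--von Neumann equivalence and finiteness of projections.\<close>

definition mvn_equiv ::
    "('h::complex_hilbert_space \<Rightarrow> 'h) set \<Rightarrow> ('h \<Rightarrow> 'h) \<Rightarrow> ('h \<Rightarrow> 'h) \<Rightarrow> bool" where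
  "mvn_equiv M p q \<longleftrightarrow> (\<exists>v\<in>M. \<exists>w\<in>M. is_adjoint v w \<and> w \<circ> v = p \<and> v \<circ> w = q)"

definition finite_projection ::
    "('h::complex_hilbert_space \<Rightarrow> 'h) set \<Rightarrow> ('h \<Rightarrow> 'h) \<Rightarrow> bool" where
  "finite_projection M p \<longleftrightarrow> p \<in> projections M \<and>
     (\<forall>q\<in>projections M. q \<le>\<^sub>o\<^sub>p p \<and> mvn_equiv M p q \<longrightarrow> q = p)"


subsection \<open>Traces\<close>

text \<open>
  A trace is a function on the positive part of \<open>M\<close>; its values elsewhere are irrelevant.
  In \<open>ennreal\<close> we have \<open>0 * \<infinity> = 0\<close>, as usual for traces.
\<close>

definition is_trace ::
    "('h::complex_hilbert_space \<Rightarrow> 'h) set \<Rightarrow> (('h \<Rightarrow> 'h) \<Rightarrow> ennreal) \<Rightarrow> bool" where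
  "is_trace M \<tau> \<longleftrightarrow>
     (\<forall>x\<in>positive_part M. \<forall>y\<in>positive_part M. \<tau> (\<lambda>\<xi>. x \<xi> + y \<xi>) = \<tau> x + \<tau> y) \<and>
     (\<forall>x\<in>positive_part M. \<forall>r\<ge>0. \<tau> (\<lambda>\<xi>. r *\<^sub>R x \<xi>) = ennreal r * \<tau> x) \<and>
     (\<forall>x\<in>M. \<forall>y\<in>M. is_adjoint x y \<longrightarrow> \<tau> (y \<circ> x) = \<tau> (x \<circ> y))"

definition faithful_trace ::
    "('h::complex_hilbert_space \<Rightarrow> 'h) set \<Rightarrow> (('h \<Rightarrow> 'h) \<Rightarrow> ennreal) \<Rightarrow> bool" where
  "faithful_trace M \<tau> \<longleftrightarrow> (\<forall>x\<in>positive_part M. \<tau> x = 0 \<longrightarrow> x = (\<lambda>_. 0))"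

text \<open>Increasing nets are rendered as upwards directed sets.\<close>

definition normal_trace ::
    "('h::complex_hilbert_space \<Rightarrow> 'h) set \<Rightarrow> (('h \<Rightarrow> 'h) \<Rightarrow> ennreal) \<Rightarrow> bool" where
  "normal_trace M \<tau> \<longleftrightarrow>
     (\<forall>X s. X \<subseteq> positive_part M \<and> X \<noteq> {} \<and>
        (\<forall>x\<in>X. \<forall>y\<in>X. \<exists>z\<in>X. x \<le>\<^sub>o\<^sub>p z \<and> y \<le>\<^sub>o\<^sub>p z) \<and>
        is_lub_in (positive_part M) X s \<longrightarrow> \<tau> s = (SUP x\<in>X. \<tau> x))"

definition semifinite_trace ::
    "('h::complex_hilbert_space \<Rightarrow> 'h) set \<Rightarrow> (('h \<Rightarrow> 'h) \<Rightarrow> ennreal) \<Rightarrow> bool" where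
  "semifinite_trace M \<tau> \<longleftrightarrow>
     (\<forall>x\<in>positive_part M. x \<noteq> (\<lambda>_. 0) \<longrightarrow>
        (\<exists>y\<in>positive_part M. y \<noteq> (\<lambda>_. 0) \<and> y \<le>\<^sub>o\<^sub>p x \<and> \<tau> y < \<infinity>))"


section \<open>Measurable operators\<close>

text \<open>
  A (partially defined) linear operator \<open>x\<close> in \<open>H\<close> is represented by its graph, so that
  \<open>Domain x\<close> is its domain, \<open>closed x\<close> says that it is a closed operator and \<open>closure x\<close>
  is its closure.
\<close>

type_synonym 'h graph = "('h \<times> 'h) set"

definition linear_subspace :: "'h::complex_hilbert_space set \<Rightarrow> bool" where
  "linear_subspace D \<longleftrightarrow>
     0 \<in> D \<and> (\<forall>\<xi>\<in>D. \<forall>\<eta>\<in>D. \<xi> + \<eta> \<in> D) \<and> (\<forall>c. \<forall>\<xi>\<in>D. c *\<^sub>C \<xi> \<in> D)"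

definition linear_operator :: "'h::complex_hilbert_space graph \<Rightarrow> bool" where
  "linear_operator x \<longleftrightarrow> single_valued x \<and> (0, 0) \<in> x \<and>
     (\<forall>(\<xi>, \<xi>')\<in>x. \<forall>(\<eta>, \<eta>')\<in>x. (\<xi> + \<eta>, \<xi>' + \<eta>') \<in> x) \<and>
     (\<forall>c. \<forall>(\<xi>, \<xi>')\<in>x. (c *\<^sub>C \<xi>, c *\<^sub>C \<xi>') \<in> x)"

definition affiliated_subspace ::
    "('h::complex_hilbert_space \<Rightarrow> 'h) set \<Rightarrow> 'h set \<Rightarrow> bool" where
  "affiliated_subspace M D \<longleftrightarrow> linear_subspace D \<and>
     (\<forall>u\<in>commutant M. unitary_op u \<longrightarrow> u ` D \<subseteq> D)"

definition affiliated_operator ::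
    "('h::complex_hilbert_space \<Rightarrow> 'h) set \<Rightarrow> 'h graph \<Rightarrow> bool" where
  "affiliated_operator M x \<longleftrightarrow> linear_operator x \<and> affiliated_subspace M (Domain x) \<and>
     (\<forall>u\<in>commutant M. \<forall>(\<xi>, \<eta>)\<in>x. (u \<xi>, u \<eta>) \<in> x)"

definition strongly_dense ::
    "('h::complex_hilbert_space \<Rightarrow> 'h) set \<Rightarrow> 'h set \<Rightarrow> bool" where
  "strongly_dense M D \<longleftrightarrow> affiliated_subspace M D \<and>
     (\<exists>p :: nat \<Rightarrow> 'h \<Rightarrow> 'h.
        (\<forall>n. p n \<in> projections M) \<and> (\<forall>n. p n \<le>\<^sub>o\<^sub>p p (Suc n)) \<and>
        is_lub_in (projections M) (range p) id \<and>
        (\<forall>n. range (p n) \<subseteq> D) \<and> (\<forall>n. finite_projection M (perp (p n))))"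

definition tau_dense ::
    "('h::complex_hilbert_space \<Rightarrow> 'h) set \<Rightarrow> (('h \<Rightarrow> 'h) \<Rightarrow> ennreal) \<Rightarrow> 'h set \<Rightarrow> bool" where
  "tau_dense M \<tau> D \<longleftrightarrow> affiliated_subspace M D \<and>
     (\<forall>\<epsilon>::real. \<epsilon> > 0 \<longrightarrow>
        (\<exists>p\<in>projections M. range p \<subseteq> D \<and> \<tau> (perp p) < ennreal \<epsilon>))"

definition measurable_ops ::
    "('h::complex_hilbert_space \<Rightarrow> 'h) set \<Rightarrow> 'h graph set" where
  "measurable_ops M = {x. affiliated_operator M x \<and> closed x \<and> strongly_dense M (Domain x)}"

definition tau_measurable_ops ::
    "('h::complex_hilbert_space \<Rightarrow> 'h) set \<Rightarrow> (('h \<Rightarrow> 'h) \<Rightarrow> ennreal) \<Rightarrow> 'h graph set" where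
  "tau_measurable_ops M \<tau> =
     {x. affiliated_operator M x \<and> closed x \<and> tau_dense M \<tau> (Domain x)}"

text \<open>
  The algebra operations are the closures of the algebraic ones.  The closure also matters for
  the multiple by the scalar \<open>0\<close>, which algebraically is the zero operator on \<open>Domain x\<close>
  only.  The relational composition \<open>y O x\<close> applies \<open>y\<close> first.
\<close>

definition op_add :: "'h::complex_hilbert_space graph \<Rightarrow> 'h graph \<Rightarrow> 'h graph"
    (infixl "\<oplus>\<^sub>m" 65) where
  "x \<oplus>\<^sub>m y = closure {(\<xi>, \<eta> + \<zeta>) |\<xi> \<eta> \<zeta>. (\<xi>, \<eta>) \<in> x \<and> (\<xi>, \<zeta>) \<in> y}"

definition op_mult :: "'h::complex_hilbert_space graph \<Rightarrow> 'h graph \<Rightarrow> 'h graph"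
    (infixl "\<otimes>\<^sub>m" 70) where
  "x \<otimes>\<^sub>m y = closure (y O x)"

definition op_scale :: "complex \<Rightarrow> 'h::complex_hilbert_space graph \<Rightarrow> 'h graph"
    (infixr "\<odot>\<^sub>m" 75) where
  "c \<odot>\<^sub>m x = closure {(\<xi>, c *\<^sub>C \<eta>) |\<xi> \<eta>. (\<xi>, \<eta>) \<in> x}"

definition op_zero :: "'h::complex_hilbert_space graph" where
  "op_zero = UNIV \<times> {0}"


section \<open>Derivations and local derivations\<close>

text \<open>
  Here \<open>A\<close> is an algebra of operators in \<open>H\<close> with the operations above.  A map on \<open>A\<close> is
  represented by a function on all graphs of which only the values on \<open>A\<close> matter.
\<close>

definition linear_map_on ::
    "'h::complex_hilbert_space graph set \<Rightarrow> ('h graph \<Rightarrow> 'h graph) \<Rightarrow> bool" where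
  "linear_map_on A D \<longleftrightarrow> (\<forall>x\<in>A. D x \<in> A) \<and>
     (\<forall>x\<in>A. \<forall>y\<in>A. D (x \<oplus>\<^sub>m y) = D x \<oplus>\<^sub>m D y) \<and>
     (\<forall>c. \<forall>x\<in>A. D (c \<odot>\<^sub>m x) = c \<odot>\<^sub>m D x)"

definition derivation_on ::
    "'h::complex_hilbert_space graph set \<Rightarrow> ('h graph \<Rightarrow> 'h graph) \<Rightarrow> bool" where
  "derivation_on A D \<longleftrightarrow> linear_map_on A D \<and>
     (\<forall>x\<in>A. \<forall>y\<in>A. D (x \<otimes>\<^sub>m y) = D x \<otimes>\<^sub>m y \<oplus>\<^sub>m x \<otimes>\<^sub>m D y)"

definition inner_on ::
    "'h::complex_hilbert_space graph set \<Rightarrow> ('h graph \<Rightarrow> 'h graph) \<Rightarrow> bool" where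
  "inner_on A D \<longleftrightarrow> (\<exists>a\<in>A. \<forall>x\<in>A. D x = a \<otimes>\<^sub>m x \<oplus>\<^sub>m (- 1) \<odot>\<^sub>m (x \<otimes>\<^sub>m a))"

definition local_derivation_on ::
    "'h::complex_hilbert_space graph set \<Rightarrow> ('h graph \<Rightarrow> 'h graph) \<Rightarrow> bool" where
  "local_derivation_on A \<Delta> \<longleftrightarrow> linear_map_on A \<Delta> \<and>
     (\<forall>x\<in>A. \<exists>D. derivation_on A D \<and> \<Delta> x = D x)"

end

theory Submission
  imports Defs "HOL-Computational_Algebra.Fundamental_Theorem_Algebra" "HOL-Algebra.Ring"
begin

text \<open>
  Both algebras are commutative, so zero is their only inner derivation.  The theorem therefore
  asks when a nonzero derivation, or a local derivation that is not a derivation, exists.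

  Suppose that every nonzero projection lies above an atom.  A derivation \<open>D\<close> kills projections,
  and for an atom \<open>q\<close> the product \<open>q x\<close> is a scalar multiple of \<open>q\<close>.  Hence
  \<open>q (D x) = D (q x) = 0\<close> for all atoms \<open>q\<close>, and atoms separate the vectors of \<open>H\<close>; so \<open>D = 0\<close>
  (\<open>atomic_derivation_zero\<close>).  A local derivation agrees at each point with a derivation, and
  vanishes as well.

  Suppose that the lattice is not atomic.  If \<open>D\<close> is a derivation with \<open>D z = 1\<close>, then \<open>D \<circ> D\<close> is a
  local derivation: \<open>D (D x)\<close> vanishes on every projection on which \<open>D x\<close> does, so it equals
  \<open>c (D x)\<close> for some \<open>c\<close>, and \<open>c D\<close> is a derivation.  It is not a derivation, because
  \<open>D (D (z z)) - 2 z (D (D z)) = 2 (D z) (D z)\<close>.  It is thus enough to find one derivation with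
  \<open>D z = 1\<close> on the corner below a nonzero projection of finite trace without atoms, where both
  algebras have the same elements (\<open>corner_tau_measurable\<close>).

  Such a corner is a field up to localization (locale \<open>patchable_algebra\<close>): a nonzero element is
  invertible on some nonzero projection, and elements given on disjoint projections have a common
  extension, finiteness of the trace making such families countable.  This suffices for the
  classical extension of derivations, one element at a time by Zorn's lemma
  (\<open>derivation_exists\<close>).  If \<open>b\<close> is locally algebraic over the present domain, a relation of
  locally minimal degree determines \<open>D b\<close>; where \<open>b\<close> is transcendental, \<open>D b\<close> is free.  The
  construction starts from \<open>d/dz\<close>, where \<open>z\<close> is not constant on any nonzero projection and hence
  is transcendental over the step functions; \<open>z\<close> is a ternary expansion whose digits are
  projections that separate all smaller ones (\<open>nowhere_constant_exists\<close>).

  The algebra \<open>M\<close> is never represented by functions.  A measurable operator is determined by its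
  restrictions to projections in its domain, which belong to \<open>M\<close> by the closed graph theorem, and
  spectral theory enters only through \<open>spectral_cut\<close>.
\<close>

section \<open>Dual numbers\<close>

text \<open>
  An additive map \<open>d\<close> satisfies the Leibniz rule if and only if \<open>x \<mapsto> x + \<epsilon> d x\<close> is multiplicative
  into the dual numbers.  Polynomials over the dual numbers therefore take care of the action of \<open>d\<close>
  on coefficients.
\<close>

datatype 'r dual = Dual (std: 'r) (eps: 'r)

instantiation dual :: (comm_ring_1) comm_ring_1
begin

definition zero_dual :: "'a dual" where "0 = Dual 0 0"
definition one_dual :: "'a dual" where "1 = Dual 1 0"
definition plus_dual :: "'a dual \<Rightarrow> 'a dual \<Rightarrow> 'a dual" where
  "u + v = Dual (std u + std v) (eps u + eps v)"
definition minus_dual :: "'a dual \<Rightarrow> 'a dual \<Rightarrow> 'a dual" where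
  "u - v = Dual (std u - std v) (eps u - eps v)"
definition uminus_dual :: "'a dual \<Rightarrow> 'a dual" where
  "- u = Dual (- std u) (- eps u)"
definition times_dual :: "'a dual \<Rightarrow> 'a dual \<Rightarrow> 'a dual" where
  "u * v = Dual (std u * std v) (eps u * std v + std u * eps v)"

instance
  by standard
    (auto simp: zero_dual_def one_dual_def plus_dual_def minus_dual_def uminus_dual_def
      times_dual_def algebra_simps)

end

lemma dual_sel [simp]:
  "std (0::'r::comm_ring_1 dual) = 0" "eps (0::'r dual) = 0"
  "std (1::'r::comm_ring_1 dual) = 1" "eps (1::'r dual) = 0"
  "std (u + v) = std u + std (v::'r dual)" "eps (u + v) = eps u + eps (v::'r dual)"
  "std (u - v) = std u - std (v::'r dual)" "eps (u - v) = eps u - eps (v::'r dual)"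
  "std (- u) = - std (u::'r dual)" "eps (- u) = - eps (u::'r dual)"
  "std (u * v) = std u * std (v::'r dual)"
  "eps (u * v) = eps u * std v + std u * eps (v::'r dual)"
  by (auto simp: zero_dual_def one_dual_def plus_dual_def minus_dual_def uminus_dual_def
      times_dual_def)

text \<open>
  Dual numbers have zero divisors, so the derivative is needed over arbitrary commutative rings.
\<close>

definition formal_deriv :: "'r::comm_ring_1 poly \<Rightarrow> 'r poly" where
  "formal_deriv F = (\<Sum>i\<le>degree F. monom (of_nat i * coeff F i) (i - 1))"

lemma coeff_formal_deriv: "coeff (formal_deriv F) n = of_nat (Suc n) * coeff F (Suc n)"
proof -
  have "coeff (formal_deriv F) n = (\<Sum>i\<le>degree F. if i - 1 = n then of_nat i * coeff F i else 0)"
    by (simp add: formal_deriv_def coeff_sum)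
  also have "\<dots> = (\<Sum>i\<le>degree F. if i = Suc n then of_nat i * coeff F i else 0)"
    by (rule sum.cong[OF refl]) (case_tac x; auto)
  also have "\<dots> = of_nat (Suc n) * coeff F (Suc n)"
    using coeff_eq_0[of F "Suc n"] by (auto simp: not_le)
  finally show ?thesis .
qed

lemma formal_deriv_0 [simp]: "formal_deriv 0 = 0"
  by (simp add: formal_deriv_def)

lemma formal_deriv_pCons: "formal_deriv (pCons a F) = F + pCons 0 (formal_deriv F)"
  by (rule poly_eqI) (auto simp: coeff_formal_deriv coeff_pCons algebra_simps split: nat.splits)

text \<open>
  First-order Taylor expansion around \<open>b\<close>; it is exact because \<open>\<epsilon> \<epsilon> = 0\<close>.
\<close>

lemma dual_taylor:
  fixes F :: "'r::comm_ring_1 dual poly"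
  shows "std (poly F (Dual b c)) = std (poly F (Dual b 0))"
    and "eps (poly F (Dual b c)) = eps (poly F (Dual b 0)) + c * std (poly (formal_deriv F) (Dual b 0))"
proof (induction F)
  case (pCons a F)
  {
    case 1
    then show ?case using pCons by simp
  next
    case 2
    then show ?case using pCons
      by (simp add: formal_deriv_pCons algebra_simps)
  }
qed simp_all

section \<open>Extension of derivations\<close>

text \<open>
  The elements under consideration form the corner \<open>p R\<close> of a ring.  The set \<open>E\<close> consists of some of
  its idempotents, thought of as the projections of the algebra, and \<open>\<kappa>\<close> embeds the scalars.  The
  last two assumptions say that the corner is a field up to localization and patching.
\<close>

locale patchable_algebra =
  fixes p :: "'r::comm_ring_1" and E :: "'r set" and \<kappa> :: "complex \<Rightarrow> 'r"
  assumes idem: "e \<in> E \<Longrightarrow> e * e = e"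
    and below: "e \<in> E \<Longrightarrow> p * e = e"
    and p_mem: "p \<in> E"
    and \<kappa>_add: "\<kappa> (a + b) = \<kappa> a + \<kappa> b"
    and \<kappa>_mult: "\<kappa> (a * b) = \<kappa> a * \<kappa> b"
    and \<kappa>_1: "\<kappa> 1 = p"
    and local_inverse: "p * w = w \<Longrightarrow> w \<noteq> 0 \<Longrightarrow> \<exists>y. w * y \<in> E \<and> w * y \<noteq> 0"
    and glue: "F \<subseteq> E \<Longrightarrow> (\<And>e f. e \<in> F \<Longrightarrow> f \<in> F \<Longrightarrow> e \<noteq> f \<Longrightarrow> e * f = 0) \<Longrightarrow>
      (\<And>e. e \<in> F \<Longrightarrow> p * c e = c e) \<Longrightarrow> \<exists>x. p * x = x \<and> (\<forall>e\<in>F. e * x = e * c e)"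
begin

lemma \<kappa>_0 [simp]: "\<kappa> 0 = 0"
  using \<kappa>_add[of 0 0] by simp

lemma \<kappa>_below: "p * \<kappa> a = \<kappa> a"
  using \<kappa>_mult[of 1 a] \<kappa>_1 by simp

lemma \<kappa>_of_nat: "\<kappa> (of_nat n) = of_nat n * p"
  by (induction n) (simp_all add: \<kappa>_add \<kappa>_1 algebra_simps)

text \<open>
  The corner has characteristic zero, because it contains the complex numbers.
\<close>

lemma of_nat_cancel:
  assumes "p * x = x" "n > 0" "of_nat n * x = 0"
  shows "x = 0"
proof -
  have "\<kappa> (inverse (of_nat n)) * (\<kappa> (of_nat n) * x) = 0"
    using assms by (simp add: \<kappa>_of_nat mult.assoc)
  moreover have "\<kappa> (inverse (of_nat n)) * \<kappa> (of_nat n) = p"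
    using assms by (simp flip: \<kappa>_mult add: \<kappa>_1)
  ultimately show ?thesis using assms by (simp flip: mult.assoc)
qed

lemma below_trans: "e * e1 = e1 \<Longrightarrow> e1 * e2 = e2 \<Longrightarrow> e * e2 = (e2::'r)"
  by (metis mult.assoc)

lemma below_eq:
  assumes "e1 * e2 = e2" "e1 * x = e1 * y" shows "e2 * x = (e2 * y :: 'r)"
proof -
  have "e2 * x = e2 * (e1 * x)" using assms(1) by (metis mult.assoc mult.commute)
  also have "\<dots> = e2 * (e1 * y)" using assms(2) by simp
  also have "\<dots> = e2 * y" using assms(1) by (metis mult.assoc mult.commute)
  finally show ?thesis .
qed

lemma local_inverse_below:
  assumes "e \<in> E" "e * w \<noteq> 0" "p * w = w"
  obtains e' y where "e' \<in> E" "e' \<noteq> 0" "e * e' = e'" "e' * (w * y) = e'"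
proof -
  have "p * (e * w) = e * w" using assms by (simp add: mult.left_commute)
  from local_inverse[OF this assms(2)] obtain y where y: "e * w * y \<in> E" "e * w * y \<noteq> 0" by blast
  define e' where "e' = e * w * y"
  have 1: "e * e' = e'" using idem[OF assms(1)] by (simp add: e'_def flip: mult.assoc)
  have "e' * (w * y) = e' * e * (w * y)" using 1 by (simp add: mult.commute)
  also have "\<dots> = e' * e'" by (simp add: e'_def mult_ac)
  also have "\<dots> = e'" using idem y e'_def by simp
  finally show ?thesis using that[of e' y] 1 y e'_def by simp
qed

text \<open>
  What can be achieved on a part of every nonzero idempotent can be achieved at once: patch along
  a maximal disjoint family of good idempotents.  An element that vanishes on all good idempotents
  is zero, since its support would contain a further good idempotent, disjoint from the family.
\<close>

lemma patch:
  fixes good :: "'r \<Rightarrow> 'r \<Rightarrow> bool"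
  assumes cong: "\<And>e c c'. e \<in> E \<Longrightarrow> good e c \<Longrightarrow> e * c = e * c' \<Longrightarrow> good e c'"
    and dense: "\<And>e. e \<in> E \<Longrightarrow> e \<noteq> 0 \<Longrightarrow>
      \<exists>e'\<in>E. \<exists>c. p * c = c \<and> e' \<noteq> 0 \<and> e * e' = e' \<and> good e' c"
  shows "\<exists>x. p * x = x \<and>
    (\<forall>w. p * w = w \<longrightarrow> (\<forall>e\<in>E. good e x \<longrightarrow> e * w = 0) \<longrightarrow> w = 0)"
proof -
  define G where "G = {e\<in>E. e \<noteq> 0 \<and> (\<exists>c. p * c = c \<and> good e c)}"
  define \<A> where "\<A> = {F. F \<subseteq> G \<and> (\<forall>e\<in>F. \<forall>f\<in>F. e \<noteq> f \<longrightarrow> e * f = 0)}"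
  have "\<exists>F\<in>\<A>. \<forall>X\<in>\<A>. F \<subseteq> X \<longrightarrow> X = F"
  proof (rule subset_Zorn')
    fix C assume C: "subset.chain \<A> C"
    show "\<Union>C \<in> \<A>"
      unfolding \<A>_def
    proof (intro CollectI conjI ballI impI)
      show "\<Union>C \<subseteq> G" using C by (auto simp: \<A>_def subset_chain_def)
      fix e f assume ef: "e \<in> \<Union>C" "f \<in> \<Union>C" "e \<noteq> f"
      then obtain X Y where XY: "X \<in> C" "Y \<in> C" "e \<in> X" "f \<in> Y" by blast
      then have "X \<subseteq> Y \<or> Y \<subseteq> X" using C by (auto simp: subset_chain_def)
      then obtain Z where "Z \<in> C" "e \<in> Z" "f \<in> Z" using XY by blast
      moreover then have "Z \<in> \<A>" using C by (auto simp: subset_chain_def)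
      ultimately show "e * f = 0" using ef by (auto simp: \<A>_def)
    qed
  qed
  then obtain F where F: "F \<in> \<A>" and max: "\<And>X. X \<in> \<A> \<Longrightarrow> F \<subseteq> X \<Longrightarrow> X = F" by blast
  then have FG: "F \<subseteq> G" and dis: "\<And>e f. e \<in> F \<Longrightarrow> f \<in> F \<Longrightarrow> e \<noteq> f \<Longrightarrow> e * f = 0"
    by (auto simp: \<A>_def)
  have "\<forall>e\<in>F. \<exists>c. p * c = c \<and> good e c" using FG by (auto simp: G_def)
  then obtain c where c: "\<And>e. e \<in> F \<Longrightarrow> p * c e = c e \<and> good e (c e)" by metis
  have "F \<subseteq> E" using FG by (auto simp: G_def)
  from glue[OF this dis, of c] c obtain x
    where x: "p * x = x" "\<And>e. e \<in> F \<Longrightarrow> e * x = e * c e" by blast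
  have gx: "good e x" if "e \<in> F" for e
    using cong[of e "c e" x] c[OF that] x(2)[OF that] that \<open>F \<subseteq> E\<close> by auto
  have "w = 0" if w: "p * w = w" "\<And>e. e \<in> E \<Longrightarrow> good e x \<Longrightarrow> e * w = 0" for w
  proof (rule ccontr)
    assume "w \<noteq> 0"
    then obtain y where y: "w * y \<in> E" "w * y \<noteq> 0" using local_inverse w(1) by blast
    then obtain e' c' where e': "e' \<in> E" "p * c' = c'" "e' \<noteq> 0" "w * y * e' = e'" "good e' c'"
      using dense by meson
    have fe: "f * e' = 0" if "f \<in> F" for f
    proof -
      have "f * w = 0" using w(2) gx that \<open>F \<subseteq> E\<close> by blast
      then have "f * (w * y * e') = 0" by (simp flip: mult.assoc)
      then show ?thesis using e' by simp
    qed
    have "insert e' F \<in> \<A>"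
      using FG dis fe e' by (auto simp: \<A>_def G_def mult.commute)
    then have "e' \<in> F" using max by blast
    then show False using fe e' idem by fastforce
  qed
  then show ?thesis using x by blast
qed

text \<open>
  An element \<open>w\<close> is a multiple of \<open>x\<close> as soon as \<open>w\<close> vanishes on every idempotent on which \<open>x\<close>
  does: invert \<open>x\<close> locally and patch the quotients.
\<close>

lemma divide:
  assumes x: "p * x = x" and w: "p * w = w"
    and supp: "\<And>e. e \<in> E \<Longrightarrow> e * x = 0 \<Longrightarrow> e * w = 0"
  obtains c where "p * c = c" "c * x = w"
proof -
  have "\<exists>e'\<in>E. \<exists>c. p * c = c \<and> e' \<noteq> 0 \<and> e * e' = e' \<and> e' * (c * x) = e' * w"
    if e: "e \<in> E" "e \<noteq> 0" for e
  proof (cases "e * x = 0")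
    case True
    then show ?thesis using e idem supp by (intro bexI[of _ e] exI[of _ 0]) auto
  next
    case False
    then obtain e' y where e': "e' \<in> E" "e' \<noteq> 0" "e * e' = e'" "e' * (x * y) = e'"
      using local_inverse_below e x by metis
    have "e' * (w * y * x) = e' * (x * y) * w" by (simp add: mult_ac)
    then have "e' * (w * y * x) = e' * w" using e' by simp
    then show ?thesis using e' w
      by (intro bexI[of _ e'] exI[of _ "w * y"]) (auto simp flip: mult.assoc)
  qed
  note dense = this
  have cong: "e * (c' * x) = e * w" if "e * (c * x) = e * w" "e * c = e * c'" for e c c'
    using that by (metis mult.assoc)
  have "\<exists>c. p * c = c \<and>
      (\<forall>v. p * v = v \<longrightarrow> (\<forall>e\<in>E. e * (c * x) = e * w \<longrightarrow> e * v = 0) \<longrightarrow> v = 0)"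
  proof (rule patch[of "\<lambda>e c. e * (c * x) = e * w"])
    show "e * (c' * x) = e * w" if "e \<in> E" "e * (c * x) = e * w" "e * c = e * c'" for e c c'
      using cong that by blast
  qed (fact dense)
  then obtain c where "p * c = c"
    "\<forall>v. p * v = v \<longrightarrow> (\<forall>e\<in>E. e * (c * x) = e * w \<longrightarrow> e * v = 0) \<longrightarrow> v = 0"
    by blast
  note c = this(1) this(2)[rule_format]
  have "c * x - w = 0"
  proof (rule c(2))
    show "p * (c * x - w) = c * x - w"
      using c(1) w by (simp add: right_diff_distrib flip: mult.assoc)
  qed (simp add: right_diff_distrib)
  then show ?thesis using that c by simp
qed

text \<open>
  The set of all \<open>x + \<epsilon> d x\<close>, where \<open>d\<close> is a derivation of a subring of the corner into the corner;
  the last clause makes \<open>d\<close> a function.  Extending \<open>d\<close> means enlarging this set, which is the form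
  that Zorn's lemma needs.
\<close>

definition derivation_graph :: "'r dual set \<Rightarrow> bool" where
  "derivation_graph G \<longleftrightarrow> (\<forall>u\<in>G. \<forall>v\<in>G. u + v \<in> G \<and> u * v \<in> G) \<and> (\<forall>u\<in>G. - u \<in> G) \<and>
     (\<forall>u\<in>G. p * std u = std u \<and> p * eps u = eps u) \<and> (\<forall>e\<in>E. Dual e 0 \<in> G) \<and>
     (\<forall>u\<in>G. std u = 0 \<longrightarrow> eps u = 0)"

definition polys :: "'r dual set \<Rightarrow> 'r dual poly set" where
  "polys G = {F. \<forall>i. coeff F i \<in> G}"

context
  fixes G assumes G: "derivation_graph G"
begin

lemma G_add: "u \<in> G \<Longrightarrow> v \<in> G \<Longrightarrow> u + v \<in> G"
  and G_mult: "u \<in> G \<Longrightarrow> v \<in> G \<Longrightarrow> u * v \<in> G"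
  and G_minus: "u \<in> G \<Longrightarrow> - u \<in> G"
  and G_E: "e \<in> E \<Longrightarrow> Dual e 0 \<in> G"
  and G_below: "u \<in> G \<Longrightarrow> p * std u = std u" "u \<in> G \<Longrightarrow> p * eps u = eps u"
  and G_single: "u \<in> G \<Longrightarrow> std u = 0 \<Longrightarrow> eps u = 0"
  using G by (auto simp: derivation_graph_def)

lemma G_0: "0 \<in> G"
  using G_add[OF G_E G_minus[OF G_E]] p_mem by fastforce

lemma G_diff: "u \<in> G \<Longrightarrow> v \<in> G \<Longrightarrow> u - v \<in> G"
  using G_add[OF _ G_minus] by fastforce

lemma G_sum: "(\<And>i. i \<in> A \<Longrightarrow> f i \<in> G) \<Longrightarrow> sum f A \<in> G"
  by (induction A rule: infinite_finite_induct) (auto simp: G_0 G_add)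

lemma G_of_nat: "u \<in> G \<Longrightarrow> of_nat n * u \<in> G"
  by (induction n) (auto simp: algebra_simps G_0 G_add)

text \<open>
  The derivation kills idempotents, so it is local: if \<open>x\<close> vanishes on \<open>e\<close>, then so does \<open>d x\<close>.
\<close>

lemma G_local_single:
  assumes "u \<in> G" "e \<in> E" "e * std u = 0" shows "Dual e 0 * u = 0"
proof -
  have "Dual e 0 * u \<in> G" using assms G_E G_mult by blast
  then have "eps (Dual e 0 * u) = 0" by (rule G_single) (use assms in simp)
  then show ?thesis using assms by (intro dual.expand) auto
qed

lemma polys_add: "F \<in> polys G \<Longrightarrow> H \<in> polys G \<Longrightarrow> F + H \<in> polys G"
  and polys_diff: "F \<in> polys G \<Longrightarrow> H \<in> polys G \<Longrightarrow> F - H \<in> polys G"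
  and polys_minus: "F \<in> polys G \<Longrightarrow> - F \<in> polys G"
  and polys_mult: "F \<in> polys G \<Longrightarrow> H \<in> polys G \<Longrightarrow> F * H \<in> polys G"
  and polys_smult: "F \<in> polys G \<Longrightarrow> a \<in> G \<Longrightarrow> smult a F \<in> polys G"
  and polys_monom: "a \<in> G \<Longrightarrow> monom a k \<in> polys G"
  and polys_deriv: "F \<in> polys G \<Longrightarrow> formal_deriv F \<in> polys G"
  by (auto simp: polys_def G_add G_diff G_minus coeff_mult G_sum G_mult G_0
      coeff_formal_deriv G_of_nat simp del: of_nat_Suc)

lemma poly_below:
  assumes F: "F \<in> polys G" 
  shows "p * std (poly F u) = std (poly F u) \<and> p * eps (poly F u) = eps (poly F u)"
proof -
  have "Dual p 0 * u = u" if "u \<in> G" for u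
    using G_below[OF that] by (intro dual.expand) auto
  then have "smult (Dual p 0) F = F"
    using F by (intro poly_eqI) (auto simp: polys_def)
  then have "Dual p 0 * poly F u = poly F u" by (metis poly_smult)
  then have "std (Dual p 0 * poly F u) = std (poly F u)"
    "eps (Dual p 0 * poly F u) = eps (poly F u)" by simp_all
  then show ?thesis by simp
qed

text \<open>
  A polynomial that does not vanish at \<open>u\<close> on \<open>e\<close> has a coefficient that does not vanish on \<open>e\<close>.  The
  highest such coefficient plays the role of the leading one.
\<close>

lemma local_leading_coeff:
  assumes F: "F \<in> polys G" and e: "e \<in> E" and nz: "Dual e 0 * poly F u \<noteq> 0"
    and vanish: "\<And>i. i \<ge> N \<Longrightarrow> e * std (coeff F i) = 0"
  obtains n where "n < N" "e * std (coeff F n) \<noteq> 0" "\<And>i. i > n \<Longrightarrow> e * std (coeff F i) = 0"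
proof -
  have "\<exists>n. e * std (coeff F n) \<noteq> 0"
  proof (rule ccontr)
    assume "\<not> ?thesis"
    then have "smult (Dual e 0) F = 0"
      using G_local_single[OF _ e] F by (intro poly_eqI) (auto simp: polys_def)
    then show False using nz by (metis poly_smult poly_0)
  qed
  then have ex: "\<exists>n. e * std (coeff F n) \<noteq> 0" .
  define n where "n = (GREATEST n. e * std (coeff F n) \<noteq> 0)"
  have bd: "\<And>k. e * std (coeff F k) \<noteq> 0 \<Longrightarrow> k \<le> N"
    using vanish by (metis linorder_le_cases)
  have "e * std (coeff F n) \<noteq> 0"
    unfolding n_def using ex bd by (rule GreatestI_ex_nat)
  moreover have "e * std (coeff F i) = 0" if "i > n" for i
    using Greatest_le_nat[of "\<lambda>n. e * std (coeff F n) \<noteq> 0" i N] bd that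
    unfolding n_def by fastforce
  moreover have "n < N" using vanish calculation(1) by (metis linorder_not_le)
  ultimately show ?thesis using that by blast
qed

end

text \<open>
  On some part of every nonzero idempotent there is an admissible value \<open>c\<close> for the derivative of
  \<open>b\<close>: every polynomial \<open>F\<close> with \<open>F b = 0\<close> there also has vanishing derivative
  \<open>(d F) b + c F' b\<close> there.  If no polynomial vanishes at \<open>b\<close> nontrivially on a part of \<open>e\<close>, then any
  \<open>c\<close> will do.  Otherwise take a relation \<open>F\<close> of least degree \<open>n\<close> over all parts of \<open>e\<close>.  Its formal
  derivative has degree \<open>n - 1\<close>, so it does not vanish at \<open>b\<close> and can be inverted on a smaller part,
  which gives \<open>c\<close>.  Pseudo-division by \<open>F\<close> reduces any other relation to one
  of smaller degree, which is trivial.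
\<close>

lemma local_extension:
  assumes G: "derivation_graph G" and b: "p * b = b" and e: "e \<in> E" "e \<noteq> 0"
  shows "\<exists>e'\<in>E. \<exists>c. p * c = c \<and> e' \<noteq> 0 \<and> e * e' = e' \<and>
    (\<forall>F\<in>polys G. e' * std (poly F (Dual b c)) = 0 \<longrightarrow> e' * eps (poly F (Dual b c)) = 0)"
proof -
  define v where "v c F = poly F (Dual b c)" for c F
  have std_v: "std (v c F) = std (v 0 F)" for c F
    using dual_taylor(1) by (simp add: v_def)
  \<comment> \<open>\<open>Q n e' F\<close>: a relation for \<open>b\<close> on the part \<open>e'\<close> of \<open>e\<close> whose local degree is \<open>n\<close>\<close>
  define Q where "Q n e' F \<longleftrightarrow> e' \<in> E \<and> e' \<noteq> 0 \<and> e * e' = e' \<and> F \<in> polys G \<and>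
    e' * std (v 0 F) = 0 \<and> e' * std (coeff F n) \<noteq> 0 \<and> (\<forall>i>n. e' * std (coeff F i) = 0)"
    for n e' F
  show ?thesis
  proof (cases "\<exists>n e' F. Q n e' F")
    case False
    have "e * eps (v 0 F) = 0" if F: "F \<in> polys G" "e * std (v 0 F) = 0" for F
    proof (rule ccontr)
      assume "e * eps (v 0 F) \<noteq> 0"
      then have "eps (Dual e 0 * v 0 F) \<noteq> 0" by simp
      then have nz: "Dual e 0 * poly F (Dual b 0) \<noteq> 0" unfolding v_def by force
      have "e * std (coeff F i) = 0" if "i \<ge> Suc (degree F)" for i
        using that by (simp add: coeff_eq_0)
      from local_leading_coeff[OF G F(1) e(1) nz this] obtain n where
        "e * std (coeff F n) \<noteq> 0" "\<And>i. i > n \<Longrightarrow> e * std (coeff F i) = 0" by blast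
      then have "Q n e F" using F e idem by (simp add: Q_def)
      then show False using False by blast
    qed
    then show ?thesis using e idem
      by (intro bexI[of _ e] exI[of _ 0]) (auto simp: v_def)
  next
    case True
    then obtain n where "\<exists>e' F. Q n e' F" and min: "\<And>m. m < n \<Longrightarrow> \<not> (\<exists>e' F. Q m e' F)"
      using exists_least_iff[of "\<lambda>n. \<exists>e' F. Q n e' F"] by blast
    then obtain e1 F where Q: "Q n e1 F" by blast
    have e1: "e1 \<in> E" "e * e1 = e1" and F: "F \<in> polys G" and e1v: "e1 * std (v 0 F) = 0"
      and a: "e1 * std (coeff F n) \<noteq> 0" and top: "\<And>i. i > n \<Longrightarrow> e1 * std (coeff F i) = 0"
      using Q by (auto simp: Q_def)
    have coeff_G: "coeff H i \<in> G" if "H \<in> polys G" for H i using that by (simp add: polys_def)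
    have nonvanishing: "H \<in> polys G \<Longrightarrow> e' \<in> E \<Longrightarrow> e * e' = e' \<Longrightarrow> e' * std (v 0 H) = 0 \<Longrightarrow>
        (\<And>i. i \<ge> n \<Longrightarrow> e' * std (coeff H i) = 0) \<Longrightarrow> Dual e' 0 * v c H = 0" for H e' c
    proof (rule ccontr)
      assume H: "H \<in> polys G" "e' \<in> E" "e * e' = e'" "e' * std (v 0 H) = 0"
        "\<And>i. i \<ge> n \<Longrightarrow> e' * std (coeff H i) = 0" and nz: "Dual e' 0 * v c H \<noteq> 0"
      from local_leading_coeff[OF G H(1,2) nz[unfolded v_def] H(5)] obtain m where m:
        "m < n" "e' * std (coeff H m) \<noteq> 0" "\<And>i. i > m \<Longrightarrow> e' * std (coeff H i) = 0" by blast
      then have "Q m e' H" using H by (auto simp: Q_def)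
      then show False using min m by blast
    qed
    obtain e2 y where e2: "e2 \<in> E" "e2 \<noteq> 0" "e1 * e2 = e2" "e2 * (std (coeff F n) * y) = e2"
      using local_inverse_below[OF e1(1) a] G_below(1)[OF G coeff_G[OF F]] by blast
    have ee2: "e * e2 = e2" using below_trans[OF e1(2) e2(3)] .
    have e2z: "e2 * x = 0" if "e1 * x = 0" for x
      using below_eq[OF e2(3), of x 0] that by simp
    have n0: "n > 0"
    proof (rule ccontr)
      assume "\<not> n > 0"
      then have n: "n = 0" by simp
      have "smult (Dual e1 0) F = [:Dual e1 0 * coeff F 0:]"
        using G_local_single[OF G _ e1(1)] coeff_G[OF F] top n
        by (intro poly_eqI) (auto simp: coeff_pCons split: nat.splits)
      then have "Dual e1 0 * v 0 F = Dual e1 0 * coeff F 0"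
        unfolding v_def by (metis poly_smult poly_const_conv)
      from arg_cong[OF this, of std] have "e1 * std (v 0 F) = e1 * std (coeff F 0)" by simp
      then show False using a e1v n by simp
    qed
    let ?F' = "formal_deriv F"
    have F': "?F' \<in> polys G" using polys_deriv[OF G F] .
    have "e2 * std (v 0 ?F') \<noteq> 0"
    proof
      assume z: "e2 * std (v 0 ?F') = 0"
      obtain m where m: "n = Suc m" using n0 by (cases n) auto
      have std_of_nat: "std (of_nat k * u) = of_nat k * std u" for k and u :: "'r dual"
        by (induction k) (auto simp: algebra_simps)
      have cf: "std (coeff ?F' i) = of_nat (Suc i) * std (coeff F (Suc i))" for i
        by (simp only: coeff_formal_deriv std_of_nat)
      have "e2 * std (coeff ?F' m) \<noteq> 0"
      proof
        assume "e2 * std (coeff ?F' m) = 0"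
        then have "of_nat (Suc m) * (e2 * std (coeff F n)) = 0"
          by (simp add: cf m mult_ac del: of_nat_Suc)
        then have "e2 * std (coeff F n) = 0"
          using of_nat_cancel[of "e2 * std (coeff F n)" "Suc m"] below[OF e2(1)]
          by (simp flip: mult.assoc del: of_nat_Suc)
        then show False using e2 by (metis mult.assoc mult_zero_left)
      qed
      moreover have "e2 * std (coeff ?F' i) = 0" if "i > m" for i
        using e2z[OF top[of "Suc i"]] that
        by (simp add: cf m mult.left_commute[of e2] del: of_nat_Suc)
      ultimately have "Q m e2 ?F'" using z e2 ee2 F' by (simp add: Q_def)
      then show False using min m by blast
    qed
    then obtain e3 y' where e3: "e3 \<in> E" "e3 \<noteq> 0" "e2 * e3 = e3" "e3 * (std (v 0 ?F') * y') = e3"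
      using local_inverse_below[OF e2(1)] poly_below[OF G F'] unfolding v_def by metis
    have e3z: "e3 * x = 0" if "e1 * x = 0" for x
      using below_eq[OF e3(3), of x 0] e2z[OF that] by simp
    have ee3: "e * e3 = e3" using below_trans[OF ee2 e3(3)] .
    have e3y: "e3 * (std (coeff F n) * y) = e3"
    proof -
      have "e2 * (std (coeff F n) * y) = e2 * 1" using e2 by simp
      from below_eq[OF e3(3) this] show ?thesis by simp
    qed
    \<comment> \<open>the solution of \<open>(d F) b + c F' b = 0\<close> on \<open>e3\<close>, where \<open>y'\<close> inverts \<open>F' b\<close>\<close>
    define c where "c = - (eps (v 0 F) * y' * e3)"
    have pc: "p * c = c" using below[OF e3(1)] by (simp add: c_def mult.left_commute[of p])
    have vF: "Dual e3 0 * v c F = 0"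
    proof (rule dual.expand, intro conjI)
      show "std (Dual e3 0 * v c F) = std 0" using e3z[OF e1v] std_v[of c F] by simp
      have "e3 * eps (v c F) = e3 * eps (v 0 F) + e3 * c * std (v 0 ?F')"
        by (simp add: v_def dual_taylor(2)[of F b c] algebra_simps)
      also have "e3 * c * std (v 0 ?F') = - (e3 * e3 * (std (v 0 ?F') * y') * eps (v 0 F))"
        by (simp add: c_def mult_ac)
      also have "\<dots> = - (e3 * eps (v 0 F))" using e3 idem by simp
      finally show "eps (Dual e3 0 * v c F) = eps 0" by simp
    qed
    have "Dual e3 0 * v c g = 0"
      if "g \<in> polys G" "e3 * std (v 0 g) = 0" "\<And>i. i \<ge> N \<Longrightarrow> e3 * std (coeff g i) = 0" for g N
      using that
    proof (induction N arbitrary: g)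
      case 0
      then show ?case using nonvanishing[OF 0(1) e3(1) ee3] by blast
    next
      case (Suc m)
      show ?case
      proof (cases "m < n")
        case True
        then show ?thesis using nonvanishing[OF Suc(2) e3(1) ee3] Suc(3,4) by simp
      next
        case False
        \<comment> \<open>one step of pseudo-division by \<open>F\<close>: the coefficient in degree \<open>m\<close> cancels on \<open>e3\<close>\<close>
        define g1 where "g1 = smult (coeff F n) g - monom (coeff g m) (m - n) * F"
        have g1: "g1 \<in> polys G"
          unfolding g1_def by (intro polys_diff polys_smult polys_mult polys_monom G Suc coeff_G F)
        have vg1: "v c' g1 = coeff F n * v c' g - coeff g m * Dual b c' ^ (m - n) * v c' F" for c'
          by (simp add: g1_def v_def poly_monom)
        have "e3 * std (v 0 g1) = std (coeff F n) * (e3 * std (v 0 g)) -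
            std (coeff g m * Dual b 0 ^ (m - n)) * (e3 * std (v 0 F))"
          by (simp add: vg1 algebra_simps)
        then have s: "e3 * std (v 0 g1) = 0" using Suc(3) e3z[OF e1v] by simp
        have "e3 * std (coeff g1 i) = 0" if i: "i \<ge> m" for i
        proof -
          have "e3 * std (coeff g1 i) = std (coeff F n) * (e3 * std (coeff g i)) -
            std (coeff g m) * (e3 * std (coeff F (i - (m - n))))"
          proof -
            have "coeff (monom (coeff g m) (m - n) * F) i = coeff g m * coeff F (i - (m - n))"
              using False i by (simp add: coeff_monom_mult)
            then have "coeff g1 i = coeff F n * coeff g i - coeff g m * coeff F (i - (m - n))"
              by (simp add: g1_def)
            then show ?thesis by (simp add: right_diff_distrib mult.left_commute)
          qed
          moreover have "\<dots> = 0"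
          proof (cases "i = m")
            case True
            then show ?thesis using False by (simp add: algebra_simps)
          next
            case False
            then have "e3 * std (coeff g i) = 0" using Suc(4) i by simp
            moreover have "e3 * std (coeff F (i - (m - n))) = 0"
              using e3z[OF top[of "i - (m - n)"]] False i \<open>\<not> m < n\<close> by simp
            ultimately show ?thesis by simp
          qed
          ultimately show ?thesis by simp
        qed
        then have "Dual e3 0 * v c g1 = 0" using Suc.IH[OF g1 s] by blast
        moreover have "Dual e3 0 * v c g1 = coeff F n * (Dual e3 0 * v c g) -
            coeff g m * Dual b c ^ (m - n) * (Dual e3 0 * v c F)"
          by (simp add: vg1 algebra_simps)
        ultimately have z: "coeff F n * (Dual e3 0 * v c g) = 0" using vF by simp
        have s0: "e3 * std (v c g) = 0" using Suc(3) std_v[of c g] by simp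
        from arg_cong[OF z, of eps] have "std (coeff F n) * (e3 * eps (v c g)) = 0"
          using s0 by simp
        then have "(std (coeff F n) * (e3 * eps (v c g))) * y = 0" by simp
        then have "e3 * (std (coeff F n) * y) * eps (v c g) = 0" by (simp add: mult_ac)
        then have "e3 * eps (v c g) = 0" using e3y by simp
        then show ?thesis using s0 by (intro dual.expand) simp
      qed
    qed
    note main = this
    have "e3 * eps (v c g) = 0" if g: "g \<in> polys G" "e3 * std (v c g) = 0" for g
    proof -
      have "Dual e3 0 * v c g = 0"
        using main[OF g(1), of "Suc (degree g)"] g(2) std_v[of c g] by (simp add: coeff_eq_0)
      from arg_cong[OF this, of eps] show ?thesis by simp
    qed
    then show ?thesis using e3 ee3 pc unfolding v_def by blast
  qed
qed

definition adjoin :: "'r dual set \<Rightarrow> 'r dual \<Rightarrow> 'r dual set" where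
  "adjoin G u = (\<lambda>F. poly F u) ` polys G"

lemma derivation_graph_adjoin:
  assumes G: "derivation_graph G"
    and single: "\<And>F. F \<in> polys G \<Longrightarrow> std (poly F u) = 0 \<Longrightarrow> eps (poly F u) = 0"
  shows "derivation_graph (adjoin G u)" and "G \<subseteq> adjoin G u"
    and "p * std u = std u \<Longrightarrow> p * eps u = eps u \<Longrightarrow> u \<in> adjoin G u"
proof -
  show sub: "G \<subseteq> adjoin G u"
  proof
    fix g assume "g \<in> G"
    then have "[:g:] \<in> polys G"
      by (auto simp: polys_def coeff_pCons G_0[OF G] split: nat.splits)
    then show "g \<in> adjoin G u" unfolding adjoin_def by (rule rev_image_eqI) simp
  qed
  show "derivation_graph (adjoin G u)"
    unfolding derivation_graph_def
  proof (intro conjI ballI impI)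
    fix a b assume "a \<in> adjoin G u" "b \<in> adjoin G u"
    then obtain F H where "F \<in> polys G" "H \<in> polys G" "a = poly F u" "b = poly H u"
      by (auto simp: adjoin_def)
    then show "a + b \<in> adjoin G u" "a * b \<in> adjoin G u"
      using polys_add[OF G] polys_mult[OF G] unfolding adjoin_def
      by (metis poly_add image_eqI, metis poly_mult image_eqI)
  next
    fix a assume "a \<in> adjoin G u"
    then obtain F where F: "F \<in> polys G" "a = poly F u" by (auto simp: adjoin_def)
    then show "- a \<in> adjoin G u"
      using polys_minus[OF G] unfolding adjoin_def by (metis poly_minus image_eqI)
    show "p * std a = std a" "p * eps a = eps a" using poly_below[OF G F(1)] F by auto
    show "eps a = 0" if "std a = 0" using single F that by blast
  next
    fix e assume "e \<in> E"
    then show "Dual e 0 \<in> adjoin G u" using G_E[OF G] sub by blast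
  qed
  assume u: "p * std u = std u" "p * eps u = eps u"
  have "monom (Dual p 0) 1 \<in> polys G" using polys_monom[OF G] G_E[OF G p_mem] by blast
  moreover have "poly (monom (Dual p 0) 1) u = u"
    using u by (intro dual.expand) (simp add: poly_monom)
  ultimately show "u \<in> adjoin G u" unfolding adjoin_def by (metis image_eqI)
qed

text \<open>
  The admissible values of \<open>local_extension\<close> patch together to a value on the whole corner, and the
  derivation extends to the ring generated by \<open>b\<close>.
\<close>

lemma extend_derivation:
  assumes G: "derivation_graph G" and b: "p * b = b"
  shows "\<exists>c. derivation_graph (adjoin G (Dual b c)) \<and> G \<subseteq> adjoin G (Dual b c) \<and> Dual b c \<in> adjoin G (Dual b c)"
proof -
  define good where "good e c \<longleftrightarrow> (\<forall>F\<in>polys G. e * std (poly F (Dual b c)) = 0 \<longrightarrow>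
    e * eps (poly F (Dual b c)) = 0)" for e c
  have cong: "good e c'" if "e \<in> E" "good e c" "e * c = e * c'" for e c c'
    unfolding good_def
  proof (intro ballI impI)
    fix F assume F: "F \<in> polys G" "e * std (poly F (Dual b c')) = 0"
    then have "e * eps (poly F (Dual b c)) = 0"
      using that(2) dual_taylor(1)[of F b] unfolding good_def by metis
    moreover have "e * eps (poly F (Dual b c')) = e * eps (poly F (Dual b c))"
    proof -
      have "e * (c' * std (poly (formal_deriv F) (Dual b 0))) =
          e * (c * std (poly (formal_deriv F) (Dual b 0)))"
        using that(3) by (metis mult.assoc)
      then show ?thesis
        by (simp add: dual_taylor(2)[of F b c] dual_taylor(2)[of F b c'] distrib_left)
    qed
    ultimately show "e * eps (poly F (Dual b c')) = 0" by simp
  qed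
  have dense: "\<exists>e'\<in>E. \<exists>c. p * c = c \<and> e' \<noteq> 0 \<and> e * e' = e' \<and> good e' c"
    if "e \<in> E" "e \<noteq> 0" for e
    using local_extension[OF G b that] unfolding good_def .
  have "\<exists>c. p * c = c \<and> (\<forall>w. p * w = w \<longrightarrow> (\<forall>e\<in>E. good e c \<longrightarrow> e * w = 0) \<longrightarrow> w = 0)"
  proof (rule patch[of good])
    show "good e c'" if "e \<in> E" "good e c" "e * c = e * c'" for e c c' using cong that by blast
  qed (fact dense)
  then obtain c where "p * c = c"
    "\<forall>w. p * w = w \<longrightarrow> (\<forall>e\<in>E. good e c \<longrightarrow> e * w = 0) \<longrightarrow> w = 0"
    by blast
  note c = this(1) this(2)[rule_format]
  have "eps (poly F (Dual b c)) = 0" if "F \<in> polys G" "std (poly F (Dual b c)) = 0" for F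
    using c(2)[of "eps (poly F (Dual b c))"] poly_below[OF G that(1)] that
    unfolding good_def by auto
  from derivation_graph_adjoin[OF G this] b c(1) show ?thesis by auto
qed

text \<open>
  The step functions: they are the initial domain, and every derivation vanishes on them.
\<close>

inductive_set simple_elements :: "'r set" where
  simple_const: "\<kappa> a \<in> simple_elements"
| simple_idem: "e \<in> E \<Longrightarrow> e \<in> simple_elements"
| simple_add: "x \<in> simple_elements \<Longrightarrow> y \<in> simple_elements \<Longrightarrow> x + y \<in> simple_elements"
| simple_mult: "x \<in> simple_elements \<Longrightarrow> y \<in> simple_elements \<Longrightarrow> x * y \<in> simple_elements"
| simple_minus: "x \<in> simple_elements \<Longrightarrow> - x \<in> simple_elements"

lemma \<kappa>_minus: "\<kappa> (- a) = - \<kappa> a"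
  using \<kappa>_add[of a "- a"] by (simp add: eq_neg_iff_add_eq_0 add.commute)

lemma \<kappa>_diff: "\<kappa> (a - b) = \<kappa> a - \<kappa> b"
  using \<kappa>_add[of a "- b"] by (simp add: \<kappa>_minus)

lemma simple_below: "x \<in> simple_elements \<Longrightarrow> p * x = x"
proof (induction rule: simple_elements.induct)
  case (simple_mult x y)
  then show ?case by (metis mult.assoc)
qed (auto simp: \<kappa>_below below distrib_left)

lemma simple_locally_constant:
  assumes "x \<in> simple_elements" "e \<in> E" "e \<noteq> 0"
  shows "\<exists>e'\<in>E. e' \<noteq> 0 \<and> e * e' = e' \<and> (\<exists>a. e' * x = e' * \<kappa> a)"
  using assms
proof (induction x arbitrary: e)
  case (simple_const a)
  then show ?case using idem by blast
next
  case (simple_idem f)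
  show ?case
  proof (cases "e * f = 0")
    case True
    then show ?thesis using simple_idem idem by (intro bexI[of _ e] conjI exI[of _ 0]) auto
  next
    case False
    then obtain e' y where e': "e' \<in> E" "e' \<noteq> 0" "e * e' = e'" "e' * (f * y) = e'"
      using local_inverse_below[OF simple_idem(2) False] below[OF simple_idem(1)] by blast
    have "e' * f = e' * (f * y) * f" using e' by simp
    also have "\<dots> = e' * (f * f * y)" by (simp add: mult_ac)
    also have "\<dots> = e' * (f * y)" using idem[OF simple_idem(1)] by simp
    also have "\<dots> = e'" using e' by simp
    finally have "e' * f = e'" .
    then have "e' * f = e' * \<kappa> 1" using below[OF e'(1)] by (simp add: \<kappa>_1 mult.commute)
    then show ?thesis using e' by blast
  qed
next
  case (simple_add x y)
  then obtain e1 a where e1: "e1 \<in> E" "e1 \<noteq> 0" "e * e1 = e1" "e1 * x = e1 * \<kappa> a" by blast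
  then obtain e2 b where e2: "e2 \<in> E" "e2 \<noteq> 0" "e1 * e2 = e2" "e2 * y = e2 * \<kappa> b"
    using simple_add by blast
  have "e2 * x = e2 * \<kappa> a" using below_eq[OF e2(3) e1(4)] .
  then have "e2 * (x + y) = e2 * \<kappa> (a + b)" using e2 by (simp add: \<kappa>_add distrib_left)
  moreover have "e * e2 = e2" using below_trans[OF e1(3) e2(3)] .
  ultimately show ?case using e2 by blast
next
  case (simple_mult x y)
  then obtain e1 a where e1: "e1 \<in> E" "e1 \<noteq> 0" "e * e1 = e1" "e1 * x = e1 * \<kappa> a" by blast
  then obtain e2 b where e2: "e2 \<in> E" "e2 \<noteq> 0" "e1 * e2 = e2" "e2 * y = e2 * \<kappa> b"
    using simple_mult by blast
  have "e2 * x = e2 * \<kappa> a" using below_eq[OF e2(3) e1(4)] .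
  then have "e2 * (x * y) = (e2 * \<kappa> a) * y" by (simp flip: mult.assoc)
  also have "\<dots> = \<kappa> a * (e2 * y)" by (simp add: mult_ac)
  also have "\<dots> = e2 * \<kappa> (a * b)" using e2 by (simp add: \<kappa>_mult mult_ac)
  finally have "e2 * (x * y) = e2 * \<kappa> (a * b)" .
  moreover have "e * e2 = e2" using below_trans[OF e1(3) e2(3)] .
  ultimately show ?case using e2 by blast
next
  case (simple_minus x)
  then obtain e1 a where e1: "e1 \<in> E" "e1 \<noteq> 0" "e * e1 = e1" "e1 * x = e1 * \<kappa> a" by blast
  then have "e1 * (- x) = e1 * \<kappa> (- a)" by (simp add: \<kappa>_minus)
  then show ?case using e1 by blast
qed

lemma simple_locally_constant_finite:
  assumes "finite I" "\<And>i. i \<in> I \<Longrightarrow> x i \<in> simple_elements" "e \<in> E" "e \<noteq> 0"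
  shows "\<exists>e'\<in>E. e' \<noteq> 0 \<and> e * e' = e' \<and> (\<exists>a. \<forall>i\<in>I. e' * x i = e' * \<kappa> (a i))"
  using assms
proof (induction I rule: finite_induct)
  case empty
  then show ?case using idem by auto
next
  case (insert i I)
  then obtain e1 a where e1: "e1 \<in> E" "e1 \<noteq> 0" "e * e1 = e1" "\<forall>i\<in>I. e1 * x i = e1 * \<kappa> (a i)"
    by auto
  obtain e2 b where e2: "e2 \<in> E" "e2 \<noteq> 0" "e1 * e2 = e2" "e2 * x i = e2 * \<kappa> b"
    using simple_locally_constant[of "x i"] insert e1 by blast
  have "e2 * x j = e2 * \<kappa> (a j)" if "j \<in> I" for j
    using below_eq[OF e2(3)] e1(4) that by blast
  then have "\<forall>j\<in>insert i I. e2 * x j = e2 * \<kappa> ((a(i := b)) j)" using e2 insert by auto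
  moreover have "e * e2 = e2" using below_trans[OF e1(3) e2(3)] .
  ultimately show ?case using e2 by blast
qed

text \<open>
  An element that is constant on no nonzero idempotent is not a root of a nonzero complex polynomial on any
  of them, since the polynomial splits into linear factors, each of which is locally invertible.
\<close>

lemma transcendental_constant_poly:
  fixes \<phi> :: "complex poly"
  assumes z: "p * z = z" and nc: "\<And>e a. e \<in> E \<Longrightarrow> e * z = e * \<kappa> a \<Longrightarrow> e = 0"
    and e: "e \<in> E" "e * poly (map_poly \<kappa> \<phi>) z = 0" and \<phi>: "\<phi> \<noteq> 0"
  shows "e = 0"
  using e(2) \<phi>
proof (induction "degree \<phi>" arbitrary: \<phi>)
  case 0
  then obtain a where a: "\<phi> = [:a:]" "a \<noteq> 0" by (metis degree_eq_zeroE pCons_eq_0_iff)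
  then have "e * \<kappa> a = 0" using 0 by (simp add: map_poly_pCons)
  then have "e * (\<kappa> a * \<kappa> (inverse a)) = 0" by (simp flip: mult.assoc)
  then show ?case using a e below by (simp flip: \<kappa>_mult add: \<kappa>_1 mult.commute)
next
  case (Suc n)
  then obtain a where "poly \<phi> a = 0"
    using fundamental_theorem_of_algebra[of \<phi>] by (metis constant_degree Zero_not_Suc)
  then obtain \<psi> where \<psi>: "\<phi> = [:- a, 1:] * \<psi>" by (metis poly_eq_0_iff_dvd dvdE)
  then have "\<psi> \<noteq> 0" using Suc by auto
  moreover from this have "degree \<phi> = Suc (degree \<psi>)" unfolding \<psi> by (subst degree_mult_eq) auto
  ultimately have \<psi>0: "\<psi> \<noteq> 0" "degree \<psi> = n" using Suc by auto
  have "map_poly \<kappa> \<phi> = [:- \<kappa> a, p:] * map_poly \<kappa> \<psi>"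
    by (rule poly_eqI)
      (auto simp: \<psi> coeff_map_poly \<kappa>_diff \<kappa>_minus \<kappa>_mult coeff_pCons \<kappa>_below split: nat.splits)
  then have "poly (map_poly \<kappa> \<phi>) z = (p * z - \<kappa> a) * poly (map_poly \<kappa> \<psi>) z"
    by (simp only: poly_mult) (simp add: algebra_simps)
  then have "e * ((p * z - \<kappa> a) * poly (map_poly \<kappa> \<psi>) z) = 0"
    using Suc by simp
  then have 1: "(z - \<kappa> a) * (e * poly (map_poly \<kappa> \<psi>) z) = 0" using z by (simp add: mult_ac)
  show ?case
  proof (cases "e * poly (map_poly \<kappa> \<psi>) z = 0")
    case True
    then show ?thesis using Suc(1)[of \<psi>] \<psi>0 by blast
  next
    case False
    have "p * (e * poly (map_poly \<kappa> \<psi>) z) = e * poly (map_poly \<kappa> \<psi>) z"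
      using below e by (simp flip: mult.assoc)
    from local_inverse[OF this False] obtain y where
      y: "e * poly (map_poly \<kappa> \<psi>) z * y \<in> E" "e * poly (map_poly \<kappa> \<psi>) z * y \<noteq> 0" by blast
    have "(z - \<kappa> a) * (e * poly (map_poly \<kappa> \<psi>) z) * y = 0" by (simp add: 1)
    then have "e * poly (map_poly \<kappa> \<psi>) z * y * z = e * poly (map_poly \<kappa> \<psi>) z * y * \<kappa> a"
      by (simp add: algebra_simps)
    then show ?thesis using nc y by blast
  qed
qed

text \<open>
  Start with \<open>d/dz\<close> on the polynomials in \<open>z\<close> over the step functions.  It is well defined: on a
  nonzero idempotent on which all coefficients are constant, a polynomial relation for \<open>z\<close> is
  trivial.  A maximal extension is defined on the whole corner by \<open>extend_derivation\<close>.
\<close>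

theorem derivation_exists:
  assumes z: "p * z = z" and nc: "\<And>e a. e \<in> E \<Longrightarrow> e * z = e * \<kappa> a \<Longrightarrow> e = 0"
  obtains D where "\<And>x. p * D x = D x" "\<And>x y. D (x + y) = D x + D y"
    "\<And>x y. D (x * y) = D x * y + x * D y" "\<And>a x. D (\<kappa> a * x) = \<kappa> a * D x"
    "\<And>e. e \<in> E \<Longrightarrow> D e = 0" "D z = p"
proof -
  define G0 where "G0 = (\<lambda>x. Dual x 0) ` simple_elements"
  have G0: "derivation_graph G0"
    unfolding derivation_graph_def
  proof (intro conjI ballI impI)
    fix u v assume "u \<in> G0" "v \<in> G0"
    then obtain x y where xy: "x \<in> simple_elements" "y \<in> simple_elements" "u = Dual x 0" "v = Dual y 0"
      by (auto simp: G0_def)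
    have "u + v = Dual (x + y) 0" "u * v = Dual (x * y) 0"
      using xy by (auto intro: dual.expand)
    then show "u + v \<in> G0" "u * v \<in> G0"
      using xy simple_elements.intros by (auto simp: G0_def)
  next
    fix u assume "u \<in> G0"
    then obtain x where x: "x \<in> simple_elements" "u = Dual x 0" by (auto simp: G0_def)
    then have "- u = Dual (- x) 0" by (auto intro: dual.expand)
    then show "- u \<in> G0" using x simple_elements.intros by (auto simp: G0_def)
    show "p * std u = std u" "p * eps u = eps u" "eps u = 0" using x simple_below by auto
  next
    fix e assume "e \<in> E" then show "Dual e 0 \<in> G0"
      using simple_elements.intros by (auto simp: G0_def)
  qed
  have "eps (poly F (Dual z p)) = 0" if F: "F \<in> polys G0" "std (poly F (Dual z p)) = 0" for F
  proof (rule ccontr)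
    assume nz: "eps (poly F (Dual z p)) \<noteq> 0"
    let ?w = "eps (poly F (Dual z p))"
    have pw: "p * ?w = ?w" using poly_below[OF G0 F(1)] by blast
    then obtain y where y: "?w * y \<in> E" "?w * y \<noteq> 0" using local_inverse nz by blast
    have cf: "coeff F i = Dual (std (coeff F i)) 0 \<and> std (coeff F i) \<in> simple_elements" for i
      using F(1) by (auto simp: polys_def G0_def) (metis (no_types, lifting) dual.sel(1) imageE)+
    obtain e a where e: "e \<in> E" "e \<noteq> 0" "?w * y * e = e"
      "\<And>i. i \<le> degree F \<Longrightarrow> e * std (coeff F i) = e * \<kappa> (a i)"
      using simple_locally_constant_finite[of "{..degree F}" "\<lambda>i. std (coeff F i)" "?w * y"] y cf
      by auto
    define \<phi> where "\<phi> = (\<Sum>i\<le>degree F. monom (a i) i)"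
    have \<phi>: "coeff \<phi> i = (if i \<le> degree F then a i else 0)" for i
      by (simp add: \<phi>_def coeff_sum)
    have ek: "e * std (coeff F i) = e * \<kappa> (coeff \<phi> i)" for i
      using e(4)[of i] by (auto simp: \<phi> coeff_eq_0)
    have eq: "smult (Dual e 0) F = smult (Dual e 0) (map_poly (\<lambda>a. Dual (\<kappa> a) 0) \<phi>)"
    proof (rule poly_eqI)
      fix i
      have "Dual e 0 * coeff F i = Dual e 0 * Dual (\<kappa> (coeff \<phi> i)) 0"
      proof (rule dual.expand, intro conjI)
        have "eps (coeff F i) = 0" using cf[of i] by (metis dual.sel(2))
        then show "eps (Dual e 0 * coeff F i) = eps (Dual e 0 * Dual (\<kappa> (coeff \<phi> i)) 0)" by simp
      qed (simp add: ek)
      then show "coeff (smult (Dual e 0) F) i =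
          coeff (smult (Dual e 0) (map_poly (\<lambda>a. Dual (\<kappa> a) 0) \<phi>)) i"
        by (simp add: coeff_map_poly zero_dual_def)
    qed
    have std_map: "std (poly (map_poly (\<lambda>a. Dual (\<kappa> a) 0) \<psi>) (Dual z p)) = poly (map_poly \<kappa> \<psi>) z" for \<psi>
    proof (induction \<psi>)
      case (pCons a \<psi>)
      then show ?case by (simp add: map_poly_pCons zero_dual_def)
    qed simp
    have "Dual e 0 * poly F (Dual z p) =
        Dual e 0 * poly (map_poly (\<lambda>a. Dual (\<kappa> a) 0) \<phi>) (Dual z p)"
      using eq by (metis poly_smult)
    note eq' = this
    from arg_cong[OF eq', of std] have "e * poly (map_poly \<kappa> \<phi>) z = 0"
      using F(2) std_map[of \<phi>] by simp
    then have "\<phi> = 0" using transcendental_constant_poly[of z e \<phi>] z nc e(1,2) by blast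
    then have "Dual e 0 * poly F (Dual z p) = 0" using eq' by simp
    from arg_cong[OF this, of eps] have "e * ?w = 0" by simp
    then have "?w * y * e = 0" by (metis mult.assoc mult.commute mult_zero_left)
    then show False using e by simp
  qed
  from derivation_graph_adjoin[OF G0 this] obtain G1 where G1: "derivation_graph G1" "G0 \<subseteq> G1" "Dual z p \<in> G1"
    using z idem[OF p_mem] by auto
  define \<A> where "\<A> = {G. derivation_graph G \<and> G1 \<subseteq> G}"
  have "\<exists>G\<in>\<A>. \<forall>X\<in>\<A>. G \<subseteq> X \<longrightarrow> X = G"
  proof (rule subset_Zorn_nonempty)
    show "\<A> \<noteq> {}" using G1 by (auto simp: \<A>_def)
    fix C assume ne: "C \<noteq> {}" and "subset.chain \<A> C"
    then have CA: "\<And>X. X \<in> C \<Longrightarrow> derivation_graph X \<and> G1 \<subseteq> X"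
      and tot: "\<And>X Y. X \<in> C \<Longrightarrow> Y \<in> C \<Longrightarrow> X \<subseteq> Y \<or> Y \<subseteq> X"
      by (auto simp: subset_chain_def \<A>_def)
    have "derivation_graph (\<Union>C)"
      unfolding derivation_graph_def
    proof (intro conjI ballI impI)
      fix u v assume "u \<in> \<Union>C" "v \<in> \<Union>C"
      then obtain X where "X \<in> C" "u \<in> X" "v \<in> X" using tot by blast
      then show "u + v \<in> \<Union>C" "u * v \<in> \<Union>C" using CA[of X] by (auto simp: derivation_graph_def)
    next
      fix u assume "u \<in> \<Union>C"
      then obtain X where X: "X \<in> C" "u \<in> X" by blast
      then have "derivation_graph X" using CA by blast
      then show "- u \<in> \<Union>C" "p * std u = std u" "p * eps u = eps u" "std u = 0 \<Longrightarrow> eps u = 0"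
        using X by (auto simp: derivation_graph_def)
    next
      fix e assume "e \<in> E" then show "Dual e 0 \<in> \<Union>C"
        using CA ne by (auto simp: derivation_graph_def)
    qed
    then show "\<Union>C \<in> \<A>" using CA ne by (auto simp: \<A>_def)
  qed
  then obtain G where G: "derivation_graph G" "G1 \<subseteq> G" and max: "\<And>X. derivation_graph X \<Longrightarrow> G \<subseteq> X \<Longrightarrow> X = G"
    by (auto simp: \<A>_def)
  have "\<exists>c. Dual b c \<in> G" if "p * b = b" for b
    using extend_derivation[OF G(1) that] max by blast
  moreover have pp: "p * (p * x) = p * x" for x using idem[OF p_mem] by (simp flip: mult.assoc)
  ultimately have "\<forall>x. \<exists>c. Dual (p * x) c \<in> G" by blast
  then obtain D where D: "\<And>x. Dual (p * x) (D x) \<in> G" by metis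
  have uniq: "c = c'" if "Dual x c \<in> G" "Dual x c' \<in> G" for x c c'
    using G_single[OF G(1) G_diff[OF G(1) that]] by simp
  have D_eq: "D x = c" if "Dual (p * x) c \<in> G" for x c using uniq D that by blast
  have D_below: "p * D x = D x" for x using G_below(2)[OF G(1) D[of x]] by simp
  have dual_mult: "Dual a b * Dual c d = Dual (a * c) (b * c + a * d)"
    and dual_add: "Dual a b + Dual c d = Dual (a + c) (b + d)" for a b c d :: 'r
    by (auto intro: dual.expand)
  have D_mult: "D (x * y) = D x * y + x * D y" for x y
  proof (rule D_eq)
    have "D x * (p * y) + p * x * D y = D x * y + x * D y"
      using D_below[of x] D_below[of y] by (metis mult.assoc mult.commute)
    moreover have "p * x * (p * y) = p * (x * y)" using pp by (metis mult.assoc mult.commute)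
    ultimately show "Dual (p * (x * y)) (D x * y + x * D y) \<in> G"
      using G_mult[OF G(1) D[of x] D[of y]] by (simp add: dual_mult)
  qed
  have D_simple: "D x = 0" if "x \<in> simple_elements" for x
    using D_eq[of x 0] that simple_below[OF that] G1(2) G(2) by (auto simp: G0_def)
  show ?thesis
  proof
    show "D (x + y) = D x + D y" for x y
      using D_eq[of "x + y" "D x + D y"] G_add[OF G(1) D[of x] D[of y]]
      by (simp add: dual_add distrib_left)
    show "D (\<kappa> a * x) = \<kappa> a * D x" for a x
      using D_simple[OF simple_const] by (simp add: D_mult)
    show "D e = 0" if "e \<in> E" for e using that D_simple simple_idem by blast
    show "D z = p" using D_eq[of z p] z G1 G(2) by auto
  qed (fact D_below D_mult)+
qed

end


section \<open>Complex Hilbert spaces\<close>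

instance complex_hilbert_space \<subseteq> banach ..

lemma scaleC_zero_left [simp]: "0 *\<^sub>C (x::'h::complex_hilbert_space) = 0"
  using scaleC_of_real[of 0 x] by simp

lemma scaleC_zero_right [simp]: "c *\<^sub>C (0::'h::complex_hilbert_space) = 0"
  using scaleC_scaleC[of c 0 "0::'h"] by simp

lemma scaleC_one [simp]: "1 *\<^sub>C (x::'h::complex_hilbert_space) = x"
  using scaleC_of_real[of 1 x] by simp

lemma scaleC_minus1: "(-1) *\<^sub>C (x::'h::complex_hilbert_space) = - x"
  using scaleC_of_real[of "-1" x] by simp

lemma scaleC_minus_right: "c *\<^sub>C (- x) = - (c *\<^sub>C (x::'h::complex_hilbert_space))"
  using scaleC_add_right[of c x "- x"] by (simp add: eq_neg_iff_add_eq_0 add.commute)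

lemma scaleC_diff_right: "c *\<^sub>C (x - y) = c *\<^sub>C x - c *\<^sub>C (y::'h::complex_hilbert_space)"
  using scaleC_add_right[of c x "- y"] by (simp add: scaleC_minus_right)

lemma scaleR_scaleC: "r *\<^sub>R (x::'h::complex_hilbert_space) = complex_of_real r *\<^sub>C x"
  by (simp add: scaleC_of_real)

lemma cinner_add_right: "cinner (x::'h::complex_hilbert_space) (y + z) = cinner x y + cinner x z"
  by (metis cinner_add_left cinner_commute complex_cnj_add)

lemma cinner_scaleC_right: "cinner (x::'h::complex_hilbert_space) (c *\<^sub>C y) = cnj c * cinner x y"
  by (metis cinner_scaleC_left cinner_commute complex_cnj_mult)

lemma cinner_zero_left [simp]: "cinner (0::'h::complex_hilbert_space) y = 0"
  using cinner_scaleC_left[of 0 "0::'h" y] by simp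

lemma cinner_zero_right [simp]: "cinner (x::'h::complex_hilbert_space) 0 = 0"
  using cinner_scaleC_right[of x 0 "0::'h"] by simp

lemma cinner_diff_left: "cinner (x - y) z = cinner x z - cinner (y::'h::complex_hilbert_space) z"
  using cinner_add_left[of "x - y" y z] by simp

lemma cinner_diff_right: "cinner x (y - z) = cinner x y - cinner (x::'h::complex_hilbert_space) z"
  using cinner_add_right[of x "y - z" z] by simp

lemma cinner_scaleR_left: "cinner (r *\<^sub>R x) y = of_real r * cinner (x::'h::complex_hilbert_space) y"
  by (simp add: scaleR_scaleC cinner_scaleC_left)

lemma cinner_scaleR_right: "cinner x (r *\<^sub>R y) = of_real r * cinner (x::'h::complex_hilbert_space) y"
  by (simp add: scaleR_scaleC cinner_scaleC_right)

lemma cinner_self: "cinner x x = of_real ((norm (x::'h::complex_hilbert_space))\<^sup>2)"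
proof (rule complex_eqI)
  have "cnj (cinner x x) = cinner x x" by (metis cinner_commute)
  then show "Im (cinner x x) = Im (of_real ((norm x)\<^sup>2))"
    by (metis Im_complex_of_real complex_cnj_cancel_iff complex_In_mult_cnj_zero complex_is_Real_iff Reals_cnj_iff)
qed (simp add: Re_cinner power2_norm_eq_inner)

lemma cinner_conv_inner: "cinner x y = Complex (inner x y) (inner x (\<i> *\<^sub>C (y::'h::complex_hilbert_space)))"
  by (simp add: complex_eq_iff Re_cinner flip: Re_cinner add: cinner_scaleC_right)

lemma norm_scaleC: "norm (c *\<^sub>C x) = cmod c * norm (x::'h::complex_hilbert_space)"
proof -
  have "of_real ((norm (c *\<^sub>C x))\<^sup>2) = (of_real ((cmod c * norm x)\<^sup>2) :: complex)"
    unfolding cinner_self[symmetric] cinner_scaleC_left cinner_scaleC_right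
    by (simp add: cinner_self power_mult_distrib complex_norm_square mult_ac
        del: of_real_power)
  then have "(norm (c *\<^sub>C x))\<^sup>2 = (cmod c * norm x)\<^sup>2" using of_real_eq_iff by blast
  then show ?thesis by (simp add: power2_eq_iff_nonneg)
qed

lemma bounded_linear_scaleC: "bounded_linear (\<lambda>x::'h::complex_hilbert_space. c *\<^sub>C x)"
  by (rule bounded_linear_intro[where K = "cmod c"])
    (simp_all add: scaleC_add_right norm_scaleC scaleR_scaleC scaleC_scaleC mult.commute)

lemma cinner_ext:
  assumes "\<And>z. cinner x z = cinner y (z::'h::complex_hilbert_space)" shows "x = y"
proof -
  have "cinner (x - y) (x - y) = 0" using assms[of "x - y"] by (simp add: cinner_diff_left)
  then show ?thesis by (simp add: cinner_self)
qed

subsection \<open>Orthogonal projections\<close>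

text \<open>
  A minimizing sequence for the distance from \<open>\<xi>\<close> to \<open>V\<close> is a Cauchy sequence by the parallelogram
  law, and its limit is the foot of the perpendicular.
\<close>

lemma orthogonal_decomposition:
  fixes V :: "'a::{real_inner,complete_space} set"
  assumes cl: "closed V" and sub: "subspace V"
  obtains v where "v \<in> V" "\<And>w. w \<in> V \<Longrightarrow> inner (\<xi> - v) w = 0"
proof -
  define d where "d = (INF w\<in>V. (norm (\<xi> - w))\<^sup>2)"
  have ne: "V \<noteq> {}" using subspace_0[OF sub] by blast
  have bdd: "bdd_below ((\<lambda>w. (norm (\<xi> - w))\<^sup>2) ` V)" by (rule bdd_belowI2[of _ 0]) simp
  have dle: "d \<le> (norm (\<xi> - w))\<^sup>2" if "w \<in> V" for w
    unfolding d_def using bdd that by (rule cINF_lower)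
  have "\<exists>w\<in>V. (norm (\<xi> - w))\<^sup>2 < d + inverse (real (Suc n))" for n
    using cINF_less_iff[OF ne bdd, of "d + inverse (real (Suc n))"] unfolding d_def by auto
  then obtain w where w: "\<And>n. w n \<in> V" "\<And>n. (norm (\<xi> - w n))\<^sup>2 < d + inverse (real (Suc n))"
    by metis
  have par: "(norm (w m - w n))\<^sup>2 \<le> 2 * inverse (real (Suc m)) + 2 * inverse (real (Suc n))" for m n
  proof -
    have "(1/2) *\<^sub>R (w m + w n) \<in> V" using w sub by (simp add: subspace_add subspace_scale)
    from dle[OF this] have "d \<le> (norm (\<xi> - (1/2) *\<^sub>R (w m + w n)))\<^sup>2" .
    moreover have "(norm (w m - w n))\<^sup>2 + 4 * (norm (\<xi> - (1/2) *\<^sub>R (w m + w n)))\<^sup>2 =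
        2 * (norm (\<xi> - w m))\<^sup>2 + 2 * (norm (\<xi> - w n))\<^sup>2"
      by (simp add: power2_norm_eq_inner inner_add_left inner_add_right inner_diff_left
          inner_diff_right inner_commute algebra_simps)
    ultimately show ?thesis using w(2)[of m] w(2)[of n] by simp
  qed
  have "Cauchy w"
  proof (rule metric_CauchyI)
    fix e :: real assume e: "e > 0"
    then obtain N where N: "inverse (real (Suc N)) < e\<^sup>2 / 4"
      using reals_Archimedean[of "e\<^sup>2 / 4"] by auto
    have "dist (w m) (w n) < e" if "m \<ge> N" "n \<ge> N" for m n
    proof -
      have "inverse (real (Suc k)) \<le> inverse (real (Suc N))" if "k \<ge> N" for k
        using that by (simp add: le_imp_inverse_le)
      from this[OF that(1)] this[OF that(2)]
      have "(norm (w m - w n))\<^sup>2 < e\<^sup>2" using par[of m n] N by linarith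
      then show ?thesis using e by (simp add: dist_norm power_less_imp_less_base)
    qed
    then show "\<exists>M. \<forall>m\<ge>M. \<forall>n\<ge>M. dist (w m) (w n) < e" by blast
  qed
  then obtain v where v: "w \<longlonglongrightarrow> v" using Cauchy_convergent convergent_def by blast
  have vV: "v \<in> V" using closed_sequentially[OF cl _ v] w by blast
  have vd: "(norm (\<xi> - v))\<^sup>2 \<le> d"
  proof (rule tendsto_le[OF _ _ ])
    show "(\<lambda>n. (norm (\<xi> - w n))\<^sup>2) \<longlonglongrightarrow> (norm (\<xi> - v))\<^sup>2" using v by (intro tendsto_intros)
    show "(\<lambda>n. d + inverse (real (Suc n))) \<longlonglongrightarrow> d"
      using tendsto_add[OF tendsto_const LIMSEQ_inverse_real_of_nat, of d] by simp
    show "\<forall>\<^sub>F n in sequentially. (norm (\<xi> - w n))\<^sup>2 \<le> d + inverse (real (Suc n))"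
      by (intro always_eventually allI less_imp_le w(2))
  qed simp
  have "inner (\<xi> - v) u = 0" if u: "u \<in> V" for u
  proof (cases "u = 0")
    case False
    \<comment> \<open>this \<open>t\<close> minimizes the distance from \<open>\<xi>\<close> to the line through \<open>v\<close> in direction \<open>u\<close>\<close>
    define t where "t = inner (\<xi> - v) u / (norm u)\<^sup>2"
    have "v + t *\<^sub>R u \<in> V" using vV u sub by (simp add: subspace_add subspace_scale)
    then have "(norm (\<xi> - v))\<^sup>2 \<le> (norm (\<xi> - (v + t *\<^sub>R u)))\<^sup>2" using order_trans[OF vd dle] by blast
    also have "\<dots> = (norm (\<xi> - v))\<^sup>2 - 2 * t * inner (\<xi> - v) u + t\<^sup>2 * (norm u)\<^sup>2"
      unfolding power2_norm_eq_inner
      by (simp add: inner_add_left inner_add_right inner_diff_left inner_diff_right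
          inner_commute algebra_simps power2_eq_square)
    also have "\<dots> = (norm (\<xi> - v))\<^sup>2 - (inner (\<xi> - v) u)\<^sup>2 / (norm u)\<^sup>2"
      using False by (simp add: t_def power2_eq_square field_simps)
    finally have "(inner (\<xi> - v) u)\<^sup>2 / (norm u)\<^sup>2 \<le> 0" by simp
    then show ?thesis using False by (simp add: divide_le_0_iff)
  qed simp
  then show ?thesis using that vV by blast
qed

lemma linear_subspace_imp_subspace: "linear_subspace V \<Longrightarrow> subspace V"
  by (auto simp: linear_subspace_def subspace_def scaleR_scaleC)

text \<open>
  On a complex subspace, orthogonality for the real part of the inner product is orthogonality.
\<close>

lemma orthogonal_complex:
  assumes V: "linear_subspace V" and orth: "\<And>w. w \<in> V \<Longrightarrow> inner \<xi> w = 0" and w: "w \<in> V"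
  shows "cinner \<xi> w = 0"
proof -
  have "\<i> *\<^sub>C w \<in> V" using V w by (auto simp: linear_subspace_def)
  then show ?thesis using orth[OF w] orth[of "\<i> *\<^sub>C w"] by (simp add: cinner_conv_inner complex_eq_iff)
qed

lemma bounded_opsI:
  assumes "\<And>x y. T (x + y) = T x + T y" "\<And>c x. T (c *\<^sub>C x) = c *\<^sub>C T x"
    "\<And>x. norm (T x) \<le> K * norm x"
  shows "T \<in> bounded_ops"
  unfolding bounded_ops_def
  using assms bounded_linear_intro[of T K] by (auto simp: scaleR_scaleC mult.commute)

lemma orthogonal_projection_exists:
  fixes V :: "'h::complex_hilbert_space set"
  assumes cl: "closed V" and V: "linear_subspace V"
  obtains p where "p \<in> bounded_ops" "is_adjoint p p" "\<And>\<xi>. p \<xi> \<in> V" "\<And>\<xi>. \<xi> \<in> V \<Longrightarrow> p \<xi> = \<xi>"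
    "\<And>\<xi> w. w \<in> V \<Longrightarrow> cinner (\<xi> - p \<xi>) w = 0"
proof -
  have "\<forall>\<xi>. \<exists>v\<in>V. \<forall>w\<in>V. cinner (\<xi> - v) w = 0"
    using orthogonal_decomposition[OF cl linear_subspace_imp_subspace[OF V]]
      orthogonal_complex[OF V] by metis
  then obtain p where p: "\<And>\<xi>. p \<xi> \<in> V" "\<And>\<xi> w. w \<in> V \<Longrightarrow> cinner (\<xi> - p \<xi>) w = 0" by metis
  have Vadd: "a \<in> V \<Longrightarrow> b \<in> V \<Longrightarrow> a + b \<in> V" and Vs: "a \<in> V \<Longrightarrow> c *\<^sub>C a \<in> V" for a b c
    using V by (auto simp: linear_subspace_def)
  have Vd: "a \<in> V \<Longrightarrow> b \<in> V \<Longrightarrow> a - b \<in> V" for a b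
    using Vadd[of a "(-1) *\<^sub>C b"] Vs[of b "-1"] by (simp add: scaleC_minus1)
  have uniq: "p \<xi> = v" if "v \<in> V" "\<And>w. w \<in> V \<Longrightarrow> cinner (\<xi> - v) w = 0" for \<xi> v
  proof -
    have "cinner (p \<xi> - v) (p \<xi> - v) = cinner (\<xi> - v) (p \<xi> - v) - cinner (\<xi> - p \<xi>) (p \<xi> - v)"
      by (simp add: cinner_diff_left)
    also have "\<dots> = 0" using that p Vd by simp
    finally show ?thesis by (simp add: cinner_self)
  qed
  have adj: "cinner (p \<xi>) \<eta> = cinner (p \<xi>) (p \<eta>)" for \<xi> \<eta>
  proof -
    have "cinner (\<eta> - p \<eta>) (p \<xi>) = 0" using p by blast
    then have "cinner (p \<xi>) (\<eta> - p \<eta>) = 0" by (metis cinner_commute complex_cnj_zero)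
    then show ?thesis by (simp add: cinner_diff_right)
  qed
  have "p \<in> bounded_ops"
  proof (rule bounded_opsI[where K = 1])
    show "p (x + y) = p x + p y" for x y
      by (rule uniq) (use p Vadd in \<open>auto simp: add_diff_add cinner_add_left\<close>)
    show "p (c *\<^sub>C x) = c *\<^sub>C p x" for c x
      by (rule uniq) (use p Vs in \<open>auto simp: cinner_scaleC_left simp flip: scaleC_diff_right\<close>)
    show "norm (p x) \<le> 1 * norm x" for x
    proof -
      have "(norm (p x))\<^sup>2 = Re (cinner (p x) x)" by (simp add: adj[of x x] cinner_self)
      also have "\<dots> = inner (p x) x" by (simp add: Re_cinner)
      also have "\<dots> \<le> norm (p x) * norm x" by (rule norm_cauchy_schwarz)
      finally show ?thesis by (cases "norm (p x) = 0") (auto simp: power2_eq_square)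
    qed
  qed
  moreover have "is_adjoint p p"
    unfolding is_adjoint_def by (metis adj cinner_commute)
  moreover have "p \<xi> = \<xi>" if "\<xi> \<in> V" for \<xi> by (rule uniq) (use that in auto)
  ultimately show ?thesis using that p by blast
qed

subsection \<open>The closed graph theorem\<close>

text \<open>
  By Baire's theorem the vectors with \<open>norm (T x) \<le> n\<close> are dense in some ball, hence every \<open>x\<close> is
  approximated up to half its norm by some \<open>g x\<close> with \<open>norm (T (g x)) \<le> K * norm x\<close>.  Iterating on
  the remainder writes \<open>x\<close> as a series whose image converges, and closedness identifies the limit.
\<close>

lemma closed_graph_theorem:
  fixes T :: "'a::banach \<Rightarrow> 'b::banach"
  assumes lin: "linear T" and cl: "closed {(x, T x) |x. True}"
  shows "bounded_linear T"
proof -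
  interpret linear T by fact
  define F where "F n = closure {x. norm (T x) \<le> real n}" for n
  have "\<Union>(range F) = UNIV"
  proof -
    have "x \<in> \<Union>(range F)" for x
    proof -
      obtain n where "norm (T x) \<le> real n" using real_arch_simple by blast
      then have "x \<in> F n" unfolding F_def by (intro subsetD[OF closure_subset]) simp
      then show ?thesis by blast
    qed
    then show ?thesis by blast
  qed
  moreover have "euclidean interior_of \<Union>(range F) = {}" if "\<And>n. interior (F n) = {}"
    by (rule Baire_category_alt)
      (use that completely_metrizable_space_euclidean in \<open>auto simp: F_def euclidean_interior_of\<close>)
  ultimately obtain n where "interior (F n) \<noteq> {}" by force
  then obtain x0 r where r: "r > 0" "ball x0 r \<subseteq> F n"
    by (metis ex_in_conv mem_interior)
  have small: "\<exists>y. norm (x - y) < e \<and> norm (T y) \<le> real n" if x: "norm x < r" and e: "e > 0" for x e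
  proof -
    have "x0 + x \<in> F n" "x0 - x \<in> F n" using r x by (auto simp: dist_norm subset_iff)
    then obtain a b where ab: "norm (T a) \<le> real n" "dist a (x0 + x) < e"
      "norm (T b) \<le> real n" "dist b (x0 - x) < e"
      unfolding F_def closure_approachable using e by blast
    have "(x0 + x - a) - (x0 - x - b) = 2 *\<^sub>R x - (a - b)" by (simp add: scaleR_2)
    then have "x - (1/2) *\<^sub>R (a - b) = (1/2) *\<^sub>R ((x0 + x - a) - (x0 - x - b))"
      by (simp only: scaleR_diff_right scaleR_scaleR) simp
    then have "norm (x - (1/2) *\<^sub>R (a - b)) = 1/2 * norm ((x0 + x - a) - (x0 - x - b))"
      by (simp only: norm_scaleR)
    also have "\<dots> \<le> 1/2 * (norm (x0 + x - a) + norm (x0 - x - b))"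
      by (intro mult_left_mono norm_triangle_ineq4) simp
    also have "\<dots> < e" using ab by (simp add: dist_norm norm_minus_commute)
    finally have "norm (x - (1/2) *\<^sub>R (a - b)) < e" .
    moreover have "norm (T ((1/2) *\<^sub>R (a - b))) \<le> 1/2 * (norm (T a) + norm (T b))"
      by (simp add: scale diff norm_triangle_ineq4)
    ultimately show ?thesis using ab by (intro exI[of _ "(1/2) *\<^sub>R (a - b)"]) auto
  qed
  define K where "K = 2 * real n / r"
  have "\<exists>y. norm (x - y) \<le> norm x / 2 \<and> norm (T y) \<le> K * norm x" for x
  proof (cases "x = 0")
    case True then show ?thesis by (intro exI[of _ 0]) simp
  next
    case False
    \<comment> \<open>scales \<open>x\<close> to norm \<open>r/2\<close>\<close>
    define s where "s = r / (2 * norm x)"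
    have s: "s > 0" using False r by (simp add: s_def)
    have "norm (s *\<^sub>R x) < r" using False r by (simp add: s_def)
    from small[OF this, of "s * (norm x / 2)"] obtain y where
      y: "norm (s *\<^sub>R x - y) < s * (norm x / 2)" "norm (T y) \<le> real n"
      using s False by auto
    have "x - y /\<^sub>R s = (s *\<^sub>R x - y) /\<^sub>R s" using s by (simp add: algebra_simps)
    then have "norm (x - y /\<^sub>R s) = norm (s *\<^sub>R x - y) / s" using s by (simp add: divide_inverse_commute)
    also have "\<dots> \<le> s * (norm x / 2) / s" using y(1) s by (intro divide_right_mono) auto
    also have "\<dots> = norm x / 2" using s by simp
    finally have "norm (x - y /\<^sub>R s) \<le> norm x / 2" .
    moreover have "norm (T (y /\<^sub>R s)) \<le> K * norm x"
    proof -
      have "norm (T (y /\<^sub>R s)) = norm (T y) / s" using s by (simp add: scale divide_inverse_commute)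
      also have "\<dots> \<le> real n / s" using y(2) s by (simp add: divide_right_mono)
      also have "\<dots> = K * norm x" using False r by (simp add: K_def s_def field_simps)
      finally show ?thesis .
    qed
    ultimately show ?thesis by blast
  qed
  then obtain g where g: "\<And>x. norm (x - g x) \<le> norm x / 2" "\<And>x. norm (T (g x)) \<le> K * norm x"
    by metis
  have K0: "K \<ge> 0" using r by (simp add: K_def)
  have "norm (T x) \<le> norm x * (2 * K)" for x
  proof -
    define R where "R k = ((\<lambda>x. x - g x) ^^ k) x" for k
    have R: "norm (R k) \<le> norm x * (1/2) ^ k" for k
    proof (induction k)
      case (Suc k)
      have "norm (R (Suc k)) \<le> norm (R k) / 2" using g(1) by (simp add: R_def)
      then show ?case using Suc by simp
    qed (simp add: R_def)
    have TR: "norm (T (g (R k))) \<le> K * norm x * (1/2) ^ k" for k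
      using g(2)[of "R k"] mult_left_mono[OF R[of k] K0] by (simp add: mult.assoc)
    have sumg: "(\<Sum>i<k. g (R i)) = x - R k" for k
    proof (induction k)
      case (Suc k)
      have "R (Suc k) = R k - g (R k)" by (simp add: R_def)
      then show ?case using Suc by simp
    qed (simp add: R_def)
    have geo: "(\<lambda>k. K * norm x * (1/2) ^ k) sums (K * norm x * 2)"
      using geometric_sums[of "1/2::real"] by (intro sums_mult) simp
    have smn: "summable (\<lambda>k. norm (T (g (R k))))"
      by (rule summable_comparison_test'[OF sums_summable[OF geo]]) (use TR in simp)
    then have sm: "summable (\<lambda>k. T (g (R k)))" by (rule summable_norm_cancel)
    define w where "w = (\<Sum>k. T (g (R k)))"
    have "R \<longlonglongrightarrow> 0"
    proof (rule Lim_null_comparison)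
      show "\<forall>\<^sub>F k in sequentially. norm (R k) \<le> norm x * (1/2) ^ k" using R by simp
      show "(\<lambda>k. norm x * (1/2) ^ k) \<longlonglongrightarrow> 0" by (intro tendsto_mult_right_zero LIMSEQ_realpow_zero) auto
    qed
    then have "(\<lambda>k. \<Sum>i<k. g (R i)) \<longlonglongrightarrow> x" unfolding sumg by (auto intro!: tendsto_eq_intros)
    moreover have "(\<lambda>k. T (\<Sum>i<k. g (R i))) \<longlonglongrightarrow> w"
      using summable_LIMSEQ[OF sm] by (simp add: w_def sum)
    ultimately have "(\<lambda>k. (\<Sum>i<k. g (R i), T (\<Sum>i<k. g (R i)))) \<longlonglongrightarrow> (x, w)"
      by (rule tendsto_Pair)
    then have "(x, w) \<in> {(x, T x) |x. True}"
      by (rule closed_sequentially[OF cl, rotated]) auto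
    then have "T x = w" by simp
    moreover have "norm w \<le> (\<Sum>k. K * norm x * (1/2) ^ k)"
      unfolding w_def
      using order_trans[OF summable_norm[OF smn] suminf_le[OF TR smn sums_summable[OF geo]]] .
    moreover have "(\<Sum>k. K * norm x * (1/2) ^ k) = K * norm x * 2" using geo by (rule sums_unique[symmetric])
    ultimately show ?thesis by (simp add: mult_ac)
  qed
  then show ?thesis by (intro bounded_linear_intro[where K = "2 * K"]) (auto simp: add scale)
qed


section \<open>Commutative von Neumann algebras\<close>

lemma bounded_ops_add: "T \<in> bounded_ops \<Longrightarrow> T (x + y) = T x + T y"
  and bounded_ops_scaleC: "T \<in> bounded_ops \<Longrightarrow> T (c *\<^sub>C x) = c *\<^sub>C T x"
  and bounded_ops_scaleR: "T \<in> bounded_ops \<Longrightarrow> T (r *\<^sub>R x) = r *\<^sub>R T x"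
  and bounded_ops_diff: "T \<in> bounded_ops \<Longrightarrow> T (x - y) = T x - T y"
  and bounded_ops_zero: "T \<in> bounded_ops \<Longrightarrow> T 0 = 0"
  and bounded_ops_bounded_linear: "T \<in> bounded_ops \<Longrightarrow> bounded_linear T"
  by (auto simp: bounded_ops_def linear_simps)

lemma bounded_ops_continuous:
  "T \<in> bounded_ops \<Longrightarrow> X \<longlonglongrightarrow> l \<Longrightarrow> (\<lambda>n. T (X n)) \<longlonglongrightarrow> T l"
  using bounded_linear.tendsto bounded_ops_bounded_linear by blast

lemma bounded_ops_closure:
  "(\<lambda>\<xi>. \<xi>) \<in> bounded_ops" "(\<lambda>\<xi>. 0) \<in> bounded_ops"
  "S \<in> bounded_ops \<Longrightarrow> T \<in> bounded_ops \<Longrightarrow> (\<lambda>\<xi>. S \<xi> + T \<xi>) \<in> bounded_ops"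
  "S \<in> bounded_ops \<Longrightarrow> T \<in> bounded_ops \<Longrightarrow> (\<lambda>\<xi>. S \<xi> - T \<xi>) \<in> bounded_ops"
  "S \<in> bounded_ops \<Longrightarrow> T \<in> bounded_ops \<Longrightarrow> (\<lambda>\<xi>. S (T \<xi>)) \<in> bounded_ops"
  "S \<in> bounded_ops \<Longrightarrow> (\<lambda>\<xi>. c *\<^sub>C S \<xi>) \<in> bounded_ops"
  by (auto simp: bounded_ops_def bounded_linear_ident bounded_linear_zero bounded_linear_add
      bounded_linear_sub scaleC_add_right scaleC_diff_right scaleC_scaleC mult.commute
      intro: bounded_linear_compose bounded_linear_compose[OF bounded_linear_scaleC])

lemma is_adjoint_sym: "is_adjoint T S \<Longrightarrow> is_adjoint S T"
  unfolding is_adjoint_def by (metis cinner_commute)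

lemma commutantD: "u \<in> commutant M \<Longrightarrow> T \<in> M \<Longrightarrow> u (T \<xi>) = T (u \<xi>)"
  by (auto simp: commutant_def fun_eq_iff)

lemma commutant_bounded: "u \<in> commutant M \<Longrightarrow> u \<in> bounded_ops"
  by (simp add: commutant_def)

locale commutative_vna =
  fixes M :: "('h::complex_hilbert_space \<Rightarrow> 'h) set"
  assumes vna: "von_neumann_algebra M" and comm: "commutative M"
begin

lemma bounded: "T \<in> M \<Longrightarrow> T \<in> bounded_ops"
  using vna by (auto simp: von_neumann_algebra_def)

text \<open>
  This is the bicommutant property.
\<close>

lemma memI:
  assumes "T \<in> bounded_ops" "\<And>u \<xi>. u \<in> commutant M \<Longrightarrow> T (u \<xi>) = u (T \<xi>)"
  shows "T \<in> M"
proof -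
  have "T \<in> commutant (commutant M)" using assms by (auto simp: commutant_def fun_eq_iff)
  then show ?thesis using vna by (simp add: von_neumann_algebra_def)
qed

lemma M_apply_commute: "S \<in> M \<Longrightarrow> T \<in> M \<Longrightarrow> S (T \<xi>) = T (S \<xi>)"
  using comm by (auto simp: commutative_def fun_eq_iff)

lemma M_sub_commutant: "T \<in> M \<Longrightarrow> T \<in> commutant M"
  using bounded comm by (auto simp: commutant_def commutative_def)

lemma M_closure:
  "(\<lambda>\<xi>. \<xi>) \<in> M" "(\<lambda>\<xi>. 0) \<in> M"
  "S \<in> M \<Longrightarrow> T \<in> M \<Longrightarrow> (\<lambda>\<xi>. S \<xi> + T \<xi>) \<in> M"
  "S \<in> M \<Longrightarrow> T \<in> M \<Longrightarrow> (\<lambda>\<xi>. S \<xi> - T \<xi>) \<in> M"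
  "S \<in> M \<Longrightarrow> T \<in> M \<Longrightarrow> (\<lambda>\<xi>. S (T \<xi>)) \<in> M"
  "S \<in> M \<Longrightarrow> (\<lambda>\<xi>. c *\<^sub>C S \<xi>) \<in> M"
  by (rule memI; auto simp: bounded_ops_closure bounded commutant_bounded
      commutantD[of _ M S] commutantD[of _ M T]
      bounded_ops_add bounded_ops_diff bounded_ops_scaleC bounded_ops_zero)+

lemma M_scaleR: "S \<in> M \<Longrightarrow> (\<lambda>\<xi>. r *\<^sub>R S \<xi>) \<in> M"
  unfolding scaleR_scaleC by (rule M_closure)

lemma adjoint_in_M: assumes "T \<in> M" obtains S where "S \<in> M" "is_adjoint T S"
  using assms vna by (auto simp: von_neumann_algebra_def)

lemma M_limit:
  assumes T: "\<And>n. T n \<in> M" and lim: "\<And>\<xi>. (\<lambda>n. T n \<xi>) \<longlonglongrightarrow> S \<xi>"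
    and bd: "\<And>\<xi>. norm (S \<xi>) \<le> K * norm \<xi>"
  shows "S \<in> M"
proof (rule memI)
  show "S \<in> bounded_ops"
  proof (rule bounded_opsI[OF _ _ bd])
    show "S (x + y) = S x + S y" for x y
      by (rule LIMSEQ_unique[OF lim]) (use tendsto_add[OF lim lim] bounded[OF T] in \<open>simp add: bounded_ops_add\<close>)
    show "S (c *\<^sub>C x) = c *\<^sub>C S x" for c x
      by (rule LIMSEQ_unique[OF lim])
        (use bounded_linear.tendsto[OF bounded_linear_scaleC lim] bounded[OF T] in \<open>simp add: bounded_ops_scaleC\<close>)
  qed
  show "S (u \<xi>) = u (S \<xi>)" if "u \<in> commutant M" for u \<xi>
  proof (rule LIMSEQ_unique[OF lim])
    show "(\<lambda>n. T n (u \<xi>)) \<longlonglongrightarrow> u (S \<xi>)"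
      using bounded_ops_continuous[OF commutant_bounded[OF that] lim, of \<xi>]
      by (simp only: commutantD[OF that T])
  qed
qed

subsection \<open>Projections\<close>

lemma projD:
  assumes "p \<in> projections M"
  shows "p \<in> M" "p (p \<xi>) = p \<xi>" "cinner (p \<xi>) \<eta> = cinner \<xi> (p \<eta>)"
  using assms by (auto simp: projections_def is_adjoint_def fun_eq_iff)

lemma projI:
  "p \<in> M \<Longrightarrow> (\<And>\<xi>. p (p \<xi>) = p \<xi>) \<Longrightarrow> (\<And>\<xi> \<eta>. cinner (p \<xi>) \<eta> = cinner \<xi> (p \<eta>)) \<Longrightarrow> p \<in> projections M"
  by (auto simp: projections_def is_adjoint_def fun_eq_iff)

lemma proj_bounded: "p \<in> projections M \<Longrightarrow> p \<in> bounded_ops"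
  using projD(1) bounded by blast

lemma proj_commute: "p \<in> projections M \<Longrightarrow> a \<in> M \<Longrightarrow> a (p \<xi>) = p (a \<xi>)"
  using projD(1) M_apply_commute by blast

lemma proj_id: "(\<lambda>\<xi>. \<xi>) \<in> projections M" and proj_zero: "(\<lambda>\<xi>. 0) \<in> projections M"
  by (rule projI; simp add: M_closure)+

lemma proj_comp:
  assumes p: "p \<in> projections M" and q: "q \<in> projections M"
  shows "(\<lambda>\<xi>. p (q \<xi>)) \<in> projections M"
proof (rule projI)
  show "p (q (p (q \<xi>))) = p (q \<xi>)" for \<xi>
    using p q by (simp add: proj_commute[OF p projD(1)[OF q]] projD(2))
  show "cinner (p (q \<xi>)) \<eta> = cinner \<xi> (p (q \<eta>))" for \<xi> \<eta>
    using p q by (simp add: proj_commute[OF q projD(1)[OF p]] projD(3))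
qed (use p q projD M_closure in auto)

lemma proj_perp: assumes p: "p \<in> projections M" shows "perp p \<in> projections M"
  unfolding perp_def
  by (rule projI)
    (use p in \<open>auto simp: M_closure projD bounded_ops_diff[OF proj_bounded[OF p]] cinner_diff_left cinner_diff_right\<close>)

lemma perp_perp [simp]: "perp (perp p) = p"
  by (simp add: perp_def)

text \<open>
  The supremum of two commuting projections.
\<close>

definition join :: "('h \<Rightarrow> 'h) \<Rightarrow> ('h \<Rightarrow> 'h) \<Rightarrow> 'h \<Rightarrow> 'h" where
  "join p q = (\<lambda>\<xi>. p \<xi> + perp p (q \<xi>))"

lemma proj_orth_add:
  assumes p: "p \<in> projections M" and q: "q \<in> projections M" and pq: "\<And>\<xi>. p (q \<xi>) = 0"
  shows "(\<lambda>\<xi>. p \<xi> + q \<xi>) \<in> projections M"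
proof (rule projI)
  have qp: "q (p \<xi>) = 0" for \<xi> using pq proj_commute[OF q projD(1)[OF p]] by simp
  show "p (p \<xi> + q \<xi>) + q (p \<xi> + q \<xi>) = p \<xi> + q \<xi>" for \<xi>
    using p q pq qp by (simp add: bounded_ops_add proj_bounded projD)
  show "cinner (p \<xi> + q \<xi>) \<eta> = cinner \<xi> (p \<eta> + q \<eta>)" for \<xi> \<eta>
    using p q by (simp add: cinner_add_left cinner_add_right projD)
qed (use p q projD M_closure in auto)

lemma perp_orth: "p \<in> projections M \<Longrightarrow> p (perp p \<xi>) = 0" "p \<in> projections M \<Longrightarrow> perp p (p \<xi>) = 0"
  by (auto simp: perp_def bounded_ops_diff[OF proj_bounded] projD)

lemma proj_join: "p \<in> projections M \<Longrightarrow> q \<in> projections M \<Longrightarrow> join p q \<in> projections M"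
  unfolding join_def by (rule proj_orth_add[OF _ proj_comp[OF proj_perp] perp_orth(1)])

lemma norm_proj_sq: "p \<in> projections M \<Longrightarrow> cinner (p \<xi>) \<xi> = of_real ((norm (p \<xi>))\<^sup>2)"
  by (metis cinner_self projD(2,3))

lemma norm_proj_le: assumes "p \<in> projections M" shows "norm (p \<xi>) \<le> norm \<xi>"
proof -
  have "(norm (p \<xi>))\<^sup>2 = inner (p \<xi>) \<xi>"
    using norm_proj_sq[OF assms, of \<xi>] by (metis Re_cinner Re_complex_of_real)
  also have "\<dots> \<le> norm (p \<xi>) * norm \<xi>" by (rule norm_cauchy_schwarz)
  finally show ?thesis by (cases "norm (p \<xi>) = 0") (auto simp: power2_eq_square)
qed

lemma proj_pythagoras:
  assumes "p \<in> projections M" shows "(norm \<xi>)\<^sup>2 = (norm (p \<xi>))\<^sup>2 + (norm (perp p \<xi>))\<^sup>2"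
proof -
  have "cinner \<xi> \<xi> = cinner (p \<xi>) \<xi> + cinner (perp p \<xi>) \<xi>" by (simp add: perp_def cinner_diff_left)
  then have "complex_of_real ((norm \<xi>)\<^sup>2) = of_real ((norm (p \<xi>))\<^sup>2 + (norm (perp p \<xi>))\<^sup>2)"
    using norm_proj_sq[OF assms] norm_proj_sq[OF proj_perp[OF assms]] by (simp add: cinner_self)
  then show ?thesis using of_real_eq_iff by blast
qed

lemma positive_op_iff: "positive_op T \<longleftrightarrow> (\<forall>\<xi>. Re (cinner (T \<xi>) \<xi>) \<ge> 0 \<and> Im (cinner (T \<xi>) \<xi>) = 0)"
  by (simp add: positive_op_def complex_nonneg_Reals_iff)

lemma proj_positive: "p \<in> projections M \<Longrightarrow> p \<in> positive_part M"
  by (auto simp: positive_part_def positive_op_iff projD(1) norm_proj_sq)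

lemma proj_le_iff:
  assumes p: "p \<in> projections M" and q: "q \<in> projections M"
  shows "p \<le>\<^sub>o\<^sub>p q \<longleftrightarrow> (\<forall>\<xi>. q (p \<xi>) = p \<xi>)"
proof
  assume le: "p \<le>\<^sub>o\<^sub>p q"
  show "\<forall>\<xi>. q (p \<xi>) = p \<xi>"
  proof
    fix \<xi>
    have "Re (cinner (q (p \<xi>) - p (p \<xi>)) (p \<xi>)) \<ge> 0"
      using le by (simp add: op_le_def positive_op_iff)
    then have "(norm (q (p \<xi>)))\<^sup>2 \<ge> (norm (p \<xi>))\<^sup>2"
      using norm_proj_sq[OF p, of "p \<xi>"] norm_proj_sq[OF q, of "p \<xi>"] projD(2)[OF p]
      by (simp add: cinner_diff_left)
    then have "norm (perp q (p \<xi>)) = 0" using proj_pythagoras[OF q, of "p \<xi>"] by simp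
    then show "q (p \<xi>) = p \<xi>" by (simp add: perp_def)
  qed
next
  assume qp: "\<forall>\<xi>. q (p \<xi>) = p \<xi>"
  have "norm (p \<xi>) \<le> norm (q \<xi>)" for \<xi>
    using qp norm_proj_le[OF p, of "q \<xi>"] proj_commute[OF p projD(1)[OF q]] by metis
  then have "(norm (p \<xi>))\<^sup>2 \<le> (norm (q \<xi>))\<^sup>2" for \<xi> by (simp add: power_mono)
  then show "p \<le>\<^sub>o\<^sub>p q"
    using norm_proj_sq[OF p] norm_proj_sq[OF q]
    by (simp add: op_le_def positive_op_iff cinner_diff_left)
qed

lemma proj_diff:
  assumes p: "p \<in> projections M" and q: "q \<in> projections M" and qp: "\<And>\<xi>. q (p \<xi>) = p \<xi>"
  shows "(\<lambda>\<xi>. q \<xi> - p \<xi>) \<in> projections M"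
proof -
  have "p (q \<xi>) = p \<xi>" for \<xi> using qp proj_commute[OF q projD(1)[OF p]] by simp
  then have "(\<lambda>\<xi>. q \<xi> - p \<xi>) = (\<lambda>\<xi>. perp p (q \<xi>))" by (simp add: perp_def)
  then show ?thesis using proj_comp[OF proj_perp[OF p] q] by simp
qed

text \<open>
  The projection onto the common kernel of a subset of \<open>M\<close> belongs to \<open>M\<close>.  Let \<open>W\<close> be the smallest
  closed subspace that contains the ranges of the adjoints, so that \<open>W\<close> is the orthogonal complement
  of the kernel.  An operator \<open>u\<close> in the commutant leaves both \<open>W\<close> and the kernel invariant, hence
  commutes with the projection onto \<open>W\<close>.
\<close>

lemma kernel_projection:
  assumes N: "N \<subseteq> M"
  obtains r where "r \<in> projections M" "\<And>\<eta>. r \<eta> = \<eta> \<longleftrightarrow> (\<forall>a\<in>N. a \<eta> = 0)"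
proof -
  define S where "S = (\<Union>b\<in>{b\<in>M. \<exists>a\<in>N. is_adjoint a b}. range b)"
  define good where "good V \<longleftrightarrow> closed V \<and> linear_subspace V \<and> S \<subseteq> V" for V
  define W where "W = \<Inter>{V. good V}"
  have clW: "closed W" unfolding W_def good_def by (rule closed_Inter) auto
  have linW: "linear_subspace W" unfolding W_def good_def linear_subspace_def by blast
  have least: "W \<subseteq> V" if "good V" for V unfolding W_def using that by blast
  have SW: "S \<subseteq> W" unfolding W_def good_def by blast
  obtain w where w: "w \<in> bounded_ops" "is_adjoint w w" "\<And>\<xi>. w \<xi> \<in> W" "\<And>\<xi>. \<xi> \<in> W \<Longrightarrow> w \<xi> = \<xi>"
    "\<And>\<xi> v. v \<in> W \<Longrightarrow> cinner (\<xi> - w \<xi>) v = 0"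
    by (rule orthogonal_projection_exists[OF clW linW]) (rule that)
  have kernel: "w \<eta> = 0 \<longleftrightarrow> (\<forall>a\<in>N. a \<eta> = 0)" for \<eta>
  proof
    assume w0: "w \<eta> = 0"
    show "\<forall>a\<in>N. a \<eta> = 0"
    proof
      fix a assume a: "a \<in> N"
      then obtain b where b: "b \<in> M" "is_adjoint a b" using adjoint_in_M N by blast
      show "a \<eta> = 0"
      proof (rule cinner_ext)
        fix \<zeta>
        have "b \<zeta> \<in> W" using SW a b by (auto simp: S_def)
        then have "cinner \<eta> (b \<zeta>) = 0" using w(5)[of "b \<zeta>" \<eta>] w0 by simp
        then show "cinner (a \<eta>) \<zeta> = cinner 0 \<zeta>" using b by (simp add: is_adjoint_def)
      qed
    qed
  next
    assume N0: "\<forall>a\<in>N. a \<eta> = 0"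
    have "good {\<zeta>. cinner \<eta> \<zeta> = 0}"
      unfolding good_def
    proof (intro conjI)
      have "{\<zeta>. cinner \<eta> \<zeta> = 0} = {\<zeta>. inner \<eta> \<zeta> = 0 \<and> inner \<eta> (\<i> *\<^sub>C \<zeta>) = 0}"
        by (auto simp: cinner_conv_inner complex_eq_iff)
      also have "closed \<dots>"
        by (intro closed_Collect_conj closed_Collect_eq continuous_intros
            bounded_linear.continuous_on[OF bounded_linear_scaleC])
      finally show "closed {\<zeta>. cinner \<eta> \<zeta> = 0}" .
      show "linear_subspace {\<zeta>. cinner \<eta> \<zeta> = 0}"
        by (auto simp: linear_subspace_def cinner_add_right cinner_scaleC_right)
      show "S \<subseteq> {\<zeta>. cinner \<eta> \<zeta> = 0}"
        using N0 by (auto simp: S_def) (metis cinner_zero_left is_adjoint_def)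
    qed
    then have "W \<subseteq> {\<zeta>. cinner \<eta> \<zeta> = 0}" by (rule least)
    from subsetD[OF this w(3)] have "cinner \<eta> (w \<zeta>) = 0" for \<zeta> by simp
    then have "cinner (w \<eta>) \<zeta> = cinner 0 \<zeta>" for \<zeta> using w(2) by (simp add: is_adjoint_def)
    then show "w \<eta> = 0" by (rule cinner_ext)
  qed
  have inv: "u \<xi> \<in> W" if u: "u \<in> commutant M" and \<xi>: "\<xi> \<in> W" for u \<xi>
  proof -
    have ub: "u \<in> bounded_ops" using u by (rule commutant_bounded)
    have "good (u -` W)"
      unfolding good_def
    proof (intro conjI)
      show "closed (u -` W)"
        by (rule closed_vimage[OF clW linear_continuous_on[OF bounded_ops_bounded_linear[OF ub]]])
      show "linear_subspace (u -` W)"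
        using linW by (auto simp: linear_subspace_def bounded_ops_zero[OF ub] bounded_ops_add[OF ub]
            bounded_ops_scaleC[OF ub])
      have "u s \<in> S" if mem: "s \<in> S" for s
      proof -
        obtain a b \<zeta> where s: "a \<in> N" "b \<in> M" "is_adjoint a b" "s = b \<zeta>"
          using mem unfolding S_def by auto
        then have "u s = b (u \<zeta>)" using commutantD[OF u s(2)] by simp
        then show ?thesis using s by (auto simp: S_def)
      qed
      then show "S \<subseteq> u -` W" using SW by blast
    qed
    then show ?thesis using least \<xi> by blast
  qed
  have "w (u \<xi>) = u (w \<xi>)" if u: "u \<in> commutant M" for u \<xi>
  proof -
    have ub: "u \<in> bounded_ops" using u by (rule commutant_bounded)
    have "w (\<xi> - w \<xi>) = 0" using w(1,3,4) by (simp add: bounded_ops_diff)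
    then have "a (\<xi> - w \<xi>) = 0" if "a \<in> N" for a using kernel that by blast
    then have "a (u (\<xi> - w \<xi>)) = 0" if "a \<in> N" for a
      using commutantD[OF u, of a] N that bounded_ops_zero[OF ub] by (metis subsetD)
    then have "w (u (\<xi> - w \<xi>)) = 0" using kernel by blast
    then have "w (u \<xi>) = w (u (w \<xi>))" using w(1) ub by (simp add: bounded_ops_diff)
    also have "\<dots> = u (w \<xi>)" using w(3,4) inv[OF u] by blast
    finally show ?thesis .
  qed
  then have "w \<in> projections M"
    using w by (intro projI memI) (auto simp: is_adjoint_def)
  from proj_perp[OF this] have "perp w \<in> projections M" .
  moreover have "perp w \<eta> = \<eta> \<longleftrightarrow> (\<forall>a\<in>N. a \<eta> = 0)" for \<eta>
    using kernel[of \<eta>] by (simp add: perp_def)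
  ultimately show ?thesis using that by blast
qed

text \<open>
  This says that the supremum of \<open>P\<close> is the identity.
\<close>

definition total :: "('h \<Rightarrow> 'h) set \<Rightarrow> bool" where
  "total P \<longleftrightarrow> P \<subseteq> projections M \<and> (\<forall>r\<in>projections M. (\<forall>p\<in>P. \<forall>\<xi>. p (r \<xi>) = 0) \<longrightarrow> (\<forall>\<xi>. r \<xi> = 0))"

lemma total_separates:
  assumes "total P" "\<And>p. p \<in> P \<Longrightarrow> p \<eta> = 0" shows "\<eta> = 0"
proof -
  have PM: "P \<subseteq> M" using assms(1) projD(1) by (auto simp: total_def)
  obtain r where r: "r \<in> projections M" "\<And>\<eta>. r \<eta> = \<eta> \<longleftrightarrow> (\<forall>a\<in>P. a \<eta> = 0)"
    using kernel_projection[OF PM] by blast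
  have "\<forall>p\<in>P. p (r \<xi>) = 0" for \<xi> using r(2)[of "r \<xi>"] projD(2)[OF r(1)] by simp
  then have "r \<eta> = 0" using assms(1) r(1) by (auto simp: total_def)
  then show ?thesis using r(2)[of \<eta>] assms(2) by simp
qed

subsection \<open>Spectral cuts\<close>

lemma self_adjoint_zero:
  assumes y: "y \<in> bounded_ops" "is_adjoint y y" and i0: "\<And>\<xi>. inner (y \<xi>) \<xi> = 0"
  shows "y = (\<lambda>\<xi>. 0)"
proof
  fix \<xi>
  let ?\<eta> = "y \<xi>"
  have "cinner (y ?\<eta>) \<xi> = cinner ?\<eta> (y \<xi>)" using y(2) unfolding is_adjoint_def by blast
  then have "inner (y ?\<eta>) \<xi> = inner (y \<xi>) ?\<eta>" by (simp flip: Re_cinner)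
  then have "inner (y \<xi>) ?\<eta> = 0"
    using i0[of "\<xi> + ?\<eta>"] i0[of \<xi>] i0[of ?\<eta>]
    by (simp add: bounded_ops_add[OF y(1)] inner_add_left inner_add_right)
  then show "y \<xi> = 0" by simp
qed

text \<open>
  The operator \<open>Y = 1 - sqrt (1 - A)\<close>, as the limit of \<open>Y (n+1) = (A + Y n * Y n) / 2\<close>.  The
  increments are dominated by those of the same iteration with \<open>1\<close> in place of \<open>A\<close>, which converges
  because it is increasing and bounded by \<open>1\<close>.
\<close>

lemma square_root_iteration:
  assumes A: "A \<in> M" "is_adjoint A A" "\<And>\<xi>. norm (A \<xi>) \<le> norm \<xi>"
  obtains Y where "Y \<in> M" "is_adjoint Y Y" "\<And>\<xi>. norm (Y \<xi>) \<le> norm \<xi>"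
    "\<And>\<xi>. 2 *\<^sub>R Y \<xi> = A \<xi> + Y (Y \<xi>)"
proof -
  define Y where "Y = rec_nat (\<lambda>\<xi>. 0) (\<lambda>_ Y \<xi>. (1/2) *\<^sub>R (A \<xi> + Y (Y \<xi>)))"
  define y :: "nat \<Rightarrow> real" where "y = rec_nat 0 (\<lambda>_ y. (1 + y * y) / 2)"
  have Y0: "Y 0 \<xi> = 0" and YS: "Y (Suc n) \<xi> = (1/2) *\<^sub>R (A \<xi> + Y n (Y n \<xi>))" for n \<xi>
    by (simp_all add: Y_def)
  have y0: "y 0 = 0" and yS: "y (Suc n) = (1 + y n * y n) / 2" for n by (simp_all add: y_def)
  have YM: "Y n \<in> M" for n
  proof (induction n)
    case 0 show ?case using M_closure(2) by (simp add: Y_def)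
  next
    case (Suc n)
    have "Y (Suc n) = (\<lambda>\<xi>. (1/2) *\<^sub>R (A \<xi> + Y n (Y n \<xi>)))" using YS by blast
    then show ?case using Suc A M_closure M_scaleR by simp
  qed
  note Yb = bounded[OF YM]
  have Ya: "is_adjoint (Y n) (Y n)" for n
  proof (induction n)
    case (Suc n)
    then show ?case using A(2)
      by (simp add: is_adjoint_def YS cinner_scaleR_left cinner_scaleR_right cinner_add_left cinner_add_right)
  qed (simp add: is_adjoint_def Y0)
  have yb: "0 \<le> y n \<and> y n \<le> 1" for n
  proof (induction n)
    case (Suc n)
    then have "y n * y n \<le> 1 * 1" by (intro mult_mono) auto
    then show ?case by (simp add: yS)
  qed (simp add: y0)
  have Yn: "norm (Y n \<xi>) \<le> y n * norm \<xi>" for n \<xi>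
  proof (induction n arbitrary: \<xi>)
    case (Suc n)
    have "norm (Y n (Y n \<xi>)) \<le> y n * (y n * norm \<xi>)"
      using Suc[of "Y n \<xi>"] mult_left_mono[OF Suc[of \<xi>], of "y n"] yb[of n] by linarith
    then have "norm (A \<xi> + Y n (Y n \<xi>)) \<le> norm \<xi> + y n * (y n * norm \<xi>)"
      using A(3)[of \<xi>] norm_triangle_ineq[of "A \<xi>" "Y n (Y n \<xi>)"] by linarith
    moreover have "norm (Y (Suc n) \<xi>) = norm (A \<xi> + Y n (Y n \<xi>)) / 2" by (simp add: YS flip: scaleR_add_right)
    ultimately show ?case by (simp add: yS algebra_simps)
  qed (simp add: Y0 y0)
  have step: "norm (Y (Suc n) \<xi> - Y n \<xi>) \<le> (y (Suc n) - y n) * norm \<xi>" for n \<xi>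
  proof (induction n arbitrary: \<xi>)
    case 0
    then show ?case using A(3)[of \<xi>] by (simp add: YS Y0 yS y0)
  next
    case (Suc n)
    let ?a = "Y (Suc n)" and ?b = "Y n"
    have "Y (Suc (Suc n)) \<xi> - Y (Suc n) \<xi> = (1/2) *\<^sub>R (?a (?a \<xi>) - ?b (?b \<xi>))"
      by (simp add: YS[of "Suc n"] YS[of n \<xi>] scaleR_diff_right scaleR_add_right)
    also have "?a (?a \<xi>) - ?b (?b \<xi>) = ?a (?a \<xi> + ?b \<xi>) - ?b (?a \<xi> + ?b \<xi>)"
      using M_apply_commute[OF YM[of "Suc n"] YM[of n]] Yb by (simp add: bounded_ops_add)
    finally have eq: "Y (Suc (Suc n)) \<xi> - Y (Suc n) \<xi> =
      (1/2) *\<^sub>R (?a (?a \<xi> + ?b \<xi>) - ?b (?a \<xi> + ?b \<xi>))" .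
    have "norm (?a \<xi> + ?b \<xi>) \<le> (y (Suc n) + y n) * norm \<xi>"
      using norm_triangle_ineq[of "?a \<xi>" "?b \<xi>"] Yn[of "Suc n" \<xi>] Yn[of n \<xi>]
      by (simp add: distrib_right)
    moreover have "0 \<le> (y (Suc n) - y n)"
    proof -
      have "y (Suc n) - y n = (1 - y n) * (1 - y n) / 2" by (simp add: yS algebra_simps)
      moreover have "(1 - y n) * (1 - y n) \<ge> 0" by simp
      ultimately show ?thesis by linarith
    qed
    ultimately have "norm (?a (?a \<xi> + ?b \<xi>) - ?b (?a \<xi> + ?b \<xi>)) \<le>
        (y (Suc n) - y n) * ((y (Suc n) + y n) * norm \<xi>)"
      using order_trans[OF Suc mult_left_mono] by blast
    moreover have "(y (Suc n) - y n) * (y (Suc n) + y n) = 2 * (y (Suc (Suc n)) - y (Suc n))"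
      by (simp add: yS[of "Suc n"] yS[of n] algebra_simps power2_eq_square)
    ultimately have "norm (?a (?a \<xi> + ?b \<xi>) - ?b (?a \<xi> + ?b \<xi>)) \<le>
        2 * ((y (Suc (Suc n)) - y (Suc n)) * norm \<xi>)"
      by (metis mult.assoc)
    then show ?case unfolding eq norm_scaleR by simp
  qed
  have diff: "norm (Y m \<xi> - Y n \<xi>) \<le> (y m - y n) * norm \<xi>" if "n \<le> m" for m n \<xi>
    using that
  proof (induction m rule: dec_induct)
    case (step m)
    have "Y (Suc m) \<xi> - Y n \<xi> = (Y (Suc m) \<xi> - Y m \<xi>) + (Y m \<xi> - Y n \<xi>)" by simp
    then have "norm (Y (Suc m) \<xi> - Y n \<xi>) \<le> norm (Y (Suc m) \<xi> - Y m \<xi>) + norm (Y m \<xi> - Y n \<xi>)"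
      using norm_triangle_ineq by metis
    then show ?case using step(3) \<open>\<And>n \<xi>. norm (Y (Suc n) \<xi> - Y n \<xi>) \<le> (y (Suc n) - y n) * norm \<xi>\<close>[of m \<xi>]
      by (simp add: algebra_simps)
  qed simp
  have "\<forall>n. y n \<le> 1" using yb by simp
  moreover have "incseq y"
  proof (rule incseq_SucI)
    fix n
    have "y (Suc n) - y n = (1 - y n) * (1 - y n) / 2" by (simp add: yS algebra_simps)
    moreover have "(1 - y n) * (1 - y n) \<ge> 0" by simp
    ultimately have "0 \<le> y (Suc n) - y n" by linarith
    then show "y n \<le> y (Suc n)" by simp
  qed
  ultimately obtain l where "y \<longlonglongrightarrow> l" using incseq_convergent by metis
  then have "convergent y" by (rule convergentI)
  then have yC: "Cauchy y" by (rule convergent_Cauchy)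
  have "convergent (\<lambda>n. Y n \<xi>)" for \<xi>
  proof (rule Cauchy_convergent, rule metric_CauchyI)
    fix e :: real assume e: "e > 0"
    then have "e / (norm \<xi> + 1) > 0" by (simp add: add_nonneg_pos)
    then obtain N where N: "\<And>m n. m \<ge> N \<Longrightarrow> n \<ge> N \<Longrightarrow> \<bar>y m - y n\<bar> < e / (norm \<xi> + 1)"
      using metric_CauchyD[OF yC, of "e / (norm \<xi> + 1)"] unfolding dist_real_def by blast
    have "dist (Y m \<xi>) (Y n \<xi>) < e" if "m \<ge> N" "n \<ge> N" for m n
    proof -
      have "norm (Y m \<xi> - Y n \<xi>) \<le> \<bar>y m - y n\<bar> * norm \<xi>"
      proof (cases "n \<le> m")
        case True
        have "(y m - y n) * norm \<xi> \<le> \<bar>y m - y n\<bar> * norm \<xi>" by (intro mult_right_mono) auto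
        then show ?thesis using diff[OF True, of \<xi>] by linarith
      next
        case False
        then have "norm (Y n \<xi> - Y m \<xi>) \<le> (y n - y m) * norm \<xi>" using diff by simp
        also have "\<dots> \<le> \<bar>y m - y n\<bar> * norm \<xi>" by (intro mult_right_mono) auto
        finally show ?thesis by (simp add: norm_minus_commute)
      qed
      also have "\<dots> \<le> \<bar>y m - y n\<bar> * (norm \<xi> + 1)" by (intro mult_left_mono) auto
      also have "\<dots> < e" using N[OF that] by (simp add: pos_less_divide_eq add_nonneg_pos)
      finally show ?thesis by (simp add: dist_norm)
    qed
    then show "\<exists>M. \<forall>m\<ge>M. \<forall>n\<ge>M. dist (Y m \<xi>) (Y n \<xi>) < e" by blast
  qed
  then obtain Z where Z: "\<And>\<xi>. (\<lambda>n. Y n \<xi>) \<longlonglongrightarrow> Z \<xi>" unfolding convergent_def by metis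
  have Yc: "norm (Y n \<xi>) \<le> norm \<xi>" for n \<xi>
    using Yn[of n \<xi>] mult_right_mono[of "y n" 1 "norm \<xi>"] yb[of n] by simp
  have Zn: "norm (Z \<xi>) \<le> norm \<xi>" for \<xi>
    by (rule Lim_bounded[OF tendsto_norm[OF Z]]) (use Yc in blast)
  have ZM: "Z \<in> M" using M_limit[OF YM Z, of 1] Zn by simp
  have YY: "(\<lambda>n. Y n (Y n \<xi>)) \<longlonglongrightarrow> Z (Z \<xi>)" for \<xi>
  proof -
    have "(\<lambda>n. Y n (Y n \<xi> - Z \<xi>)) \<longlonglongrightarrow> 0"
    proof (rule Lim_null_comparison)
      show "\<forall>\<^sub>F n in sequentially. norm (Y n (Y n \<xi> - Z \<xi>)) \<le> norm (Y n \<xi> - Z \<xi>)"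
        using Yc by simp
      show "(\<lambda>n. norm (Y n \<xi> - Z \<xi>)) \<longlonglongrightarrow> 0"
        using Z by (simp add: LIM_zero_iff tendsto_norm_zero)
    qed
    from tendsto_add[OF this Z[of "Z \<xi>"]] show ?thesis using Yb by (simp add: bounded_ops_diff)
  qed
  have lim1: "(\<lambda>n. A \<xi> + Y n (Y n \<xi>)) \<longlonglongrightarrow> 2 *\<^sub>R Z \<xi>" for \<xi>
  proof -
    have "(\<lambda>n. 2 *\<^sub>R Y (Suc n) \<xi>) \<longlonglongrightarrow> 2 *\<^sub>R Z \<xi>"
      by (intro tendsto_scaleR tendsto_const LIMSEQ_Suc Z)
    then show ?thesis by (simp add: YS)
  qed
  have eqn: "2 *\<^sub>R Z \<xi> = A \<xi> + Z (Z \<xi>)" for \<xi>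
    by (rule LIMSEQ_unique[OF lim1 tendsto_add[OF tendsto_const YY]])
  have "is_adjoint Z Z"
    unfolding is_adjoint_def
  proof (intro allI complex_eqI)
    have inn: "inner (Z \<xi>) \<eta> = inner \<xi> (Z \<eta>)" for \<xi> \<eta>
    proof (rule LIMSEQ_unique)
      show "(\<lambda>n. inner (Y n \<xi>) \<eta>) \<longlonglongrightarrow> inner (Z \<xi>) \<eta>" by (intro tendsto_intros Z)
      have "(\<lambda>n. inner \<xi> (Y n \<eta>)) \<longlonglongrightarrow> inner \<xi> (Z \<eta>)" by (intro tendsto_intros Z)
      then show "(\<lambda>n. inner (Y n \<xi>) \<eta>) \<longlonglongrightarrow> inner \<xi> (Z \<eta>)"
        using Ya by (simp add: is_adjoint_def flip: Re_cinner)
    qed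
    fix \<xi> \<eta>
    show "Re (cinner (Z \<xi>) \<eta>) = Re (cinner \<xi> (Z \<eta>))" using inn by (simp add: Re_cinner)
    show "Im (cinner (Z \<xi>) \<eta>) = Im (cinner \<xi> (Z \<eta>))"
      using inn[of \<xi> "\<i> *\<^sub>C \<eta>"] bounded[OF ZM]
      by (simp add: cinner_conv_inner bounded_ops_scaleC)
  qed
  then show ?thesis using that ZM Zn eqn by blast
qed

text \<open>
  Scale \<open>T\<close> to a contraction \<open>B\<close> and take \<open>sqrt (1 - A)\<close> for \<open>A = 1 - B * B\<close>.
\<close>

lemma absolute_value:
  assumes T: "T \<in> M" "is_adjoint T T"
  obtains R where "R \<in> M" "is_adjoint R R" "\<And>\<xi>. inner (R \<xi>) \<xi> \<ge> 0" "\<And>\<xi>. R (R \<xi>) = T (T \<xi>)"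
proof -
  obtain K where K: "K > 0" "\<And>\<xi>. norm (T \<xi>) \<le> norm \<xi> * K"
    using bounded_linear.pos_bounded[OF bounded_ops_bounded_linear[OF bounded[OF T(1)]]] by blast
  define B where "B = (\<lambda>\<xi>. inverse K *\<^sub>R T \<xi>)"
  have B: "B \<in> M" "is_adjoint B B" "norm (B \<xi>) \<le> norm \<xi>" for \<xi>
    using T M_scaleR K
    by (auto simp: B_def is_adjoint_def cinner_scaleR_left cinner_scaleR_right divide_simps
        simp flip: divide_inverse_commute)
  define A where "A = (\<lambda>\<xi>. \<xi> - B (B \<xi>))"
  have AM: "A \<in> M" unfolding A_def using B M_closure by simp
  have Aa: "is_adjoint A A"
    using B by (simp add: A_def is_adjoint_def cinner_diff_left cinner_diff_right)
  have An: "norm (A \<xi>) \<le> norm \<xi>" for \<xi>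
  proof -
    have "inner \<xi> (B (B \<xi>)) = (norm (B \<xi>))\<^sup>2"
      using B(2) by (metis Re_cinner is_adjoint_def power2_norm_eq_inner)
    then have "(norm (A \<xi>))\<^sup>2 = (norm \<xi>)\<^sup>2 - 2 * (norm (B \<xi>))\<^sup>2 + (norm (B (B \<xi>)))\<^sup>2"
      by (simp add: A_def power2_norm_eq_inner inner_diff_left inner_diff_right inner_commute)
    also have "\<dots> \<le> (norm \<xi>)\<^sup>2 - 2 * (norm (B \<xi>))\<^sup>2 + (norm (B \<xi>))\<^sup>2"
      using B(3)[of "B \<xi>"] by (simp add: power_mono)
    also have "\<dots> \<le> (norm \<xi>)\<^sup>2" by simp
    finally show ?thesis by (simp add: power2_le_iff_abs_le)
  qed
  obtain Y where Y: "Y \<in> M" "is_adjoint Y Y" "\<And>\<xi>. norm (Y \<xi>) \<le> norm \<xi>"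
    "\<And>\<xi>. 2 *\<^sub>R Y \<xi> = A \<xi> + Y (Y \<xi>)"
    using square_root_iteration[OF AM Aa An] by blast
  have sq: "(\<xi> - Y \<xi>) - Y (\<xi> - Y \<xi>) = B (B \<xi>)" for \<xi>
  proof -
    have "(\<xi> - Y \<xi>) - Y (\<xi> - Y \<xi>) = \<xi> - 2 *\<^sub>R Y \<xi> + Y (Y \<xi>)"
      using bounded[OF Y(1)] by (simp add: bounded_ops_diff scaleR_2)
    then show ?thesis by (simp add: Y(4) A_def)
  qed
  define R where "R = (\<lambda>\<xi>. K *\<^sub>R (\<xi> - Y \<xi>))"
  have RM: "R \<in> M" unfolding R_def using Y M_closure M_scaleR by simp
  have "is_adjoint R R"
    using Y by (simp add: R_def is_adjoint_def cinner_scaleR_left cinner_scaleR_right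
        cinner_diff_left cinner_diff_right)
  moreover have "inner (R \<xi>) \<xi> \<ge> 0" for \<xi>
  proof -
    have "inner (Y \<xi>) \<xi> \<le> norm (Y \<xi>) * norm \<xi>" by (rule norm_cauchy_schwarz)
    also have "\<dots> \<le> norm \<xi> * norm \<xi>" using Y(3) by (intro mult_right_mono) auto
    finally show ?thesis using K by (simp add: R_def inner_diff_left dot_square_norm power2_eq_square)
  qed
  moreover have "R (R \<xi>) = T (T \<xi>)" for \<xi>
  proof -
    have "R (R \<xi>) = K *\<^sub>R K *\<^sub>R ((\<xi> - Y \<xi>) - Y (\<xi> - Y \<xi>))"
      using bounded[OF Y(1)] by (simp add: R_def bounded_ops_scaleR flip: scaleR_diff_right)
    also have "\<dots> = K *\<^sub>R K *\<^sub>R (inverse K *\<^sub>R inverse K *\<^sub>R T (T \<xi>))"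
      using bounded[OF T(1)] unfolding sq by (simp add: B_def bounded_ops_scaleR)
    also have "\<dots> = (K * inverse K) *\<^sub>R (K * inverse K) *\<^sub>R T (T \<xi>)" by (simp add: mult_ac)
    also have "\<dots> = T (T \<xi>)" using K by simp
    finally show ?thesis .
  qed
  ultimately show ?thesis using that RM by blast
qed

text \<open>
  The form in which the spectral theorem is used.  With \<open>R\<close> the absolute value of \<open>T\<close>, the identity
  \<open>(R + T) (R - T) = 0\<close> shows that the kernel projection of \<open>R + T\<close> separates the negative part of
  \<open>T\<close>, where \<open>T = - R\<close>, from the positive part, where \<open>T = R\<close>.
\<close>

lemma spectral_cut:
  assumes T: "T \<in> M" "is_adjoint T T"
  obtains e where "e \<in> projections M" "\<And>\<xi>. inner (T (e \<xi>)) (e \<xi>) \<ge> 0"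
    "\<And>\<xi>. inner (T (perp e \<xi>)) (perp e \<xi>) \<le> 0"
proof -
  obtain R where R: "R \<in> M" "is_adjoint R R" "\<And>\<xi>. inner (R \<xi>) \<xi> \<ge> 0" "\<And>\<xi>. R (R \<xi>) = T (T \<xi>)"
    using absolute_value[OF T] by blast
  define N where "N = (\<lambda>\<xi>. R \<xi> + T \<xi>)"
  have NM: "N \<in> M" unfolding N_def using R T M_closure by simp
  obtain f where f: "f \<in> projections M" "\<And>\<eta>. f \<eta> = \<eta> \<longleftrightarrow> N \<eta> = 0"
    using kernel_projection[of "{N}"] NM by auto
  have fN: "N (f \<xi>) = 0" for \<xi> using f(2)[of "f \<xi>"] projD(2)[OF f(1)] by simp
  have "N (R \<xi> - T \<xi>) = 0" for \<xi>
    using R T bounded[OF R(1)] bounded[OF T(1)] M_apply_commute[OF R(1) T(1)]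
    by (simp add: N_def bounded_ops_diff)
  then have fR: "f (R \<xi> - T \<xi>) = R \<xi> - T \<xi>" for \<xi> using f(2) by blast
  have pT: "T (perp f \<xi>) = R (perp f \<xi>)" for \<xi>
  proof -
    have "R (perp f \<xi>) - T (perp f \<xi>) = f (R (perp f \<xi>) - T (perp f \<xi>))" using fR by simp
    also have "\<dots> = R (f (perp f \<xi>)) - T (f (perp f \<xi>))"
      by (simp add: proj_commute[OF f(1) R(1)] proj_commute[OF f(1) T(1)]
        bounded_ops_diff[OF proj_bounded[OF f(1)]])
    also have "\<dots> = 0"
      using bounded[OF R(1)] bounded[OF T(1)] by (simp add: perp_orth(1)[OF f(1)] bounded_ops_zero)
    finally show ?thesis by simp
  qed
  show ?thesis
  proof (rule that[OF proj_perp[OF f(1)]])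
    show "inner (T (perp f \<xi>)) (perp f \<xi>) \<ge> 0" for \<xi> using pT R(3) by metis
    have "T (f \<xi>) = - R (f \<xi>)" for \<xi> using fN[of \<xi>] by (simp add: N_def add_eq_0_iff)
    then show "inner (T (perp (perp f) \<xi>)) (perp (perp f) \<xi>) \<le> 0" for \<xi> using R(3) by simp
  qed
qed

text \<open>
  The range of \<open>a\<close> on \<open>e\<close> is closed because \<open>a\<close> is bounded below there.  It is all of the range of \<open>e\<close>
  because \<open>a\<close> is normal, so that a vector orthogonal to it, being in the kernel of the adjoint, is in
  the kernel of \<open>a\<close>.
\<close>

lemma bounded_below_inverse:
  assumes a: "a \<in> M" and e: "e \<in> projections M" and \<delta>: "\<delta> > 0"
    and below: "\<And>\<xi>. norm (a (e \<xi>)) \<ge> \<delta> * norm (e \<xi>)"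
  obtains b where "b \<in> M" "\<And>\<xi>. a (b \<xi>) = e \<xi>" "\<And>\<xi>. e (b \<xi>) = b \<xi>"
proof -
  note ab = bounded[OF a] and eb = proj_bounded[OF e]
  define V where "V = range (\<lambda>\<xi>. a (e \<xi>))"
  have Ve: "e v = v" if "v \<in> V" for v
    using that proj_commute[OF e a] projD(2)[OF e] by (auto simp: V_def)
  have linV: "linear_subspace V"
    unfolding linear_subspace_def V_def
    using bounded_ops_zero[OF ab] bounded_ops_zero[OF eb]
    by (auto simp: image_iff simp flip: bounded_ops_add[OF ab] bounded_ops_add[OF eb]
        bounded_ops_scaleC[OF ab] bounded_ops_scaleC[OF eb])
      metis
  have clV: "closed V"
  proof (rule closed_sequential_limits[THEN iffD2], intro allI impI, elim conjE)
    fix X l assume X: "\<forall>n. X n \<in> V" and lim: "X \<longlonglongrightarrow> l"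
    from X have "\<forall>n. \<exists>\<xi>. X n = a (e \<xi>)" unfolding V_def by blast
    then obtain \<xi> where \<xi>: "\<And>n. X n = a (e (\<xi> n))" by metis
    have "Cauchy (\<lambda>n. e (\<xi> n))"
    proof (rule metric_CauchyI)
      fix \<epsilon> :: real assume "\<epsilon> > 0"
      then have "\<delta> * \<epsilon> > 0" using \<delta> by simp
      then obtain N where N: "\<And>m n. m \<ge> N \<Longrightarrow> n \<ge> N \<Longrightarrow> dist (X m) (X n) < \<delta> * \<epsilon>"
        using metric_CauchyD[OF LIMSEQ_imp_Cauchy[OF lim]] by metis
      have "dist (e (\<xi> m)) (e (\<xi> n)) < \<epsilon>" if "m \<ge> N" "n \<ge> N" for m n
      proof -
        have "\<delta> * norm (e (\<xi> m - \<xi> n)) \<le> norm (a (e (\<xi> m - \<xi> n)))" by (rule below)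
        also have "\<dots> < \<delta> * \<epsilon>" using N[OF that] ab eb by (simp add: dist_norm \<xi> bounded_ops_diff)
        finally show ?thesis using \<delta> eb by (simp add: dist_norm bounded_ops_diff)
      qed
      then show "\<exists>M. \<forall>m\<ge>M. \<forall>n\<ge>M. dist (e (\<xi> m)) (e (\<xi> n)) < \<epsilon>" by blast
    qed
    then obtain \<zeta> where \<zeta>: "(\<lambda>n. e (\<xi> n)) \<longlonglongrightarrow> \<zeta>" using Cauchy_convergent convergent_def by blast
    have "(\<lambda>n. e (e (\<xi> n))) \<longlonglongrightarrow> e \<zeta>" using bounded_ops_continuous[OF eb \<zeta>] .
    then have "(\<lambda>n. e (\<xi> n)) \<longlonglongrightarrow> e \<zeta>" by (simp add: projD(2)[OF e])
    from LIMSEQ_unique[OF this \<zeta>] have "e \<zeta> = \<zeta>" .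
    moreover have "X \<longlonglongrightarrow> a \<zeta>" using bounded_ops_continuous[OF ab \<zeta>] by (simp flip: \<xi>)
    ultimately have "l = a (e \<zeta>)" using LIMSEQ_unique[OF lim] by simp
    then show "l \<in> V" by (simp add: V_def)
  qed
  obtain q where q: "q \<in> bounded_ops" "is_adjoint q q" "\<And>\<xi>. q \<xi> \<in> V" "\<And>\<xi>. \<xi> \<in> V \<Longrightarrow> q \<xi> = \<xi>"
    "\<And>\<xi> w. w \<in> V \<Longrightarrow> cinner (\<xi> - q \<xi>) w = 0"
    by (rule orthogonal_projection_exists[OF clV linV]) (rule that)
  obtain s where s: "s \<in> M" "is_adjoint a s" using adjoint_in_M[OF a] by blast
  have norms: "norm (s \<zeta>) = norm (a \<zeta>)" for \<zeta>
  proof -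
    have "cinner (s \<zeta>) (s \<zeta>) = cinner (a (s \<zeta>)) \<zeta>" using s(2) by (simp add: is_adjoint_def)
    also have "\<dots> = cinner (s (a \<zeta>)) \<zeta>" using M_apply_commute[OF a s(1)] by simp
    also have "\<dots> = cinner (a \<zeta>) (a \<zeta>)" using is_adjoint_sym[OF s(2)] by (simp add: is_adjoint_def)
    finally have "complex_of_real ((norm (s \<zeta>))\<^sup>2) = of_real ((norm (a \<zeta>))\<^sup>2)" by (simp only: cinner_self)
    then have "(norm (s \<zeta>))\<^sup>2 = (norm (a \<zeta>))\<^sup>2" using of_real_eq_iff by blast
    then show ?thesis by (simp add: power2_eq_iff_nonneg)
  qed
  have surj: "e \<xi> \<in> V" for \<xi>
  proof -
    define d where "d = e \<xi> - q (e \<xi>)"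
    have ed: "e d = d" using Ve[OF q(3)] projD(2)[OF e] eb by (simp add: d_def bounded_ops_diff)
    have "s d = 0"
    proof (rule cinner_ext)
      fix \<zeta>
      have "cinner (s d) \<zeta> = cinner d (a \<zeta>)" using is_adjoint_sym[OF s(2)] by (simp add: is_adjoint_def)
      also have "\<dots> = cinner d (a (e \<zeta>))"
        using projD(3)[OF e, of d "a \<zeta>"] ed proj_commute[OF e a] by simp
      also have "\<dots> = 0" unfolding d_def by (rule q(5)) (simp add: V_def)
      finally show "cinner (s d) \<zeta> = cinner 0 \<zeta>" by simp
    qed
    then have "norm (a (e d)) = 0" using norms[of d] ed by simp
    then have "\<delta> * norm (e d) \<le> 0" using below[of d] by simp
    then have "d = 0" using ed \<delta> by (simp add: mult_le_0_iff)
    then show ?thesis using q(3)[of "e \<xi>"] by (simp add: d_def)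
  qed
  then have "\<forall>\<xi>. \<exists>\<zeta>. e \<zeta> = \<zeta> \<and> a \<zeta> = e \<xi>"
    unfolding V_def using projD(2)[OF e] by (metis rangeE)
  then obtain b where b: "\<And>\<xi>. e (b \<xi>) = b \<xi>" "\<And>\<xi>. a (b \<xi>) = e \<xi>" by metis
  have inj: "x = y" if "e x = x" "e y = y" "a x = a y" for x y
  proof -
    have "\<delta> * norm (e (x - y)) \<le> norm (a (e (x - y)))" by (rule below)
    also have "\<dots> = 0" using that ab eb by (simp add: bounded_ops_diff)
    finally show ?thesis using \<delta> that eb by (simp add: mult_le_0_iff bounded_ops_diff)
  qed
  have "b \<in> M"
  proof (rule memI)
    show "b \<in> bounded_ops"
    proof (rule bounded_opsI[where K = "1/\<delta>"])
      show "b (x + y) = b x + b y" for x y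
        by (rule inj) (simp_all add: b bounded_ops_add[OF ab] bounded_ops_add[OF eb])
      show "b (c *\<^sub>C x) = c *\<^sub>C b x" for c x
        by (rule inj) (simp_all add: b bounded_ops_scaleC[OF ab] bounded_ops_scaleC[OF eb])
      show "norm (b x) \<le> 1/\<delta> * norm x" for x
      proof -
        have "\<delta> * norm (b x) \<le> norm (e x)" using below[of "b x"] b by simp
        also have "\<dots> \<le> norm x" using norm_proj_le[OF e] .
        finally show ?thesis using \<delta> by (simp add: field_simps)
      qed
    qed
    show "b (u \<xi>) = u (b \<xi>)" if u: "u \<in> commutant M" for u \<xi>
      by (rule inj) (use commutantD[OF u a] commutantD[OF u projD(1)[OF e]] b in metis)+
  qed
  then show ?thesis using that b by blast
qed

end


section \<open>The ring of measurable operators\<close>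

context commutative_vna
begin

text \<open>
  In a commutative algebra equivalent projections are equal.
\<close>

lemma finite_projection_iff: "finite_projection M p \<longleftrightarrow> p \<in> projections M"
proof -
  have "q = p" if "mvn_equiv M p q" for q
    using that comm by (auto simp: mvn_equiv_def commutative_def)
  then show ?thesis by (auto simp: finite_projection_def)
qed

definition countably_total :: "('h \<Rightarrow> 'h) set \<Rightarrow> bool" where
  "countably_total S \<longleftrightarrow> (\<exists>P\<subseteq>S. countable P \<and> total P)"

inductive_set join_hull :: "('h \<Rightarrow> 'h) set \<Rightarrow> ('h \<Rightarrow> 'h) set" for P where
  hull_zero: "(\<lambda>\<xi>. 0) \<in> join_hull P"
| hull_base: "p \<in> P \<Longrightarrow> p \<in> join_hull P"
| hull_join: "p \<in> join_hull P \<Longrightarrow> q \<in> join_hull P \<Longrightarrow> p \<in> projections M \<Longrightarrow> q \<in> projections M \<Longrightarrow>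
    join p q \<in> join_hull P"

text \<open>
  The finite joins of an enumeration of \<open>P\<close> increase to the identity, strongly: an increasing
  sequence of projections converges, and totality identifies the limit.
\<close>

lemma total_sequence:
  assumes P: "countable P" "total P"
  obtains J where "\<And>n. J n \<in> projections M" "\<And>n \<xi>. J (Suc n) (J n \<xi>) = J n \<xi>"
    "\<And>\<xi>. (\<lambda>n. J n \<xi>) \<longlonglongrightarrow> \<xi>"
    "\<And>n. J n \<in> join_hull P"
proof -
  \<comment> \<open>the zero projection provides an enumeration in case \<open>P\<close> is empty\<close>
  define P' where "P' = insert (\<lambda>\<xi>. 0) P"
  have PM: "p \<in> projections M" if "p \<in> P'" for p
    using P(2) that proj_zero by (auto simp: P'_def total_def)
  define f where "f = from_nat_into P'"
  have f: "range f = P'" unfolding f_def using P(1) by (intro range_from_nat_into) (auto simp: P'_def)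
  define J where "J = rec_nat (f 0) (\<lambda>n J. join J (f (Suc n)))"
  have J0: "J 0 = f 0" and JS: "J (Suc n) = join (J n) (f (Suc n))" for n
    by (simp_all add: J_def)
  have fM: "f n \<in> projections M" for n using f PM by blast
  have JM: "J n \<in> projections M" for n by (induction n) (auto simp: J0 JS fM proj_join)
  note Jb = proj_bounded[OF JM]
  have up: "J (Suc n) (J n \<xi>) = J n \<xi>" for n \<xi>
    using proj_commute[OF JM projD(1)[OF fM], of "Suc n" n] perp_orth(2)[OF JM]
      bounded_ops_zero[OF proj_bounded[OF proj_perp[OF JM]]]
    unfolding JS join_def
    by (simp add: projD[OF JM] proj_commute[OF JM projD(1)[OF fM]])
  have upm: "J m (J n \<xi>) = J n \<xi>" if "n \<le> m" for m n \<xi>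
    using that
  proof (induction m rule: dec_induct)
    case (step m)
    then show ?case using up[of m "J n \<xi>"] by simp
  qed (simp add: projD[OF JM])
  have fJ: "J n (f n \<xi>) = f n \<xi>" for n \<xi>
  proof (cases n)
    case (Suc m)
    have "J m (f n \<xi>) + perp (J m) (f n (f n \<xi>)) = f n \<xi>"
      by (simp add: perp_def projD(2)[OF fM])
    then show ?thesis by (simp add: Suc JS join_def)
  qed (simp add: J0 projD(2)[OF fM])
  have orth: "(norm (J m \<xi> - J n \<xi>))\<^sup>2 = (norm (J m \<xi>))\<^sup>2 - (norm (J n \<xi>))\<^sup>2" if "n \<le> m" for m n \<xi>
  proof -
    have "J n (J m \<xi>) = J n \<xi>"
      using upm[OF that] proj_commute[OF JM projD(1)[OF JM]] by metis
    then show ?thesis using proj_pythagoras[OF JM, of "J m \<xi>" n] by (simp add: perp_def)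
  qed
  have conv: "(\<lambda>n. J n \<xi>) \<longlonglongrightarrow> \<xi>" for \<xi>
  proof -
    define y where "y n = (norm (J n \<xi>))\<^sup>2" for n
    have "incseq y"
      unfolding incseq_def y_def using orth zero_le_power2 by (metis diff_ge_0_iff_ge)
    moreover have "y n \<le> (norm \<xi>)\<^sup>2" for n
      unfolding y_def using norm_proj_le[OF JM] by (simp add: power_mono)
    ultimately have "convergent y" using incseq_convergent convergent_def by metis
    then have yC: "Cauchy y" by (rule convergent_Cauchy)
    have "Cauchy (\<lambda>n. J n \<xi>)"
    proof (rule metric_CauchyI)
      fix e :: real assume e: "e > 0"
      then obtain N where N: "\<And>m n. m \<ge> N \<Longrightarrow> n \<ge> N \<Longrightarrow> \<bar>y m - y n\<bar> < e\<^sup>2"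
        using metric_CauchyD[OF yC, of "e\<^sup>2"] zero_less_power[OF e, of 2]
        unfolding dist_real_def by meson
      have "dist (J m \<xi>) (J n \<xi>) < e" if "m \<ge> N" "n \<ge> N" for m n
      proof -
        have "(norm (J m \<xi> - J n \<xi>))\<^sup>2 = \<bar>y m - y n\<bar>"
        proof (cases "n \<le> m")
          case True
          then show ?thesis using orth[OF True, of \<xi>] by (metis abs_of_nonneg y_def zero_le_power2)
        next
          case False
          then have "n \<ge> m" by simp
          from orth[OF this, of \<xi>] show ?thesis
            by (metis abs_minus_commute abs_of_nonneg norm_minus_commute y_def zero_le_power2)
        qed
        then have "(norm (J m \<xi> - J n \<xi>))\<^sup>2 < e\<^sup>2" using N[OF that] by simp
        then show ?thesis using e by (simp add: dist_norm power_less_imp_less_base)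
      qed
      then show "\<exists>M. \<forall>m\<ge>M. \<forall>n\<ge>M. dist (J m \<xi>) (J n \<xi>) < e" by blast
    qed
    then obtain l where l: "(\<lambda>n. J n \<xi>) \<longlonglongrightarrow> l" using Cauchy_convergent convergent_def by blast
    have "\<xi> - l = 0"
    proof (rule total_separates[OF P(2)])
      fix p assume "p \<in> P"
      then obtain k where k: "p = f k" using f by (metis P'_def insertI2 rangeE)
      have pM: "p \<in> projections M" using fM k by simp
      have "p (J n \<xi>) = p \<xi>" if "n \<ge> k" for n
      proof -
        have "J n (p \<xi>) = p \<xi>" using upm[OF that, of "p \<xi>"] fJ[of k \<xi>] k by simp
        then show ?thesis using proj_commute[OF JM projD(1)[OF pM]] by simp
      qed
      then have "eventually (\<lambda>n. p (J n \<xi>) = p \<xi>) sequentially"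
        by (auto simp: eventually_sequentially)
      then have "(\<lambda>n. p (J n \<xi>)) \<longlonglongrightarrow> p \<xi>" by (rule tendsto_eventually)
      moreover have "(\<lambda>n. p (J n \<xi>)) \<longlonglongrightarrow> p l"
        by (rule bounded_ops_continuous[OF proj_bounded[OF pM] l])
      ultimately have "p \<xi> = p l" by (rule LIMSEQ_unique)
      then show "p (\<xi> - l) = 0" using proj_bounded[OF pM] by (simp add: bounded_ops_diff)
    qed
    then show ?thesis using l by simp
  qed
  have "f k \<in> join_hull P" for k using f join_hull.intros(1,2) by (metis P'_def insertE rangeI)
  then have ind: "J n \<in> join_hull P" for n
    by (induction n) (auto simp: J0 JS intro!: join_hull.intros(3) JM fM)
  show ?thesis using that[OF JM up conv ind] by blast
qed

lemma join_in_subspace: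
  assumes D: "linear_subspace D" and p: "p \<in> projections M" and q: "q \<in> projections M"
    and "range p \<subseteq> D" "range q \<subseteq> D"
  shows "range (join p q) \<subseteq> D"
proof -
  have "p \<xi> + q (perp p \<xi>) \<in> D" for \<xi>
    using assms by (auto simp: linear_subspace_def)
  moreover have "join p q \<xi> = p \<xi> + q (perp p \<xi>)" for \<xi>
    using proj_commute[OF p projD(1)[OF q]] proj_bounded[OF q]
    by (simp add: join_def perp_def bounded_ops_diff)
  ultimately show ?thesis by auto
qed

text \<open>
  In the commutative case strong density only asks for countably many projections below the domain
  with supremum \<open>1\<close>; taking finite joins makes the sequence increasing.
\<close>

lemma strongly_dense_iff:
  "strongly_dense M D \<longleftrightarrow>
    affiliated_subspace M D \<and> countably_total {p \<in> projections M. range p \<subseteq> D}"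
proof
  assume sd: "strongly_dense M D"
  from conjunct2[OF sd[unfolded strongly_dense_def]]
  obtain p where "(\<forall>n. p n \<in> projections M) \<and> (\<forall>n. p n \<le>\<^sub>o\<^sub>p p (Suc n)) \<and>
    is_lub_in (projections M) (range p) id \<and> (\<forall>n. range (p n) \<subseteq> D) \<and>
    (\<forall>n. finite_projection M (perp (p n)))" by (rule exE)
  then have p: "\<And>n. p n \<in> projections M" "is_lub_in (projections M) (range p) id"
    "\<And>n. range (p n) \<subseteq> D" by simp_all
  have "total (range p)"
    unfolding total_def
  proof (intro conjI ballI impI allI)
    show "range p \<subseteq> projections M" using p by blast
    fix r \<xi> assume r: "r \<in> projections M" "\<forall>p\<in>range p. \<forall>\<xi>. p (r \<xi>) = 0"
    have "p n \<le>\<^sub>o\<^sub>p perp r" for n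
      unfolding proj_le_iff[OF p(1) proj_perp[OF r(1)]]
      using r(2) proj_commute[OF r(1) projD(1)[OF p(1)[of n]]] by (simp add: perp_def)
    then have "id \<le>\<^sub>o\<^sub>p perp r" using p(2) proj_perp[OF r(1)] by (auto simp: is_lub_in_def)
    then have "perp r \<xi> = \<xi>"
      using proj_le_iff[of id "perp r"] proj_id proj_perp[OF r(1)] by (auto simp: id_def)
    then show "r \<xi> = 0" by (simp add: perp_def)
  qed
  then show "affiliated_subspace M D \<and> countably_total {p \<in> projections M. range p \<subseteq> D}"
    using conjunct1[OF sd[unfolded strongly_dense_def]] p(1,3)
    unfolding countably_total_def by (intro conjI exI[of _ "range p"]) auto
next
  assume R: "affiliated_subspace M D \<and> countably_total {p \<in> projections M. range p \<subseteq> D}"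
  then obtain P where P: "countable P" "total P" "P \<subseteq> {p \<in> projections M. range p \<subseteq> D}"
    by (auto simp: countably_total_def)
  have D: "linear_subspace D" using R by (simp add: affiliated_subspace_def)
  obtain J where J: "\<And>n. J n \<in> projections M" "\<And>n \<xi>. J (Suc n) (J n \<xi>) = J n \<xi>"
    "\<And>\<xi>. (\<lambda>n. J n \<xi>) \<longlonglongrightarrow> \<xi>"
    and hull: "\<And>n. J n \<in> join_hull P"
    by (rule total_sequence[OF P(1,2)]) (rule that)
  have "range p \<subseteq> D" if "p \<in> join_hull P" for p
    using that
  proof (induction rule: join_hull.induct)
    case hull_zero then show ?case using D by (auto simp: linear_subspace_def)
  next
    case (hull_base p) then show ?case using P(3) by blast
  next
    case (hull_join p q) then show ?case by (intro join_in_subspace[OF D])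
  qed
  then have "range (J n) \<subseteq> D" for n using hull by blast
  moreover have "J n \<le>\<^sub>o\<^sub>p J (Suc n)" for n using proj_le_iff[OF J(1) J(1)] J(2) by blast
  moreover have "is_lub_in (projections M) (range J) id"
    unfolding is_lub_in_def
  proof (intro conjI ballI impI)
    show "id \<in> projections M" using proj_id by (simp add: id_def)
    show "x \<le>\<^sub>o\<^sub>p id" if "x \<in> range J" for x
      using that proj_le_iff[of x id] J(1) \<open>id \<in> projections M\<close> by auto
    fix z assume z: "z \<in> projections M" "\<forall>x\<in>range J. x \<le>\<^sub>o\<^sub>p z"
    have "z \<xi> = \<xi>" for \<xi>
    proof (rule LIMSEQ_unique)
      show "(\<lambda>n. J n \<xi>) \<longlonglongrightarrow> \<xi>" by (rule J)
      have "z (J n \<xi>) = J n \<xi>" for n using z proj_le_iff[OF J(1) z(1)] by auto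
      then show "(\<lambda>n. J n \<xi>) \<longlonglongrightarrow> z \<xi>"
        using bounded_ops_continuous[OF proj_bounded[OF z(1)] J(3)[of \<xi>]] by simp
    qed
    then show "id \<le>\<^sub>o\<^sub>p z" using proj_le_iff[of id z] z(1) \<open>id \<in> projections M\<close> by simp
  qed
  ultimately show "strongly_dense M D"
    using R J(1) proj_perp finite_projection_iff unfolding strongly_dense_def by blast
qed

text \<open>
  Two such domains have a common one, given by the products of their projections.
\<close>

lemma countably_total_comp:
  assumes "countably_total S" "countably_total T"
    and closed: "\<And>p q. p \<in> S \<Longrightarrow> q \<in> T \<Longrightarrow> (\<lambda>\<xi>. p (q \<xi>)) \<in> U"
  shows "countably_total U"
proof -
  obtain P Q where P: "P \<subseteq> S" "countable P" "total P" and Q: "Q \<subseteq> T" "countable Q" "total Q"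
    using assms by (auto simp: countably_total_def)
  define X where "X = (\<lambda>(p, q) \<xi>. p (q \<xi>)) ` (P \<times> Q)"
  have "total X"
    unfolding total_def
  proof (intro conjI ballI impI)
    show "X \<subseteq> projections M"
    proof
      fix r assume "r \<in> X"
      then obtain p q where "p \<in> P" "q \<in> Q" "r = (\<lambda>\<xi>. p (q \<xi>))" by (auto simp: X_def)
      moreover then have "p \<in> projections M" "q \<in> projections M"
        using P(3) Q(3) by (auto simp: total_def)
      ultimately show "r \<in> projections M" using proj_comp[of p q] by simp
    qed
    fix r assume r: "r \<in> projections M" "\<forall>p\<in>X. \<forall>\<xi>. p (r \<xi>) = 0"
    have "q (r \<xi>) = 0" if q: "q \<in> Q" for q \<xi>
    proof -
      have "p (q (r \<zeta>)) = 0" if "p \<in> P" for p \<zeta> using r(2) q that by (force simp: X_def)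
      moreover have "q \<in> projections M" using q Q(3) by (auto simp: total_def)
      from proj_comp[OF this r(1)] have "(\<lambda>\<xi>. q (r \<xi>)) \<in> projections M" .
      ultimately show ?thesis using P(3) unfolding total_def by fastforce
    qed
    then show "\<forall>\<xi>. r \<xi> = 0" using Q(3) r(1) by (auto simp: total_def)
  qed
  moreover have "countable X" "X \<subseteq> U" using P Q closed by (auto simp: X_def)
  ultimately show ?thesis by (auto simp: countably_total_def)
qed

definition dom_projs :: "'h graph \<Rightarrow> ('h \<Rightarrow> 'h) set" where
  "dom_projs x = {p \<in> projections M. range p \<subseteq> Domain x}"

lemma proj_in_dom: "p \<in> dom_projs x \<Longrightarrow> p \<in> projections M"
  by (simp add: dom_projs_def)

lemma proj_bounded': "p \<in> dom_projs x \<Longrightarrow> p \<in> bounded_ops"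
  using proj_in_dom proj_bounded by blast

text \<open>
  The bounded operator \<open>x p\<close>, for \<open>p\<close> in \<open>dom_projs x\<close>.
\<close>

definition res :: "'h graph \<Rightarrow> ('h \<Rightarrow> 'h) \<Rightarrow> 'h \<Rightarrow> 'h" where
  "res x p = (\<lambda>\<xi>. THE \<eta>. (p \<xi>, \<eta>) \<in> x)"

lemma measurable_iff:
  "x \<in> measurable_ops M \<longleftrightarrow> affiliated_operator M x \<and> closed x \<and> countably_total (dom_projs x)"
  by (auto simp: measurable_ops_def strongly_dense_iff dom_projs_def affiliated_operator_def)

lemma linear_operatorD:
  assumes "linear_operator x"
  shows "(\<xi>, \<eta>) \<in> x \<Longrightarrow> (\<xi>, \<eta>') \<in> x \<Longrightarrow> \<eta> = \<eta>'"
    "(0, 0) \<in> x" "(\<xi>, \<eta>) \<in> x \<Longrightarrow> (\<xi>', \<eta>') \<in> x \<Longrightarrow> (\<xi> + \<xi>', \<eta> + \<eta>') \<in> x"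
    "(\<xi>, \<eta>) \<in> x \<Longrightarrow> (c *\<^sub>C \<xi>, c *\<^sub>C \<eta>) \<in> x"
    "(\<xi>, \<eta>) \<in> x \<Longrightarrow> (\<xi>', \<eta>') \<in> x \<Longrightarrow> (\<xi> - \<xi>', \<eta> - \<eta>') \<in> x"
proof -
  show 1: "(\<xi>, \<eta>) \<in> x \<Longrightarrow> (\<xi>, \<eta>') \<in> x \<Longrightarrow> \<eta> = \<eta>'" "(0, 0) \<in> x"
    using assms by (auto simp: linear_operator_def single_valued_def)
  have ax: "\<forall>(\<xi>, \<xi>')\<in>x. \<forall>(\<eta>, \<eta>')\<in>x. (\<xi> + \<eta>, \<xi>' + \<eta>') \<in> x"
    "\<forall>c. \<forall>(\<xi>, \<xi>')\<in>x. (c *\<^sub>C \<xi>, c *\<^sub>C \<xi>') \<in> x"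
    using assms unfolding linear_operator_def by blast+
  show 2: "(\<xi>, \<eta>) \<in> x \<Longrightarrow> (\<xi>', \<eta>') \<in> x \<Longrightarrow> (\<xi> + \<xi>', \<eta> + \<eta>') \<in> x" for \<xi> \<eta> \<xi>' \<eta>'
    using ax(1) by blast
  show 3: "(\<xi>, \<eta>) \<in> x \<Longrightarrow> (c *\<^sub>C \<xi>, c *\<^sub>C \<eta>) \<in> x" for \<xi> \<eta> c
    using ax(2) by blast
  show "(\<xi>, \<eta>) \<in> x \<Longrightarrow> (\<xi>', \<eta>') \<in> x \<Longrightarrow> (\<xi> - \<xi>', \<eta> - \<eta>') \<in> x"
    using 2[of \<xi> \<eta> "(-1) *\<^sub>C \<xi>'" "(-1) *\<^sub>C \<eta>'"] 3[of \<xi>' \<eta>' "-1"] by (simp add: scaleC_minus1)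
qed

lemma affiliated_linear: "affiliated_operator M x \<Longrightarrow> linear_operator x"
  by (simp add: affiliated_operator_def)

lemma affiliated_commutant:
  "affiliated_operator M x \<Longrightarrow> u \<in> commutant M \<Longrightarrow> (\<xi>, \<eta>) \<in> x \<Longrightarrow> (u \<xi>, u \<eta>) \<in> x"
  by (auto simp: affiliated_operator_def)

lemma affiliatedI:
  assumes "linear_operator x" "\<And>u \<xi> \<eta>. u \<in> commutant M \<Longrightarrow> (\<xi>, \<eta>) \<in> x \<Longrightarrow> (u \<xi>, u \<eta>) \<in> x"
  shows "affiliated_operator M x"
  unfolding affiliated_operator_def affiliated_subspace_def
proof (intro conjI ballI allI impI)
  show "linear_subspace (Domain x)"
    unfolding linear_subspace_def using linear_operatorD[OF assms(1)] by (blast intro: DomainI elim: DomainE)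
qed (use assms in \<open>auto simp: linear_operator_def\<close>)

context
  fixes x assumes x: "affiliated_operator M x" "closed x"
begin

lemma res_mem: "p \<in> dom_projs x \<Longrightarrow> (p \<xi>, res x p \<xi>) \<in> x"
proof -
  assume "p \<in> dom_projs x"
  then have "p \<xi> \<in> Domain x" by (auto simp: dom_projs_def)
  then have "\<exists>!\<eta>. (p \<xi>, \<eta>) \<in> x"
    using linear_operatorD(1)[OF affiliated_linear[OF x(1)]] by blast
  then show ?thesis unfolding res_def by (rule theI')
qed

lemma res_eqI: "p \<in> dom_projs x \<Longrightarrow> (p \<xi>, \<eta>) \<in> x \<Longrightarrow> res x p \<xi> = \<eta>"
  using res_mem linear_operatorD(1)[OF affiliated_linear[OF x(1)]] by blast

lemma res_in_M:
  assumes p: "p \<in> dom_projs x" shows "res x p \<in> M"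
proof (rule memI)
  note lin = linear_operatorD[OF affiliated_linear[OF x(1)]]
  have pM: "p \<in> projections M" using p by (simp add: dom_projs_def)
  note pb = proj_bounded[OF pM]
  have add: "res x p (\<xi> + \<eta>) = res x p \<xi> + res x p \<eta>" for \<xi> \<eta>
    by (rule res_eqI[OF p]) (use lin(3)[OF res_mem[OF p] res_mem[OF p]] pb in \<open>simp add: bounded_ops_add\<close>)
  have scale: "res x p (c *\<^sub>C \<xi>) = c *\<^sub>C res x p \<xi>" for c \<xi>
    by (rule res_eqI[OF p]) (use lin(4)[OF res_mem[OF p]] pb in \<open>simp add: bounded_ops_scaleC\<close>)
  have "linear (res x p)" by (rule linearI) (simp_all add: add scale scaleR_scaleC)
  moreover have "closed {(\<xi>, res x p \<xi>) |\<xi>. True}"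
  proof -
    have "{(\<xi>, res x p \<xi>) |\<xi>. True} = (\<lambda>z. (p (fst z), snd z)) -` x"
      using res_mem[OF p] res_eqI[OF p] by auto
    moreover have "continuous_on UNIV (\<lambda>z::'h\<times>'h. (p (fst z), snd z))"
      by (intro continuous_intros bounded_linear.continuous_on[OF bounded_ops_bounded_linear[OF pb]])
    ultimately show ?thesis using closed_vimage[OF x(2)] by simp
  qed
  ultimately have "bounded_linear (res x p)" by (rule closed_graph_theorem)
  then show "res x p \<in> bounded_ops" by (simp add: bounded_ops_def scale)
  show "res x p (u \<xi>) = u (res x p \<xi>)" if u: "u \<in> commutant M" for u \<xi>
    by (rule res_eqI[OF p])
      (use affiliated_commutant[OF x(1) u res_mem[OF p]] commutantD[OF u projD(1)[OF pM]] in simp)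
qed

lemma res_proj: "p \<in> dom_projs x \<Longrightarrow> res x p (p \<xi>) = res x p \<xi>"
  by (simp add: res_def dom_projs_def projD(2))

lemma res_compat:
  assumes "p \<in> dom_projs x" "q \<in> dom_projs x"
  shows "q (res x p \<xi>) = res x q (p \<xi>)"
proof -
  have "q \<in> commutant M" using assms M_sub_commutant projD(1) by (auto simp: dom_projs_def)
  from res_eqI[OF assms(2) affiliated_commutant[OF x(1) this res_mem[OF assms(1)]]]
  show ?thesis by simp
qed

lemma dom_projs_comp:
  assumes "p \<in> dom_projs x" "q \<in> projections M"
  shows "(\<lambda>\<xi>. p (q \<xi>)) \<in> dom_projs x" "res x (\<lambda>\<xi>. p (q \<xi>)) = (\<lambda>\<xi>. res x p (q \<xi>))"
  using assms by (auto simp: dom_projs_def proj_comp res_def)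

text \<open>
  A closed affiliated operator is determined by its behaviour on a total family: membership passes
  from the family to its finite joins, and from these to the limit.
\<close>

lemma graph_mem_iff:
  assumes P: "countable P" "total P"
  shows "(\<xi>, \<eta>) \<in> x \<longleftrightarrow> (\<forall>p\<in>P. (p \<xi>, p \<eta>) \<in> x)"
proof
  assume "(\<xi>, \<eta>) \<in> x"
  moreover have "p \<in> commutant M" if "p \<in> P" for p
    using that P(2) M_sub_commutant projD(1) by (auto simp: total_def)
  ultimately show "\<forall>p\<in>P. (p \<xi>, p \<eta>) \<in> x" using affiliated_commutant[OF x(1)] by blast
next
  assume mem: "\<forall>p\<in>P. (p \<xi>, p \<eta>) \<in> x"
  note lin = linear_operatorD[OF affiliated_linear[OF x(1)]]
  obtain J where J: "\<And>\<xi>. (\<lambda>n. J n \<xi>) \<longlonglongrightarrow> \<xi>"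
    and hull: "\<And>n. J n \<in> join_hull P"
    by (rule total_sequence[OF P]) (rule that)
  have "(r \<xi>, r \<eta>) \<in> x" if "r \<in> join_hull P" for r
    using that
  proof (induction rule: join_hull.induct)
    case (hull_join p q)
    then have pq: "p \<in> projections M" "q \<in> projections M" "(p \<xi>, p \<eta>) \<in> x" "(q \<xi>, q \<eta>) \<in> x"
      by auto
    have "p \<in> commutant M" using pq M_sub_commutant projD(1) by blast
    then have "(p (q \<xi>), p (q \<eta>)) \<in> x" using affiliated_commutant[OF x(1)] pq by blast
    from lin(3)[OF pq(3) lin(5)[OF pq(4) this]]
    show ?case by (simp add: join_def perp_def)
  qed (use mem lin in auto)
  then have "(J n \<xi>, J n \<eta>) \<in> x" for n using hull by blast
  moreover have "(\<lambda>n. (J n \<xi>, J n \<eta>)) \<longlonglongrightarrow> (\<xi>, \<eta>)" by (intro tendsto_Pair J)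
  ultimately show "(\<xi>, \<eta>) \<in> x"
    by (rule closed_sequentially[OF x(2), of "\<lambda>n. (J n \<xi>, J n \<eta>)"])
qed

lemma graph_mem_res_iff:
  assumes P: "countable P" "total P" "P \<subseteq> dom_projs x"
  shows "(\<xi>, \<eta>) \<in> x \<longleftrightarrow> (\<forall>p\<in>P. p \<eta> = res x p \<xi>)"
proof -
  have "(p \<xi>, p \<eta>) \<in> x \<longleftrightarrow> p \<eta> = res x p \<xi>" if "p \<in> P" for p
  proof -
    have "p \<in> dom_projs x" using that P(3) by blast
    note res = res_mem[OF this, of \<xi>] res_eqI[OF this, of \<xi> "p \<eta>"]
    show ?thesis
    proof
      show "(p \<xi>, p \<eta>) \<in> x" if eq: "p \<eta> = res x p \<xi>" unfolding eq by (rule res)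
    qed (simp add: res(2))
  qed
  then show ?thesis by (subst graph_mem_iff[OF P(1,2)]) simp
qed

end

text \<open>
  The operator with prescribed restrictions \<open>a p\<close> to the projections \<open>p\<close> in \<open>P\<close>.  This
  description of the graph makes it obvious that the operator is closed.
\<close>

definition make_op :: "('h \<Rightarrow> 'h) set \<Rightarrow> (('h \<Rightarrow> 'h) \<Rightarrow> 'h \<Rightarrow> 'h) \<Rightarrow> 'h graph" where
  "make_op P a = {(\<xi>, \<eta>). \<forall>p\<in>P. p \<eta> = a p \<xi>}"

context
  fixes P a
  assumes P: "countable P" "total P" and a: "\<And>p. p \<in> P \<Longrightarrow> a p \<in> M"
    and a_proj: "\<And>p \<xi>. p \<in> P \<Longrightarrow> a p (p \<xi>) = a p \<xi>"
    and a_compat: "\<And>p q \<xi>. p \<in> P \<Longrightarrow> q \<in> P \<Longrightarrow> q (a p \<xi>) = a q (p \<xi>)"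
begin

lemma make_op_affiliated: "affiliated_operator M (make_op P a)"
proof (rule affiliatedI)
  have PM: "p \<in> projections M" if "p \<in> P" for p using that P(2) by (auto simp: total_def)
  note simps = bounded_ops_zero bounded_ops_add bounded_ops_scaleC bounded_ops_diff
  note Pb = proj_bounded[OF PM] and ab = bounded[OF a]
  have "\<eta> = \<eta>'" if "(\<xi>, \<eta>) \<in> make_op P a" "(\<xi>, \<eta>') \<in> make_op P a" for \<xi> \<eta> \<eta>'
  proof -
    have "\<eta> - \<eta>' = 0"
    proof (rule total_separates[OF P(2)])
      fix p assume "p \<in> P"
      moreover from this that have "p \<eta> = a p \<xi>" "p \<eta>' = a p \<xi>" by (simp_all add: make_op_def)
      ultimately show "p (\<eta> - \<eta>') = 0" using Pb by (simp add: simps)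
    qed
    then show ?thesis by simp
  qed
  then show "linear_operator (make_op P a)"
    unfolding linear_operator_def single_valued_def
    using Pb ab by (auto simp: make_op_def simps)
  fix u \<xi> \<eta> assume u: "u \<in> commutant M" and m: "(\<xi>, \<eta>) \<in> make_op P a"
  have "p (u \<eta>) = a p (u \<xi>)" if "p \<in> P" for p
    using m that commutantD[OF u projD(1)[OF PM[OF that]], of \<eta>] commutantD[OF u a[OF that], of \<xi>]
    by (simp add: make_op_def)
  then show "(u \<xi>, u \<eta>) \<in> make_op P a" by (simp add: make_op_def)
qed

lemma make_op_closed: "closed (make_op P a)"
proof -
  have "make_op P a = (\<Inter>p\<in>P. {z. p (snd z) = a p (fst z)})" by (auto simp: make_op_def)
  moreover have "closed {z. p (snd z) = a p (fst z)}" if "p \<in> P" for p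
  proof (rule closed_Collect_eq)
    have "p \<in> bounded_ops" "a p \<in> bounded_ops"
      using that P(2) a proj_bounded bounded by (auto simp: total_def)
    then show "continuous_on UNIV (\<lambda>z::'h\<times>'h. p (snd z))" "continuous_on UNIV (\<lambda>z::'h\<times>'h. a p (fst z))"
      by (simp_all add: bounded_linear.continuous_on[OF bounded_ops_bounded_linear]
          continuous_on_fst continuous_on_snd)
  qed
  ultimately show ?thesis by auto
qed

lemma make_op_mem: "p \<in> P \<Longrightarrow> (p \<xi>, a p \<xi>) \<in> make_op P a"
  by (auto simp: make_op_def a_compat)

lemma make_op_dom: "P \<subseteq> dom_projs (make_op P a)"
  using make_op_mem P(2) by (force simp: dom_projs_def total_def)

lemma make_op_res:
  assumes "p \<in> P" shows "res (make_op P a) p = a p"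
proof
  show "res (make_op P a) p \<xi> = a p \<xi>" for \<xi>
    by (rule res_eqI[OF make_op_affiliated make_op_closed subsetD[OF make_op_dom assms] make_op_mem[OF assms]])
qed

lemma make_op_measurable: "make_op P a \<in> measurable_ops M"
  using make_op_affiliated make_op_closed make_op_dom P
  by (auto simp: measurable_iff countably_total_def)

text \<open>
  The criterion that identifies the sum, product and scalar multiple, which are closures of
  algebraically defined graphs, through their restrictions.
\<close>

lemma closure_eq_make_op:
  assumes s: "s \<subseteq> make_op P a" and zero: "(0, 0) \<in> s"
    and add: "\<And>\<xi> \<eta> \<xi>' \<eta>'. (\<xi>, \<eta>) \<in> s \<Longrightarrow> (\<xi>', \<eta>') \<in> s \<Longrightarrow> (\<xi> + \<xi>', \<eta> + \<eta>') \<in> s"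
    and diff: "\<And>\<xi> \<eta> \<xi>' \<eta>'. (\<xi>, \<eta>) \<in> s \<Longrightarrow> (\<xi>', \<eta>') \<in> s \<Longrightarrow> (\<xi> - \<xi>', \<eta> - \<eta>') \<in> s"
    and mem: "\<And>p \<xi>. p \<in> P \<Longrightarrow> (p \<xi>, a p \<xi>) \<in> s"
  shows "closure s = make_op P a"
proof
  show "closure s \<subseteq> make_op P a" using s make_op_closed by (simp add: closure_minimal)
  show "make_op P a \<subseteq> closure s"
  proof
    fix z assume "z \<in> make_op P a"
    then obtain \<xi> \<eta> where z: "z = (\<xi>, \<eta>)" "(\<xi>, \<eta>) \<in> make_op P a" by (cases z) auto
    obtain J where JM: "\<And>n. J n \<in> projections M" and J: "\<And>\<xi>. (\<lambda>n. J n \<xi>) \<longlonglongrightarrow> \<xi>"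
      and hull: "\<And>n. J n \<in> join_hull P"
      by (rule total_sequence[OF P]) (rule that)
    define Q where "Q p \<longleftrightarrow> (\<forall>\<xi> \<eta>. (\<xi>, \<eta>) \<in> make_op P a \<longrightarrow> (p \<xi>, p \<eta>) \<in> s)" for p
    have "Q r" if "r \<in> join_hull P" for r
      using that
    proof (induction rule: join_hull.induct)
      case (hull_base p)
        have "p \<eta> = a p \<xi>" if "(\<xi>, \<eta>) \<in> make_op P a" for \<xi> \<eta>
          using that hull_base by (simp add: make_op_def)
      then show ?case using mem[OF hull_base] unfolding Q_def by metis
    next
      case hull_zero
      show ?case using zero by (simp add: Q_def)
    next
      case (hull_join p q)
      then have pq: "p \<in> projections M" "q \<in> projections M" "Q p" "Q q" by auto
      have "(join p q \<xi>, join p q \<eta>) \<in> s" if z: "(\<xi>, \<eta>) \<in> make_op P a" for \<xi> \<eta>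
      proof -
        have "q \<in> commutant M" using pq M_sub_commutant projD(1) by blast
        then have "(q \<xi>, q \<eta>) \<in> make_op P a" using affiliated_commutant[OF make_op_affiliated] z by blast
        then have 1: "(p (q \<xi>), p (q \<eta>)) \<in> s" using pq by (auto simp: Q_def)
        have 2: "(p \<xi>, p \<eta>) \<in> s" "(q \<xi>, q \<eta>) \<in> s" using pq z by (auto simp: Q_def)
        from add[OF 2(1) diff[OF 2(2) 1]] show ?thesis by (simp add: join_def perp_def)
      qed
      then show ?case by (simp add: Q_def)
    qed
    then have "(J n \<xi>, J n \<eta>) \<in> s" for n using z hull unfolding Q_def by blast
    moreover have "(\<lambda>n. (J n \<xi>, J n \<eta>)) \<longlonglongrightarrow> (\<xi>, \<eta>)" by (intro tendsto_Pair J)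
    ultimately show "z \<in> closure s"
      unfolding z(1) closure_sequential by (intro exI[of _ "\<lambda>n. (J n \<xi>, J n \<eta>)"] conjI allI)
  qed
qed

end

abbreviation "Meas \<equiv> measurable_ops M"

lemma measurableD:
  assumes "x \<in> Meas" shows "affiliated_operator M x" "closed x" "countably_total (dom_projs x)"
  using assms by (auto simp: measurable_iff)

lemma measurable_eqI:
  assumes x: "x \<in> Meas" and y: "y \<in> Meas" and P: "countable P" "total P"
    and eq: "\<And>p. p \<in> P \<Longrightarrow> p \<in> dom_projs x \<and> p \<in> dom_projs y \<and> res x p = res y p"
  shows "x = y"
proof -
  have "P \<subseteq> dom_projs x" "P \<subseteq> dom_projs y" using eq by blast+
  note iff = graph_mem_res_iff[OF measurableD(1,2)[OF x] P this(1)]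
    graph_mem_res_iff[OF measurableD(1,2)[OF y] P this(2)]
  have "(\<xi>, \<eta>) \<in> x \<longleftrightarrow> (\<xi>, \<eta>) \<in> y" for \<xi> \<eta>
    unfolding iff using eq by simp
  then show ?thesis by auto
qed

lemma common_dom:
  assumes "x \<in> Meas" "y \<in> Meas"
  shows "countably_total (dom_projs x \<inter> dom_projs y)"
proof (rule countably_total_comp[OF measurableD(3) measurableD(3)])
  fix p q assume pq: "p \<in> dom_projs x" "q \<in> dom_projs y"
  then have M: "p \<in> projections M" "q \<in> projections M" by (auto simp: dom_projs_def)
  have "(\<lambda>\<xi>. p (q \<xi>)) = (\<lambda>\<xi>. q (p \<xi>))" using proj_commute[OF M(1) projD(1)[OF M(2)]] by simp
  then show "(\<lambda>\<xi>. p (q \<xi>)) \<in> dom_projs x \<inter> dom_projs y"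
    using dom_projs_comp(1)[OF measurableD(1,2)[OF assms(1)] pq(1) M(2)]
      dom_projs_comp(1)[OF measurableD(1,2)[OF assms(2)] pq(2) M(1)] by simp
qed (use assms in auto)

lemma total_insert: "p \<in> projections M \<Longrightarrow> total P \<Longrightarrow> total (insert p P)"
  by (auto simp: total_def)

lemma countable_total_containing:
  assumes "countably_total S" "S \<subseteq> projections M" "p \<in> S"
  obtains P where "countable P" "total P" "P \<subseteq> S" "p \<in> P"
proof -
  obtain P where "P \<subseteq> S" "countable P" "total P" using assms(1) by (auto simp: countably_total_def)
  then show ?thesis using that[of "insert p P"] assms total_insert[of p P] by auto
qed

lemma countably_totalD: 
  assumes "countably_total S" obtains P where "countable P" "total P" "P \<subseteq> S"
  using assms by (auto simp: countably_total_def)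

lemma add_make_op:
  assumes x: "x \<in> Meas" and y: "y \<in> Meas"
    and P: "countable P" "total P" "P \<subseteq> dom_projs x \<inter> dom_projs y"
  shows "x \<oplus>\<^sub>m y = make_op P (\<lambda>p \<xi>. res x p \<xi> + res y p \<xi>)"
    "make_op P (\<lambda>p \<xi>. res x p \<xi> + res y p \<xi>) \<in> Meas"
    "p \<in> P \<Longrightarrow> p \<in> dom_projs (x \<oplus>\<^sub>m y)" "p \<in> P \<Longrightarrow> res (x \<oplus>\<^sub>m y) p = (\<lambda>\<xi>. res x p \<xi> + res y p \<xi>)"
proof -
  note X = measurableD(1,2)[OF x] and Y = measurableD(1,2)[OF y]
  note linx = linear_operatorD[OF affiliated_linear[OF X(1)]]
    and liny = linear_operatorD[OF affiliated_linear[OF Y(1)]]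
  have Px: "p \<in> dom_projs x" "p \<in> dom_projs y" "p \<in> bounded_ops" if "p \<in> P" for p
    using P(3) that proj_bounded' by blast+
  let ?a = "\<lambda>p \<xi>. res x p \<xi> + res y p \<xi>"
  have a: "?a p \<in> M" "?a p (p \<xi>) = ?a p \<xi>" if "p \<in> P" for p \<xi>
    using Px[OF that] res_in_M[OF X] res_in_M[OF Y] M_closure(3) res_proj[OF X] res_proj[OF Y] by auto
  have c: "q (?a p \<xi>) = ?a q (p \<xi>)" if "p \<in> P" "q \<in> P" for p q \<xi>
    using Px[OF that(1)] Px[OF that(2)] by (simp add: bounded_ops_add res_compat[OF X] res_compat[OF Y])
  show eq: "x \<oplus>\<^sub>m y = make_op P ?a"
    unfolding op_add_def
  proof (rule closure_eq_make_op[OF P(1,2) a c])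
    show "{(\<xi>, \<eta> + \<zeta>) |\<xi> \<eta> \<zeta>. (\<xi>, \<eta>) \<in> x \<and> (\<xi>, \<zeta>) \<in> y} \<subseteq> make_op P ?a"
    proof clarify
      fix \<xi> \<eta> \<zeta> assume "(\<xi>, \<eta>) \<in> x" "(\<xi>, \<zeta>) \<in> y"
      moreover have "P \<subseteq> dom_projs x" "P \<subseteq> dom_projs y" using P by auto
      ultimately show "(\<xi>, \<eta> + \<zeta>) \<in> make_op P ?a"
        using graph_mem_res_iff[OF X P(1,2)] graph_mem_res_iff[OF Y P(1,2)] Px(3)
        by (auto simp: make_op_def bounded_ops_add)
    qed
    show "(0, 0) \<in> {(\<xi>, \<eta> + \<zeta>) |\<xi> \<eta> \<zeta>. (\<xi>, \<eta>) \<in> x \<and> (\<xi>, \<zeta>) \<in> y}"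
      using linx(2) liny(2) by force
    show "(p \<xi>, ?a p \<xi>) \<in> {(\<xi>, \<eta> + \<zeta>) |\<xi> \<eta> \<zeta>. (\<xi>, \<eta>) \<in> x \<and> (\<xi>, \<zeta>) \<in> y}" if "p \<in> P" for p \<xi>
      using res_mem[OF X Px(1)[OF that]] res_mem[OF Y Px(2)[OF that]] by blast
    fix \<xi> \<eta> \<xi>' \<eta>'
    assume "(\<xi>, \<eta>) \<in> {(\<xi>, \<eta> + \<zeta>) |\<xi> \<eta> \<zeta>. (\<xi>, \<eta>) \<in> x \<and> (\<xi>, \<zeta>) \<in> y}"
      "(\<xi>', \<eta>') \<in> {(\<xi>, \<eta> + \<zeta>) |\<xi> \<eta> \<zeta>. (\<xi>, \<eta>) \<in> x \<and> (\<xi>, \<zeta>) \<in> y}"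
    then obtain b c b' c' where bc: "\<eta> = b + c" "\<eta>' = b' + c'" "(\<xi>, b) \<in> x" "(\<xi>, c) \<in> y"
      "(\<xi>', b') \<in> x" "(\<xi>', c') \<in> y" by blast
    have e: "\<eta> + \<eta>' = (b + b') + (c + c')" "\<eta> - \<eta>' = (b - b') + (c - c')" using bc by simp_all
    show "(\<xi> + \<xi>', \<eta> + \<eta>') \<in> {(\<xi>, \<eta> + \<zeta>) |\<xi> \<eta> \<zeta>. (\<xi>, \<eta>) \<in> x \<and> (\<xi>, \<zeta>) \<in> y}"
      using linx(3)[OF bc(3,5)] liny(3)[OF bc(4,6)] e(1) by blast
    show "(\<xi> - \<xi>', \<eta> - \<eta>') \<in> {(\<xi>, \<eta> + \<zeta>) |\<xi> \<eta> \<zeta>. (\<xi>, \<eta>) \<in> x \<and> (\<xi>, \<zeta>) \<in> y}"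
      using linx(5)[OF bc(3,5)] liny(5)[OF bc(4,6)] e(2) by blast
  qed
  show "make_op P ?a \<in> Meas" by (rule make_op_measurable[OF P(1,2) a c])
  show "p \<in> P \<Longrightarrow> p \<in> dom_projs (x \<oplus>\<^sub>m y)" "p \<in> P \<Longrightarrow> res (x \<oplus>\<^sub>m y) p = ?a p"
    unfolding eq using make_op_dom[OF P(1,2) a c] make_op_res[OF P(1,2) a c] by blast+
qed

lemma mult_make_op:
  assumes x: "x \<in> Meas" and y: "y \<in> Meas"
    and P: "countable P" "total P" "P \<subseteq> dom_projs x \<inter> dom_projs y"
  shows "x \<otimes>\<^sub>m y = make_op P (\<lambda>p \<xi>. res x p (res y p \<xi>))"
    "make_op P (\<lambda>p \<xi>. res x p (res y p \<xi>)) \<in> Meas"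
    "p \<in> P \<Longrightarrow> p \<in> dom_projs (x \<otimes>\<^sub>m y)" "p \<in> P \<Longrightarrow> res (x \<otimes>\<^sub>m y) p = (\<lambda>\<xi>. res x p (res y p \<xi>))"
proof -
  note X = measurableD(1,2)[OF x] and Y = measurableD(1,2)[OF y]
  note linx = linear_operatorD[OF affiliated_linear[OF X(1)]]
    and liny = linear_operatorD[OF affiliated_linear[OF Y(1)]]
  have Px: "p \<in> dom_projs x" "p \<in> dom_projs y" "p \<in> projections M" if "p \<in> P" for p
    using P(3) that proj_in_dom by blast+
  let ?a = "\<lambda>p \<xi>. res x p (res y p \<xi>)"
  have a: "?a p \<in> M" "?a p (p \<xi>) = ?a p \<xi>" if "p \<in> P" for p \<xi>
    using Px[OF that] res_in_M[OF X] res_in_M[OF Y] M_closure(5) res_proj[OF Y] by auto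
  have fixed: "p (res y p \<xi>) = res y p \<xi>" if "p \<in> P" for p \<xi>
    using res_compat[OF Y Px(2)[OF that] Px(2)[OF that]] res_proj[OF Y Px(2)[OF that]] by simp
  have c: "q (?a p \<xi>) = ?a q (p \<xi>)" if "p \<in> P" "q \<in> P" for p q \<xi>
  proof -
    have "q (?a p \<xi>) = res x q (p (res y p \<xi>))"
      using Px[OF that(1)] Px[OF that(2)] by (simp add: res_compat[OF X])
    also have "\<dots> = res x q (res y p \<xi>)" by (simp only: fixed[OF that(1)])
    also have "\<dots> = res x q (q (res y p \<xi>))" using Px[OF that(2)] res_proj[OF X] by simp
    also have "\<dots> = ?a q (p \<xi>)" using Px[OF that(1)] Px[OF that(2)] by (simp add: res_compat[OF Y])
    finally show ?thesis .
  qed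
  show eq: "x \<otimes>\<^sub>m y = make_op P ?a"
    unfolding op_mult_def
  proof (rule closure_eq_make_op[OF P(1,2) a c])
    show "y O x \<subseteq> make_op P ?a"
    proof clarify
      fix \<xi> \<zeta> \<eta> assume m: "(\<xi>, \<zeta>) \<in> y" "(\<zeta>, \<eta>) \<in> x"
      have PP: "P \<subseteq> dom_projs x" "P \<subseteq> dom_projs y" using P by auto
      have "p \<eta> = res x p (res y p \<xi>)" if "p \<in> P" for p
      proof -
        have "p \<eta> = res x p \<zeta>" using graph_mem_res_iff[OF X P(1,2) PP(1)] m that by blast
        also have "\<dots> = res x p (p \<zeta>)" using res_proj[OF X] Px that by simp
        also have "p \<zeta> = res y p \<xi>" using graph_mem_res_iff[OF Y P(1,2) PP(2)] m that by blast
        finally show ?thesis .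
      qed
      then show "(\<xi>, \<eta>) \<in> make_op P ?a" by (simp add: make_op_def)
    qed
    show "(0, 0) \<in> y O x" using linx(2) liny(2) by blast
    show "(p \<xi>, ?a p \<xi>) \<in> y O x" if "p \<in> P" for p \<xi>
      using res_mem[OF X Px(1)[OF that], of "res y p \<xi>"] res_mem[OF Y Px(2)[OF that], of \<xi>] fixed[OF that]
      by (metis relcompI)
    fix \<xi> \<eta> \<xi>' \<eta>'
    assume "(\<xi>, \<eta>) \<in> y O x" "(\<xi>', \<eta>') \<in> y O x"
    then obtain b b' where bc: "(\<xi>, b) \<in> y" "(b, \<eta>) \<in> x" "(\<xi>', b') \<in> y" "(b', \<eta>') \<in> x" by blast
    show "(\<xi> + \<xi>', \<eta> + \<eta>') \<in> y O x"
      using liny(3)[OF bc(1,3)] linx(3)[OF bc(2,4)] by blast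
    show "(\<xi> - \<xi>', \<eta> - \<eta>') \<in> y O x"
      using liny(5)[OF bc(1,3)] linx(5)[OF bc(2,4)] by blast
  qed
  show "make_op P ?a \<in> Meas" by (rule make_op_measurable[OF P(1,2) a c])
  show "p \<in> P \<Longrightarrow> p \<in> dom_projs (x \<otimes>\<^sub>m y)" "p \<in> P \<Longrightarrow> res (x \<otimes>\<^sub>m y) p = ?a p"
    unfolding eq using make_op_dom[OF P(1,2) a c] make_op_res[OF P(1,2) a c] by blast+
qed

lemma scale_make_op:
  assumes x: "x \<in> Meas" and P: "countable P" "total P" "P \<subseteq> dom_projs x"
  shows "c \<odot>\<^sub>m x = make_op P (\<lambda>p \<xi>. c *\<^sub>C res x p \<xi>)"
    "make_op P (\<lambda>p \<xi>. c *\<^sub>C res x p \<xi>) \<in> Meas"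
    "p \<in> P \<Longrightarrow> p \<in> dom_projs (c \<odot>\<^sub>m x)" "p \<in> P \<Longrightarrow> res (c \<odot>\<^sub>m x) p = (\<lambda>\<xi>. c *\<^sub>C res x p \<xi>)"
proof -
  note X = measurableD(1,2)[OF x]
  note linx = linear_operatorD[OF affiliated_linear[OF X(1)]]
  have Px: "p \<in> dom_projs x" "p \<in> bounded_ops" if "p \<in> P" for p
    using P(3) that proj_bounded' by blast+
  let ?a = "\<lambda>p \<xi>. c *\<^sub>C res x p \<xi>"
  have a: "?a p \<in> M" "?a p (p \<xi>) = ?a p \<xi>" if "p \<in> P" for p \<xi>
    using Px[OF that] res_in_M[OF X] M_closure(6) res_proj[OF X] by auto
  have cp: "q (?a p \<xi>) = ?a q (p \<xi>)" if "p \<in> P" "q \<in> P" for p q \<xi>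
    using Px[OF that(1)] Px[OF that(2)] by (simp add: bounded_ops_scaleC res_compat[OF X])
  show eq: "c \<odot>\<^sub>m x = make_op P ?a"
    unfolding op_scale_def
  proof (rule closure_eq_make_op[OF P(1,2) a cp])
    show "{(\<xi>, c *\<^sub>C \<eta>) |\<xi> \<eta>. (\<xi>, \<eta>) \<in> x} \<subseteq> make_op P ?a"
      using graph_mem_res_iff[OF X P] Px(2) by (auto simp: make_op_def bounded_ops_scaleC)
    show "(0, 0) \<in> {(\<xi>, c *\<^sub>C \<eta>) |\<xi> \<eta>. (\<xi>, \<eta>) \<in> x}"
      using linx(2) by force
    show "(p \<xi>, ?a p \<xi>) \<in> {(\<xi>, c *\<^sub>C \<eta>) |\<xi> \<eta>. (\<xi>, \<eta>) \<in> x}" if "p \<in> P" for p \<xi>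
      using res_mem[OF X Px(1)[OF that]] by blast
    fix \<xi> \<eta> \<xi>' \<eta>'
    assume "(\<xi>, \<eta>) \<in> {(\<xi>, c *\<^sub>C \<eta>) |\<xi> \<eta>. (\<xi>, \<eta>) \<in> x}"
      "(\<xi>', \<eta>') \<in> {(\<xi>, c *\<^sub>C \<eta>) |\<xi> \<eta>. (\<xi>, \<eta>) \<in> x}"
    then obtain b b' where bc: "\<eta> = c *\<^sub>C b" "\<eta>' = c *\<^sub>C b'" "(\<xi>, b) \<in> x" "(\<xi>', b') \<in> x" by blast
    have e: "\<eta> + \<eta>' = c *\<^sub>C (b + b')" "\<eta> - \<eta>' = c *\<^sub>C (b - b')"
      using bc by (simp_all add: scaleC_add_right scaleC_diff_right)
    show "(\<xi> + \<xi>', \<eta> + \<eta>') \<in> {(\<xi>, c *\<^sub>C \<eta>) |\<xi> \<eta>. (\<xi>, \<eta>) \<in> x}"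
      using linx(3)[OF bc(3,4)] e(1) by blast
    show "(\<xi> - \<xi>', \<eta> - \<eta>') \<in> {(\<xi>, c *\<^sub>C \<eta>) |\<xi> \<eta>. (\<xi>, \<eta>) \<in> x}"
      using linx(5)[OF bc(3,4)] e(2) by blast
  qed
  show "make_op P ?a \<in> Meas" by (rule make_op_measurable[OF P(1,2) a cp])
  show "p \<in> P \<Longrightarrow> p \<in> dom_projs (c \<odot>\<^sub>m x)" "p \<in> P \<Longrightarrow> res (c \<odot>\<^sub>m x) p = ?a p"
    unfolding eq using make_op_dom[OF P(1,2) a cp] make_op_res[OF P(1,2) a cp] by blast+
qed

lemma add_measurable:
  assumes "x \<in> Meas" "y \<in> Meas" shows "x \<oplus>\<^sub>m y \<in> Meas"
proof -
  obtain P where "countable P" "total P" "P \<subseteq> dom_projs x \<inter> dom_projs y"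
    using countably_totalD[OF common_dom[OF assms]] by blast
  from add_make_op(1,2)[OF assms this] show ?thesis by simp
qed

lemma mult_measurable:
  assumes "x \<in> Meas" "y \<in> Meas" shows "x \<otimes>\<^sub>m y \<in> Meas"
proof -
  obtain P where "countable P" "total P" "P \<subseteq> dom_projs x \<inter> dom_projs y"
    using countably_totalD[OF common_dom[OF assms]] by blast
  from mult_make_op(1,2)[OF assms this] show ?thesis by simp
qed

lemma scale_measurable:
  assumes "x \<in> Meas" shows "c \<odot>\<^sub>m x \<in> Meas"
proof -
  obtain P where "countable P" "total P" "P \<subseteq> dom_projs x"
    using countably_totalD[OF measurableD(3)[OF assms]] by blast
  from scale_make_op(1,2)[OF assms this] show ?thesis by simp
qed

lemma dom_add:
  assumes "x \<in> Meas" "y \<in> Meas" "p \<in> dom_projs x" "p \<in> dom_projs y"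
  shows "p \<in> dom_projs (x \<oplus>\<^sub>m y)" "res (x \<oplus>\<^sub>m y) p = (\<lambda>\<xi>. res x p \<xi> + res y p \<xi>)"
proof -
  obtain P where "countable P" "total P" "P \<subseteq> dom_projs x \<inter> dom_projs y" "p \<in> P"
    using countable_total_containing[OF common_dom[OF assms(1,2)], of p] assms(3,4)
    by (auto simp: dom_projs_def)
  with add_make_op(3,4)[OF assms(1,2), of P p] show
    "p \<in> dom_projs (x \<oplus>\<^sub>m y)" "res (x \<oplus>\<^sub>m y) p = (\<lambda>\<xi>. res x p \<xi> + res y p \<xi>)" by auto
qed

lemma dom_mult:
  assumes "x \<in> Meas" "y \<in> Meas" "p \<in> dom_projs x" "p \<in> dom_projs y"
  shows "p \<in> dom_projs (x \<otimes>\<^sub>m y)" "res (x \<otimes>\<^sub>m y) p = (\<lambda>\<xi>. res x p (res y p \<xi>))"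
proof -
  obtain P where "countable P" "total P" "P \<subseteq> dom_projs x \<inter> dom_projs y" "p \<in> P"
    using countable_total_containing[OF common_dom[OF assms(1,2)], of p] assms(3,4)
    by (auto simp: dom_projs_def)
  with mult_make_op(3,4)[OF assms(1,2), of P p] show
    "p \<in> dom_projs (x \<otimes>\<^sub>m y)" "res (x \<otimes>\<^sub>m y) p = (\<lambda>\<xi>. res x p (res y p \<xi>))" by auto
qed

lemma dom_scale:
  assumes "x \<in> Meas" "p \<in> dom_projs x"
  shows "p \<in> dom_projs (c \<odot>\<^sub>m x)" "res (c \<odot>\<^sub>m x) p = (\<lambda>\<xi>. c *\<^sub>C res x p \<xi>)"
proof -
  obtain P where "countable P" "total P" "P \<subseteq> dom_projs x" "p \<in> P"
    using countable_total_containing[OF measurableD(3)[OF assms(1)], of p] assms(2)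
    by (auto simp: dom_projs_def)
  with scale_make_op(3,4)[OF assms(1), of P p] show
    "p \<in> dom_projs (c \<odot>\<^sub>m x)" "res (c \<odot>\<^sub>m x) p = (\<lambda>\<xi>. c *\<^sub>C res x p \<xi>)" by auto
qed

definition graph_of :: "('h \<Rightarrow> 'h) \<Rightarrow> 'h graph" where
  "graph_of T = {(\<xi>, T \<xi>) |\<xi>. True}"

lemma total_id: "total {\<lambda>\<xi>. \<xi>}"
  using proj_id by (auto simp: total_def)

lemma graph_of_make_op: "graph_of T = make_op {\<lambda>\<xi>. \<xi>} (\<lambda>_. T)"
  by (auto simp: graph_of_def make_op_def)

lemma graph_of_measurable: "T \<in> M \<Longrightarrow> graph_of T \<in> Meas"
  unfolding graph_of_make_op by (rule make_op_measurable) (auto simp: total_id)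

lemma dom_graph_of: "dom_projs (graph_of T) = projections M"
  by (auto simp: dom_projs_def graph_of_def)

lemma res_graph_of: "res (graph_of T) p = (\<lambda>\<xi>. T (p \<xi>))"
  by (auto simp: res_def graph_of_def)

lemma op_zero_graph: "op_zero = graph_of (\<lambda>\<xi>. 0)"
  by (auto simp: op_zero_def graph_of_def)

lemma graph_of_inj: "graph_of S = graph_of T \<Longrightarrow> S = T"
  by (force simp: graph_of_def)

lemma res_bounded: "x \<in> Meas \<Longrightarrow> p \<in> dom_projs x \<Longrightarrow> res x p \<in> bounded_ops"
  using res_in_M measurableD bounded by blast

lemma res_fixed:
  assumes "x \<in> Meas" "p \<in> dom_projs x"
  shows "p (res x p \<xi>) = res x p \<xi>" "res x p (p \<xi>) = res x p \<xi>"
  using res_compat[OF measurableD(1,2)[OF assms(1)] assms(2,2)]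
    res_proj[OF measurableD(1,2)[OF assms(1)] assms(2)] by simp_all

lemma common_dom3:
  assumes "x \<in> Meas" "y \<in> Meas" "z \<in> Meas"
  obtains P where "countable P" "total P" "P \<subseteq> dom_projs x" "P \<subseteq> dom_projs y" "P \<subseteq> dom_projs z"
proof -
  have "countably_total (dom_projs x \<inter> dom_projs y \<inter> dom_projs z)"
  proof (rule countably_total_comp[OF common_dom[OF assms(1,2)] measurableD(3)[OF assms(3)]])
    fix p q assume pq: "p \<in> dom_projs x \<inter> dom_projs y" "q \<in> dom_projs z"
    then have M: "p \<in> projections M" "q \<in> projections M" by (auto simp: dom_projs_def)
    have "(\<lambda>\<xi>. p (q \<xi>)) = (\<lambda>\<xi>. q (p \<xi>))" using proj_commute[OF M(1) projD(1)[OF M(2)]] by simp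
    then show "(\<lambda>\<xi>. p (q \<xi>)) \<in> dom_projs x \<inter> dom_projs y \<inter> dom_projs z"
      using dom_projs_comp(1)[OF measurableD(1,2)[OF assms(1)] _ M(2), of p]
        dom_projs_comp(1)[OF measurableD(1,2)[OF assms(2)] _ M(2), of p]
        dom_projs_comp(1)[OF measurableD(1,2)[OF assms(3)] pq(2) M(1)] pq by simp
  qed
  then show ?thesis using that by (auto simp: countably_total_def)
qed

abbreviation meas_ring :: "'h graph ring" where
  "meas_ring \<equiv> \<lparr>carrier = Meas, mult = (\<otimes>\<^sub>m), one = graph_of (\<lambda>\<xi>. \<xi>), zero = op_zero, add = (\<oplus>\<^sub>m)\<rparr>"

lemma one_measurable: "graph_of (\<lambda>\<xi>. \<xi>) \<in> Meas" and zero_measurable: "op_zero \<in> Meas"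
  unfolding op_zero_graph by (intro graph_of_measurable M_closure)+

lemmas meas_simps = add_measurable mult_measurable scale_measurable dom_add dom_mult dom_scale
  one_measurable zero_measurable graph_of_measurable

text \<open>
  All ring laws hold for restrictions to a common total family, where they are laws of bounded
  operators, and transfer by \<open>measurable_eqI\<close>.
\<close>

lemma meas_ring_laws:
  assumes x: "x \<in> Meas" and y: "y \<in> Meas" and z: "z \<in> Meas"
  shows "x \<oplus>\<^sub>m y = y \<oplus>\<^sub>m x" "x \<oplus>\<^sub>m y \<oplus>\<^sub>m z = x \<oplus>\<^sub>m (y \<oplus>\<^sub>m z)" "op_zero \<oplus>\<^sub>m x = x"
    "(-1) \<odot>\<^sub>m x \<oplus>\<^sub>m x = op_zero"
    "x \<otimes>\<^sub>m y = y \<otimes>\<^sub>m x" "x \<otimes>\<^sub>m y \<otimes>\<^sub>m z = x \<otimes>\<^sub>m (y \<otimes>\<^sub>m z)" "graph_of (\<lambda>\<xi>. \<xi>) \<otimes>\<^sub>m x = x"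
    "(x \<oplus>\<^sub>m y) \<otimes>\<^sub>m z = x \<otimes>\<^sub>m z \<oplus>\<^sub>m y \<otimes>\<^sub>m z"
    "c \<odot>\<^sub>m x = graph_of (\<lambda>\<xi>. c *\<^sub>C \<xi>) \<otimes>\<^sub>m x"
proof -
  obtain P where P: "countable P" "total P" and
    sub: "P \<subseteq> dom_projs x" "P \<subseteq> dom_projs y" "P \<subseteq> dom_projs z"
    using common_dom3[OF assms] by blast
  have d: "p \<in> dom_projs x" "p \<in> dom_projs y" "p \<in> dom_projs z" "p \<in> dom_projs (graph_of T)"
    "p \<in> dom_projs op_zero" if "p \<in> P" for p T
  proof -
    show p: "p \<in> dom_projs x" "p \<in> dom_projs y" "p \<in> dom_projs z" using that sub by blast+
    show "p \<in> dom_projs (graph_of T)" "p \<in> dom_projs op_zero"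
      unfolding op_zero_graph dom_graph_of by (rule proj_in_dom[OF p(1)])+
  qed
  have comm: "res a p (res b p \<xi>) = res b p (res a p \<xi>)"
    if "a \<in> Meas" "b \<in> Meas" "p \<in> dom_projs a" "p \<in> dom_projs b" for a b p \<xi>
    using that M_apply_commute res_in_M measurableD(1,2) by metis
  have cM: "graph_of (\<lambda>\<xi>. c *\<^sub>C \<xi>) \<in> Meas"
    using graph_of_measurable[OF M_closure(6)[OF M_closure(1)]] .
  note eqI = measurable_eqI[OF _ _ P]
  note s = meas_simps d res_graph_of x y z op_zero_graph[symmetric] cM res_fixed
    bounded_ops_add[OF res_bounded]
  have res0: "res op_zero p = (\<lambda>\<xi>. 0)" for p by (simp add: op_zero_graph res_graph_of)
  show "x \<oplus>\<^sub>m y = y \<oplus>\<^sub>m x" by (rule eqI) (auto simp: s add.commute)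
  show "x \<oplus>\<^sub>m y \<oplus>\<^sub>m z = x \<oplus>\<^sub>m (y \<oplus>\<^sub>m z)" by (rule eqI) (auto simp: s add.assoc)
  show "op_zero \<oplus>\<^sub>m x = x" by (rule eqI) (auto simp: s res0)
  show "(-1) \<odot>\<^sub>m x \<oplus>\<^sub>m x = op_zero" by (rule eqI) (auto simp: s res0 scaleC_minus1)
  show "x \<otimes>\<^sub>m y = y \<otimes>\<^sub>m x" by (rule eqI) (auto simp: s comm[of x y])
  show "x \<otimes>\<^sub>m y \<otimes>\<^sub>m z = x \<otimes>\<^sub>m (y \<otimes>\<^sub>m z)" by (rule eqI) (auto simp: s)
  show "graph_of (\<lambda>\<xi>. \<xi>) \<otimes>\<^sub>m x = x" by (rule eqI) (auto simp: s)
  show "(x \<oplus>\<^sub>m y) \<otimes>\<^sub>m z = x \<otimes>\<^sub>m z \<oplus>\<^sub>m y \<otimes>\<^sub>m z" by (rule eqI) (auto simp: s)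
  show "c \<odot>\<^sub>m x = graph_of (\<lambda>\<xi>. c *\<^sub>C \<xi>) \<otimes>\<^sub>m x" by (rule eqI) (auto simp: s)
qed

lemma cring_meas: "cring meas_ring"
proof (rule cringI)
  show "abelian_group meas_ring"
  proof (rule abelian_groupI; simp)
    fix x assume "x \<in> Meas"
    then show "\<exists>y\<in>Meas. y \<oplus>\<^sub>m x = op_zero" using meas_ring_laws(4) scale_measurable by blast
  qed (use meas_ring_laws meas_simps in auto)
  show "Group.comm_monoid meas_ring"
    by (rule comm_monoidI; simp) (use meas_ring_laws meas_simps in auto)
qed (use meas_ring_laws in auto)

end


section \<open>The product of all commutative rings on a type\<close>

text \<open>
  A ring whose carrier is a set depending on \<open>M\<close> is not a type, but polynomials and the
  algebraic type classes require one.  Every commutative ring with elements in a type \<open>'a\<close> is a direct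
  factor of the product of all such rings, which is a type.  The additional integer factor keeps
  \<open>0\<close> and \<open>1\<close> distinct even if all other factors are trivial.
\<close>

typedef 'a ring_product =
  "{x :: int \<times> ('a ring \<Rightarrow> 'a). \<forall>R. if cring R then snd x R \<in> carrier R else snd x R = undefined}"
proof
  show "(0, \<lambda>R. if cring R then \<zero>\<^bsub>R\<^esub> else undefined) \<in>
      {x. \<forall>R. if cring R then snd x R \<in> carrier R else snd x R = undefined}"
    by (auto intro: abelian_monoid.zero_closed simp: cring_def ring_def abelian_group_def)
qed

definition head :: "'a ring_product \<Rightarrow> int" where
  "head x = fst (Rep_ring_product x)"

definition component :: "'a ring \<Rightarrow> 'a ring_product \<Rightarrow> 'a" where
  "component R x = snd (Rep_ring_product x) R"

definition family :: "int \<Rightarrow> ('a ring \<Rightarrow> 'a) \<Rightarrow> 'a ring_product" where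
  "family z f = Abs_ring_product (z, \<lambda>R. if cring R then f R else undefined)"

lemma component_closed: "cring R \<Longrightarrow> component R x \<in> carrier R"
  using Rep_ring_product[of x] by (auto simp: component_def)

lemma ring_product_eqI:
  assumes "head x = head y" "\<And>R. cring R \<Longrightarrow> component R x = component R y"
  shows "x = y"
proof -
  have "snd (Rep_ring_product x) R = snd (Rep_ring_product y) R" for R
    using Rep_ring_product[of x] Rep_ring_product[of y] assms(2)[of R]
    by (cases "cring R") (auto simp: component_def)
  then have "Rep_ring_product x = Rep_ring_product y"
    using assms(1) by (intro prod_eqI ext) (auto simp: head_def)
  then show ?thesis by (simp add: Rep_ring_product_inject)
qed

lemma family_sel:
  assumes "\<And>R. cring R \<Longrightarrow> f R \<in> carrier R"
  shows "head (family z f) = z" "cring R \<Longrightarrow> component R (family z f) = f R"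
  using assms by (simp_all add: head_def component_def family_def Abs_ring_product_inverse)

instantiation ring_product :: (type) comm_ring_1
begin

definition "0 = family 0 (\<lambda>R. \<zero>\<^bsub>R\<^esub>)"
definition "1 = family 1 (\<lambda>R. \<one>\<^bsub>R\<^esub>)"
definition "x + y = family (head x + head y) (\<lambda>R. component R x \<oplus>\<^bsub>R\<^esub> component R y)"
definition "- x = family (- head x) (\<lambda>R. \<ominus>\<^bsub>R\<^esub> component R x)"
definition "x - y = family (head x - head y) (\<lambda>R. component R x \<ominus>\<^bsub>R\<^esub> component R y)"
definition "x * y = family (head x * head y) (\<lambda>R. component R x \<otimes>\<^bsub>R\<^esub> component R y)"

lemma head_simps:
  "head (0::'a ring_product) = 0" "head (1::'a ring_product) = 1" "head (x + y) = head x + head y"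
  "head (- x) = - head x" "head (x - y) = head x - head y" "head (x * y) = head x * head (y::'a ring_product)"
  unfolding zero_ring_product_def one_ring_product_def plus_ring_product_def
    uminus_ring_product_def minus_ring_product_def times_ring_product_def
  by (rule family_sel(1); simp add: component_closed cring.cring_simprules)+

lemma component_simps:
  assumes "cring R"
  shows "component R 0 = \<zero>\<^bsub>R\<^esub>" "component R 1 = \<one>\<^bsub>R\<^esub>"
    "component R (x + y) = component R x \<oplus>\<^bsub>R\<^esub> component R y"
    "component R (- x) = \<ominus>\<^bsub>R\<^esub> component R x"
    "component R (x - y) = component R x \<ominus>\<^bsub>R\<^esub> component R y"
    "component R (x * y) = component R x \<otimes>\<^bsub>R\<^esub> component R y"
  unfolding zero_ring_product_def one_ring_product_def plus_ring_product_def
    uminus_ring_product_def minus_ring_product_def times_ring_product_def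
  by (rule family_sel(2)[OF _ assms]; simp add: component_closed cring.cring_simprules)+

instance
proof
  fix x y z :: "'a ring_product"
  note simps = head_simps component_simps component_closed cring.cring_simprules
  show "x * y * z = x * (y * z)" by (rule ring_product_eqI) (simp_all add: simps)
  show "x * y = y * x"
    by (rule ring_product_eqI) (simp_all add: simps mult.commute cring.cring_simprules(14))
  show "1 * x = x" by (rule ring_product_eqI) (simp_all add: simps)
  show "x + y + z = x + (y + z)" by (rule ring_product_eqI) (simp_all add: simps)
  show "x + y = y + x" 
    by (rule ring_product_eqI) (simp_all add: simps add.commute cring.cring_simprules(10))
  show "0 + x = x" by (rule ring_product_eqI) (simp_all add: simps)
  show "- x + x = 0" by (rule ring_product_eqI) (simp_all add: simps)
  show "x - y = x + - y" by (rule ring_product_eqI) (simp_all add: simps)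
  show "(x + y) * z = x * z + y * z"
    by (rule ring_product_eqI) (simp_all add: simps distrib_right)
  have "head (0::'a ring_product) \<noteq> head (1::'a ring_product)" by (simp add: head_simps)
  then show "(0::'a ring_product) \<noteq> 1" by metis
qed

end

text \<open>
  The inclusion of \<open>R\<close> as a factor.  It preserves sums and products and is inverse to \<open>component R\<close>
  on its image, the corner of the idempotent \<open>embed R 1\<close>.
\<close>

definition embed :: "'a ring \<Rightarrow> 'a \<Rightarrow> 'a ring_product" where
  "embed R a = family 0 (\<lambda>R'. if R' = R then a else \<zero>\<^bsub>R'\<^esub>)"

lemma embed_sel:
  assumes "cring R" "a \<in> carrier R"
  shows "head (embed R a) = 0" "component R (embed R a) = a"
    "cring R' \<Longrightarrow> component R' (embed R a) = (if R' = R then a else \<zero>\<^bsub>R'\<^esub>)"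
  unfolding embed_def using assms
  by (subst family_sel; simp add: cring.cring_simprules)+

lemma embed_hom:
  assumes R: "cring R" and ab: "a \<in> carrier R" "b \<in> carrier R"
  shows "embed R (a \<oplus>\<^bsub>R\<^esub> b) = embed R a + embed R b"
    "embed R (a \<otimes>\<^bsub>R\<^esub> b) = embed R a * embed R b"
    "embed R \<zero>\<^bsub>R\<^esub> = 0"
  by (rule ring_product_eqI;
      simp add: embed_sel[OF R] ab head_simps component_simps cring.cring_simprules R)+

lemma embed_component:
  assumes "cring R" shows "embed R (component R x) = embed R \<one>\<^bsub>R\<^esub> * x"
  by (rule ring_product_eqI)
    (simp_all add: embed_sel[OF assms] head_simps component_simps component_closed
      cring.cring_simprules assms)

lemma embed_inj:
  assumes "cring R" "a \<in> carrier R" "b \<in> carrier R" "embed R a = embed R b" shows "a = b"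
  using embed_sel(2)[OF assms(1)] assms by metis


section \<open>Traces\<close>

locale traced_vna = commutative_vna +
  fixes \<tau> :: "('a \<Rightarrow> 'a) \<Rightarrow> ennreal"
  assumes trace: "is_trace M \<tau>" and faithful: "faithful_trace M \<tau>"
    and normal: "normal_trace M \<tau>" and semifinite: "semifinite_trace M \<tau>"
begin

lemma trace_add: "x \<in> positive_part M \<Longrightarrow> y \<in> positive_part M \<Longrightarrow> \<tau> (\<lambda>\<xi>. x \<xi> + y \<xi>) = \<tau> x + \<tau> y"
  using trace by (auto simp: is_trace_def)

lemma trace_scale: "x \<in> positive_part M \<Longrightarrow> r \<ge> 0 \<Longrightarrow> \<tau> (\<lambda>\<xi>. r *\<^sub>R x \<xi>) = ennreal r * \<tau> x"
  using trace by (auto simp: is_trace_def)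

lemma trace_zero: "\<tau> (\<lambda>\<xi>. 0) = 0"
  using trace_scale[OF proj_positive[OF proj_zero], of 0] by simp

lemma trace_mono:
  assumes x: "x \<in> positive_part M" and y: "y \<in> positive_part M" and le: "x \<le>\<^sub>o\<^sub>p y"
  shows "\<tau> x \<le> \<tau> y"
proof -
  have "(\<lambda>\<xi>. y \<xi> - x \<xi>) \<in> positive_part M"
    using x y le M_closure(4) by (auto simp: positive_part_def op_le_def)
  from trace_add[OF x this] show ?thesis by simp
qed

text \<open>
  The order of projections in the form used for computations.
\<close>

definition sub_proj :: "('a \<Rightarrow> 'a) \<Rightarrow> ('a \<Rightarrow> 'a) \<Rightarrow> bool" where
  "sub_proj e p \<longleftrightarrow> e \<in> projections M \<and> (\<forall>\<xi>. p (e \<xi>) = e \<xi>)"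

lemma sub_projD: assumes "sub_proj e p" shows "e \<in> projections M" "p (e \<xi>) = e \<xi>"
  using assms by (auto simp: sub_proj_def)

lemma sub_proj_right: "sub_proj e p \<Longrightarrow> p \<in> projections M \<Longrightarrow> e (p \<xi>) = e \<xi>"
  using proj_commute[of e p] projD(1) by (auto simp: sub_proj_def)

lemma sub_proj_trans: "sub_proj e f \<Longrightarrow> sub_proj f g \<Longrightarrow> sub_proj e g"
  unfolding sub_proj_def by metis

lemma sub_proj_op_le: "sub_proj e p \<Longrightarrow> p \<in> projections M \<Longrightarrow> e \<le>\<^sub>o\<^sub>p p"
  using proj_le_iff by (auto simp: sub_proj_def)

lemma trace_sub_proj:
  assumes e: "sub_proj e p" and p: "p \<in> projections M"
  shows "\<tau> p = \<tau> e + \<tau> (\<lambda>\<xi>. p \<xi> - e \<xi>)" "sub_proj (\<lambda>\<xi>. p \<xi> - e \<xi>) p" "\<tau> e \<le> \<tau> p"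
proof -
  have d: "(\<lambda>\<xi>. p \<xi> - e \<xi>) \<in> projections M" using proj_diff[OF _ p] e by (auto simp: sub_proj_def)
  show "\<tau> p = \<tau> e + \<tau> (\<lambda>\<xi>. p \<xi> - e \<xi>)"
    using trace_add[OF proj_positive[OF sub_projD(1)[OF e]] proj_positive[OF d]] by simp
  then show "\<tau> e \<le> \<tau> p" by simp
  show "sub_proj (\<lambda>\<xi>. p \<xi> - e \<xi>) p"
    using d e projD(2)[OF p] bounded_ops_diff[OF proj_bounded[OF p]] by (simp add: sub_proj_def)
qed

lemma trace_pos: "e \<in> projections M \<Longrightarrow> \<tau> e = 0 \<Longrightarrow> e = (\<lambda>\<xi>. 0)"
  using faithful proj_positive by (auto simp: faithful_trace_def)

lemma trace_join_perp:
  assumes p: "p \<in> projections M" and q: "q \<in> projections M"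
  shows "\<tau> (perp (\<lambda>\<xi>. p (q \<xi>))) \<le> \<tau> (perp p) + \<tau> (perp q)"
proof -
  have "perp (\<lambda>\<xi>. p (q \<xi>)) = (\<lambda>\<xi>. perp p \<xi> + p (perp q \<xi>))"
    using bounded_ops_diff[OF proj_bounded[OF p]] by (auto simp: perp_def)
  then have "\<tau> (perp (\<lambda>\<xi>. p (q \<xi>))) = \<tau> (perp p) + \<tau> (\<lambda>\<xi>. p (perp q \<xi>))"
    using trace_add[OF proj_positive[OF proj_perp[OF p]] proj_positive[OF proj_comp[OF p proj_perp[OF q]]]]
    by simp
  moreover have "sub_proj (\<lambda>\<xi>. p (perp q \<xi>)) (perp q)"
    using proj_comp[OF p proj_perp[OF q]] proj_commute[OF p projD(1)[OF proj_perp[OF q]]]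
      projD(2)[OF proj_perp[OF q]] by (simp add: sub_proj_def)
  ultimately show ?thesis using trace_sub_proj(3)[OF _ proj_perp[OF q]] by (simp add: add_left_mono)
qed

subsection \<open>Projections of finite trace\<close>

text \<open>
  Below \<open>p\<close> there is a positive \<open>y \<noteq> 0\<close> of finite trace.  Cutting \<open>y\<close> at a small level \<open>\<delta>\<close> gives a
  projection \<open>e \<noteq> 0\<close> with \<open>\<delta> e \<le> y\<close>, and thus \<open>\<delta> * \<tau> e \<le> \<tau> y\<close>.
\<close>

lemma finite_trace_subprojection:
  assumes p: "p \<in> projections M" "p \<noteq> (\<lambda>\<xi>. 0)"
  obtains e where "sub_proj e p" "e \<noteq> (\<lambda>\<xi>. 0)" "\<tau> e < \<infinity>"
proof -
  obtain y where y: "y \<in> positive_part M" "y \<noteq> (\<lambda>\<xi>. 0)" "y \<le>\<^sub>o\<^sub>p p" "\<tau> y < \<infinity>"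
    using semifinite proj_positive[OF p(1)] p(2) unfolding semifinite_trace_def by blast
  have yM: "y \<in> M" using y by (simp add: positive_part_def)
  note yb = bounded[OF yM]
  obtain s where s: "s \<in> M" "is_adjoint y s" using adjoint_in_M[OF yM] by blast
  have pos: "Re (cinner (y \<xi>) \<xi>) \<ge> 0" "Im (cinner (y \<xi>) \<xi>) = 0" for \<xi>
    using y(1) by (auto simp: positive_part_def positive_op_iff)
  \<comment> \<open>a positive operator is self-adjoint, by polarization\<close>
  have sa: "is_adjoint y y"
    unfolding is_adjoint_def
  proof (intro allI)
    fix \<xi> \<eta>
    define d where "d = (\<lambda>\<xi>. y \<xi> - s \<xi>)"
    have d0: "cinner (d \<zeta>) \<zeta> = 0" for \<zeta>
    proof -
      have "cinner (s \<zeta>) \<zeta> = cnj (cinner (y \<zeta>) \<zeta>)"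
        using is_adjoint_sym[OF s(2)] by (metis cinner_commute is_adjoint_def)
      then show ?thesis using pos(2)[of \<zeta>] by (simp add: d_def cinner_diff_left complex_eq_iff)
    qed
    have db: "d \<in> bounded_ops" unfolding d_def using bounded[OF M_closure(4)[OF yM s(1)]] .
    have "cinner (d \<xi>) \<eta> + cinner (d \<eta>) \<xi> = 0"
      using d0[of "\<xi> + \<eta>"] d0[of \<xi>] d0[of \<eta>] db
      by (simp add: bounded_ops_add cinner_add_left cinner_add_right add.commute)
    moreover have "- \<i> * cinner (d \<xi>) \<eta> + \<i> * cinner (d \<eta>) \<xi> = 0"
      using d0[of "\<xi> + \<i> *\<^sub>C \<eta>"] d0[of \<xi>] d0[of \<eta>] db
      by (simp add: bounded_ops_add bounded_ops_scaleC cinner_add_left cinner_add_right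
          cinner_scaleC_left cinner_scaleC_right)
    then have "\<i> * (cinner (d \<eta>) \<xi> - cinner (d \<xi>) \<eta>) = 0" by (simp add: algebra_simps)
    then have "cinner (d \<eta>) \<xi> = cinner (d \<xi>) \<eta>" by simp
    ultimately have "cinner (d \<xi>) \<eta> = 0" by simp
    then have "cinner (y \<xi>) \<eta> = cinner (s \<xi>) \<eta>" by (simp add: d_def cinner_diff_left)
    then show "cinner (y \<xi>) \<eta> = cinner \<xi> (y \<eta>)"
      using is_adjoint_sym[OF s(2)] by (simp add: is_adjoint_def)
  qed
  obtain \<xi>0 where \<xi>0: "inner (y \<xi>0) \<xi>0 > 0"
  proof (rule ccontr)
    assume "\<not> thesis"
    then have i0: "inner (y \<xi>) \<xi> = 0" for \<xi>
      using that pos(1)[of \<xi>] by (metis Re_cinner antisym_conv1)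
    then show False using self_adjoint_zero[OF yb sa] y(2) by blast
  qed
  then have \<xi>0n: "\<xi>0 \<noteq> 0" by auto
  \<comment> \<open>half of the mean value of \<open>y\<close> at \<open>\<xi>0\<close>, so that \<open>y - \<delta>\<close> is positive at \<open>\<xi>0\<close>\<close>
  define \<delta> where "\<delta> = inner (y \<xi>0) \<xi>0 / (2 * (norm \<xi>0)\<^sup>2)"
  have \<delta>: "\<delta> > 0" using \<xi>0 \<xi>0n by (simp add: \<delta>_def)
  define T where "T = (\<lambda>\<xi>. y \<xi> - \<delta> *\<^sub>R \<xi>)"
  have TM: "T \<in> M" unfolding T_def using yM M_closure(1,4) M_scaleR by simp
  have Ta: "is_adjoint T T"
    using sa by (simp add: T_def is_adjoint_def cinner_diff_left cinner_diff_right
        cinner_scaleR_left cinner_scaleR_right)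
  obtain e where e: "e \<in> projections M" "\<And>\<xi>. inner (T (e \<xi>)) (e \<xi>) \<ge> 0"
    "\<And>\<xi>. inner (T (perp e \<xi>)) (perp e \<xi>) \<le> 0" by (rule spectral_cut[OF TM Ta]) (rule that)
  note eb = proj_bounded[OF e(1)]
  have lower: "\<delta> * (norm (e \<xi>))\<^sup>2 \<le> inner (y (e \<xi>)) (e \<xi>)" for \<xi>
    using e(2)[of \<xi>] by (simp add: T_def inner_diff_left dot_square_norm)
  have e0: "e \<noteq> (\<lambda>\<xi>. 0)"
  proof
    assume "e = (\<lambda>\<xi>. 0)"
    then have "inner (T \<xi>0) \<xi>0 \<le> 0" using e(3)[of \<xi>0] by (simp add: perp_def)
    then have "inner (y \<xi>0) \<xi>0 \<le> \<delta> * (norm \<xi>0)\<^sup>2"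
      by (simp add: T_def inner_diff_left dot_square_norm)
    also have "\<dots> = inner (y \<xi>0) \<xi>0 / 2" using \<xi>0n by (simp add: \<delta>_def)
    finally show False using \<xi>0 by simp
  qed
  have ep: "sub_proj e p"
    unfolding sub_proj_def
  proof (intro conjI allI e(1))
    fix \<xi>
    have ep': "e (perp p \<xi>) = perp p (e \<xi>)"
      using proj_commute[OF proj_perp[OF p(1)] projD(1)[OF e(1)]] .
    have "Re (cinner (p (e (perp p \<xi>)) - y (e (perp p \<xi>))) (e (perp p \<xi>))) \<ge> 0"
      using y(3) by (simp add: op_le_def positive_op_iff)
    moreover have "p (e (perp p \<xi>)) = 0" using ep' perp_orth(1)[OF p(1)] by simp
    ultimately have "inner (y (e (perp p \<xi>))) (e (perp p \<xi>)) \<le> 0"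
      by (simp add: Re_cinner cinner_diff_left)
    then have "\<delta> * (norm (e (perp p \<xi>)))\<^sup>2 \<le> 0" using lower[of "perp p \<xi>"] by linarith
    then have "e (perp p \<xi>) = 0" using \<delta> by (simp add: mult_le_0_iff)
    then show "p (e \<xi>) = e \<xi>" using ep' by (simp add: perp_def)
  qed
  have "(\<lambda>\<xi>. \<delta> *\<^sub>R e \<xi>) \<in> positive_part M"
    using M_scaleR[OF projD(1)[OF e(1)]] \<delta> norm_proj_sq[OF e(1)]
    by (auto simp: positive_part_def positive_op_iff cinner_scaleR_left)
  moreover have "(\<lambda>\<xi>. \<delta> *\<^sub>R e \<xi>) \<le>\<^sub>o\<^sub>p y"
    unfolding op_le_def positive_op_iff
  proof (intro allI conjI)
    fix \<xi>
    have split: "cinner (y \<xi>) \<xi> = cinner (y (e \<xi>)) (e \<xi>) + cinner (y (perp e \<xi>)) (perp e \<xi>)"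
    proof -
      have "cinner (y (e \<xi>)) (perp e \<xi>) = 0"
        using projD(3)[OF e(1), of "y \<xi>" "perp e \<xi>"] proj_commute[OF e(1) yM] perp_orth(1)[OF e(1)]
        by simp
      moreover have "cinner (y (perp e \<xi>)) (e \<xi>) = 0"
        using projD(3)[OF e(1), of "y (perp e \<xi>)" \<xi>] proj_commute[OF e(1) yM, of "perp e \<xi>"]
          perp_orth(1)[OF e(1)] bounded_ops_zero[OF yb] projD(3)[OF e(1)] by (metis cinner_zero_left)
      moreover have "\<xi> = e \<xi> + perp e \<xi>" by (simp add: perp_def)
      ultimately show ?thesis using yb
        by (metis (no_types, lifting) add.right_neutral add_0 bounded_ops_add cinner_add_left cinner_add_right)
    qed
    show "Re (cinner (y \<xi> - \<delta> *\<^sub>R e \<xi>) \<xi>) \<ge> 0"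
      using lower[of \<xi>] pos(1)[of "perp e \<xi>"] norm_proj_sq[OF e(1), of \<xi>]
      by (simp add: cinner_diff_left split cinner_scaleR_left Re_cinner)
    show "Im (cinner (y \<xi> - \<delta> *\<^sub>R e \<xi>) \<xi>) = 0"
      using pos(2)[of \<xi>] norm_proj_sq[OF e(1), of \<xi>] by (simp add: cinner_diff_left cinner_scaleR_left)
  qed
  ultimately have "ennreal \<delta> * \<tau> e \<le> \<tau> y"
    using trace_mono[of "\<lambda>\<xi>. \<delta> *\<^sub>R e \<xi>" y] y(1) trace_scale[OF proj_positive[OF e(1)], of \<delta>] \<delta> by simp
  then have "\<tau> e < \<infinity>"
    using y(4) \<delta> by (metis ennreal_eq_0_iff ennreal_mult_eq_top_iff infinity_ennreal_def
        linorder_not_less order_le_less_trans top.not_eq_extremum)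
  then show ?thesis using that ep e0 by blast
qed

lemma trace_disjoint_sum:
  assumes "finite G" "\<And>e. e \<in> G \<Longrightarrow> sub_proj e p"
    "\<And>e f \<xi>. e \<in> G \<Longrightarrow> f \<in> G \<Longrightarrow> e \<noteq> f \<Longrightarrow> e (f \<xi>) = 0" and p: "p \<in> projections M"
  shows "sub_proj (\<lambda>\<xi>. \<Sum>e\<in>G. e \<xi>) p \<and> \<tau> (\<lambda>\<xi>. \<Sum>e\<in>G. e \<xi>) = (\<Sum>e\<in>G. \<tau> e)"
  using assms(1-3)
proof (induction G rule: finite_induct)
  case empty
  then show ?case using proj_zero bounded_ops_zero[OF proj_bounded[OF p]]
    by (simp add: sub_proj_def trace_zero)
next
  case (insert e G)
  let ?s = "\<lambda>\<xi>. \<Sum>e\<in>G. e \<xi>"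
  have IH: "sub_proj ?s p" "\<tau> ?s = (\<Sum>e\<in>G. \<tau> e)" using insert by auto
  have e: "sub_proj e p" using insert by simp
  have "e (?s \<xi>) = (\<Sum>f\<in>G. e (f \<xi>))" for \<xi>
    using bounded_ops_bounded_linear[OF proj_bounded[OF sub_projD(1)[OF e]]]
      Real_Vector_Spaces.linear_sum bounded_linear.linear by blast
  moreover have "(\<Sum>f\<in>G. e (f \<xi>)) = 0" for \<xi> using insert by (intro sum.neutral) auto
  ultimately have es: "e (?s \<xi>) = 0" for \<xi> by simp
  have "(\<lambda>\<xi>. e \<xi> + ?s \<xi>) \<in> projections M"
    by (rule proj_orth_add[OF sub_projD(1)[OF e] sub_projD(1)[OF IH(1)] es])
  then have "sub_proj (\<lambda>\<xi>. e \<xi> + ?s \<xi>) p"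
    using e IH(1) bounded_ops_add[OF proj_bounded[OF p]] by (simp add: sub_proj_def)
  moreover have "\<tau> (\<lambda>\<xi>. e \<xi> + ?s \<xi>) = \<tau> e + \<tau> ?s"
    by (rule trace_add; intro proj_positive sub_projD(1)[OF e] sub_projD(1)[OF IH(1)])
  ultimately show ?case using insert(1,2) IH(2) by simp
qed

text \<open>
  At most \<open>(n+1) * \<tau> p\<close> of the projections have trace at least \<open>1/(n+1)\<close>.
\<close>

lemma countable_disjoint:
  assumes p: "p \<in> projections M" "\<tau> p < \<infinity>" and F: "\<And>e. e \<in> F \<Longrightarrow> sub_proj e p"
    and disj: "\<And>e f \<xi>. e \<in> F \<Longrightarrow> f \<in> F \<Longrightarrow> e \<noteq> f \<Longrightarrow> e (f \<xi>) = 0"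
  shows "countable F"
proof -
  define Fn where "Fn n = {e\<in>F. \<tau> e \<ge> ennreal (1 / real (Suc n))}" for n
  have tp: "\<tau> p = ennreal (enn2real (\<tau> p))" using p(2) by simp
  have fin: "finite (Fn n)" for n
  proof (rule conjunct1[OF finite_if_finite_subsets_card_bdd])
    fix G assume G: "G \<subseteq> Fn n" "finite G"
    have "sub_proj (\<lambda>\<xi>. \<Sum>e\<in>G. e \<xi>) p \<and> \<tau> (\<lambda>\<xi>. \<Sum>e\<in>G. e \<xi>) = (\<Sum>e\<in>G. \<tau> e)"
    proof (rule trace_disjoint_sum[OF G(2) _ _ p(1)])
      have "G \<subseteq> F" using G(1) by (auto simp: Fn_def)
      then show "e \<in> G \<Longrightarrow> sub_proj e p" "e \<in> G \<Longrightarrow> f \<in> G \<Longrightarrow> e \<noteq> f \<Longrightarrow> e (f \<xi>) = 0" for e f \<xi>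
        using F disj by blast+
    qed
    then have "(\<Sum>e\<in>G. \<tau> e) \<le> \<tau> p" using trace_sub_proj(3) p by metis
    moreover have "of_nat (card G) * ennreal (1 / real (Suc n)) \<le> (\<Sum>e\<in>G. \<tau> e)"
      using G by (intro sum_bounded_below) (auto simp: Fn_def)
    ultimately have "ennreal (real (card G) * (1 / real (Suc n))) \<le> ennreal (enn2real (\<tau> p))"
      using tp by (metis dual_order.trans ennreal_mult ennreal_of_nat_eq_real_of_nat
          of_nat_0_le_iff zero_le_divide_1_iff)
    then have "real (card G) * (1 / real (Suc n)) \<le> enn2real (\<tau> p)"
      by (simp add: ennreal_le_iff del: of_nat_Suc)
    then have "real (card G) \<le> enn2real (\<tau> p) * real (Suc n)"
      by (simp add: field_simps del: of_nat_Suc)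
    then show "card G \<le> nat \<lceil>enn2real (\<tau> p) * real (Suc n)\<rceil>" by linarith
  qed
  have "F \<subseteq> insert (\<lambda>\<xi>. 0) (\<Union>n. Fn n)"
  proof
    fix e assume e: "e \<in> F"
    show "e \<in> insert (\<lambda>\<xi>. 0) (\<Union>n. Fn n)"
    proof (cases "e = (\<lambda>\<xi>. 0)")
      case False
      then have "\<tau> e > 0" using trace_pos[OF sub_projD(1)[OF F[OF e]]] by (auto simp: zero_less_iff_neq_zero)
      have "\<tau> e < \<infinity>" using trace_sub_proj(3)[OF F[OF e] p(1)] p(2) by simp
      then have te: "\<tau> e = ennreal (enn2real (\<tau> e))" by simp
      then have "enn2real (\<tau> e) > 0" using \<open>\<tau> e > 0\<close> by (metis ennreal_less_zero_iff)
      then obtain n where "inverse (real (Suc n)) < enn2real (\<tau> e)" using reals_Archimedean by blast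
      then have "ennreal (1 / real (Suc n)) \<le> \<tau> e"
        by (subst te) (simp add: ennreal_leI inverse_eq_divide del: of_nat_Suc)
      then show ?thesis using e by (auto simp: Fn_def)
    qed simp
  qed
  moreover have "countable (insert (\<lambda>\<xi>. 0) (\<Union>n. Fn n))" using fin by (simp add: countable_finite)
  ultimately show ?thesis by (rule countable_subset)
qed

subsection \<open>An element that is nowhere constant\<close>

definition nonatomic :: "('a \<Rightarrow> 'a) \<Rightarrow> bool" where
  "nonatomic p \<longleftrightarrow> p \<in> projections M \<and> \<tau> p < \<infinity> \<and>
    (\<forall>e. sub_proj e p \<and> e \<noteq> (\<lambda>\<xi>. 0) \<longrightarrow> (\<exists>f. sub_proj f e \<and> f \<noteq> (\<lambda>\<xi>. 0) \<and> f \<noteq> e))"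

lemma nonatomic_exists:
  assumes "\<not> atomic_projections M"
  obtains p where "nonatomic p" "p \<noteq> (\<lambda>\<xi>. 0)"
proof -
  obtain p0 where p0: "p0 \<in> projections M" "p0 \<noteq> (\<lambda>\<xi>. 0)" "\<And>q. atom M q \<Longrightarrow> \<not> q \<le>\<^sub>o\<^sub>p p0"
    using assms unfolding atomic_projections_def by blast
  obtain p where p: "sub_proj p p0" "p \<noteq> (\<lambda>\<xi>. 0)" "\<tau> p < \<infinity>"
    using finite_trace_subprojection[OF p0(1,2)] by blast
  have "\<exists>f. sub_proj f e \<and> f \<noteq> (\<lambda>\<xi>. 0) \<and> f \<noteq> e" if e: "sub_proj e p" "e \<noteq> (\<lambda>\<xi>. 0)" for e
  proof -
    have "sub_proj e p0" using sub_proj_trans e p by blast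
    then have "\<not> atom M e" using p0(3) sub_proj_op_le p0(1) by blast
    then obtain f where "f \<in> projections M" "f \<noteq> (\<lambda>\<xi>. 0)" "f \<le>\<^sub>o\<^sub>p e" "f \<noteq> e"
      using e sub_projD(1) unfolding atom_def by blast
    then show ?thesis using proj_le_iff[of f e] sub_projD(1)[OF e(1)] by (auto simp: sub_proj_def)
  qed
  then show ?thesis using that[of p] p sub_projD(1) by (auto simp: nonatomic_def)
qed

context
  fixes p assumes p: "nonatomic p"
begin

lemma p_proj: "p \<in> projections M" and p_fin: "\<tau> p < \<infinity>"
  using p by (auto simp: nonatomic_def)

definition mass :: "('a \<Rightarrow> 'a) \<Rightarrow> real" where
  "mass e = enn2real (\<tau> e)"

lemma mass_add:
  assumes e: "sub_proj e q" and q: "sub_proj q p"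
  shows "mass q = mass e + mass (\<lambda>\<xi>. q \<xi> - e \<xi>)"
proof -
  have "\<tau> q < \<infinity>" using trace_sub_proj(3)[OF q p_proj] p_fin by simp
  then show ?thesis
    using trace_sub_proj(1)[OF e sub_projD(1)[OF q]] enn2real_plus[of "\<tau> e" "\<tau> (\<lambda>\<xi>. q \<xi> - e \<xi>)"]
    by (simp add: mass_def less_top)
qed

lemma mass_nonneg: "mass e \<ge> 0" by (simp add: mass_def)

lemma mass_pos: assumes "sub_proj e p" "e \<noteq> (\<lambda>\<xi>. 0)" shows "mass e > 0"
proof -
  have "\<tau> e < \<infinity>" using trace_sub_proj(3)[OF assms(1) p_proj] p_fin by simp
  moreover have "\<tau> e \<noteq> 0" using trace_pos[OF sub_projD(1)[OF assms(1)]] assms(2) by blast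
  ultimately show ?thesis by (simp add: mass_def enn2real_positive_iff zero_less_iff_neq_zero less_top)
qed

lemma mass_mono: "sub_proj e q \<Longrightarrow> sub_proj q p \<Longrightarrow> mass e \<le> mass q"
  using mass_add mass_nonneg[of "\<lambda>\<xi>. q \<xi> - e \<xi>"] by fastforce

text \<open>
  A subprojection that splits \<open>q\<close> within a factor \<open>2\<close> as evenly as any other one does.
\<close>

lemma fair_split:
  assumes q: "sub_proj q p"
  shows "\<exists>r. sub_proj r q \<and> (\<forall>r'. sub_proj r' q \<longrightarrow>
    min (mass r') (mass (\<lambda>\<xi>. q \<xi> - r' \<xi>)) \<le> 2 * min (mass r) (mass (\<lambda>\<xi>. q \<xi> - r \<xi>)))"
proof -
  define m where "m r = min (mass r) (mass (\<lambda>\<xi>. q \<xi> - r \<xi>))" for r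
  define S where "S = (SUP r\<in>{r. sub_proj r q}. m r)"
  have z: "sub_proj (\<lambda>\<xi>. 0) q"
    using proj_zero bounded_ops_zero[OF proj_bounded[OF sub_projD(1)[OF q]]] by (simp add: sub_proj_def)
  have bdd: "bdd_above (m ` {r. sub_proj r q})"
  proof (rule bdd_aboveI2)
    show "m r \<le> mass q" if "r \<in> {r. sub_proj r q}" for r
      using that mass_mono[OF _ q] unfolding m_def by fastforce
  qed
  have up: "m r \<le> S" if "sub_proj r q" for r
    unfolding S_def by (rule cSUP_upper[OF _ bdd]) (use that in simp)
  have "\<exists>r. sub_proj r q \<and> S \<le> 2 * m r"
  proof (cases "S > 0")
    case True
    then have "S / 2 < S" by simp
    then obtain r where "sub_proj r q" "S / 2 < m r"
      unfolding S_def using less_cSUP_iff[OF _ bdd] z by blast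
    then show ?thesis by (intro exI[of _ r]) auto
  next
    case False
    have "m (\<lambda>\<xi>. 0) \<ge> 0" using mass_nonneg by (simp add: m_def)
    then show ?thesis using False z by (intro exI[of _ "\<lambda>\<xi>. 0"]) auto
  qed
  then show ?thesis using up unfolding m_def by (meson order_trans)
qed

definition split :: "('a \<Rightarrow> 'a) \<Rightarrow> 'a \<Rightarrow> 'a" where
  "split q = (SOME r. sub_proj r q \<and> (\<forall>r'. sub_proj r' q \<longrightarrow>
    min (mass r') (mass (\<lambda>\<xi>. q \<xi> - r' \<xi>)) \<le> 2 * min (mass r) (mass (\<lambda>\<xi>. q \<xi> - r \<xi>))))"

text \<open>
  The binary tree of projections that arises from \<open>p\<close> by repeated splitting.
\<close>

primrec cell :: "bool list \<Rightarrow> 'a \<Rightarrow> 'a" where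
  "cell [] = p"
| "cell (b # l) = (if b then split (cell l) else (\<lambda>\<xi>. cell l \<xi> - split (cell l) \<xi>))"

lemma split:
  assumes "sub_proj q p"
  shows "sub_proj (split q) q" "sub_proj r' q \<Longrightarrow>
    min (mass r') (mass (\<lambda>\<xi>. q \<xi> - r' \<xi>)) \<le> 2 * min (mass (split q)) (mass (\<lambda>\<xi>. q \<xi> - split q \<xi>))"
  using someI_ex[OF fair_split[OF assms]] unfolding split_def by blast+

lemma sub_proj_refl: "q \<in> projections M \<Longrightarrow> sub_proj q q"
  using projD(2) by (simp add: sub_proj_def)

lemma cell_sub: "sub_proj (cell l) p"
proof (induction l)
  case Nil
  then show ?case using sub_proj_refl[OF p_proj] by simp
next
  case (Cons b l)
  have "sub_proj (\<lambda>\<xi>. cell l \<xi> - split (cell l) \<xi>) (cell l)"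
    using trace_sub_proj(2)[OF split(1)[OF Cons] sub_projD(1)[OF Cons]] .
  then show ?case using split(1)[OF Cons] sub_proj_trans[OF _ Cons] by simp
qed

text \<open>
  If \<open>e\<close> were nonzero and inside or outside each cell, it would lie in a decreasing sequence of cells.
  As \<open>e\<close> is not an atom, it splits into two nonzero parts of trace at least \<open>m\<close>; each cell of the
  sequence could be split as evenly, so every splitting in the sequence takes away at least \<open>m/2\<close>.
  This exhausts the trace of \<open>p\<close>.
\<close>

lemma cells_separate:
  assumes e: "sub_proj e p" and dec: "\<And>l. (\<forall>\<xi>. cell l (e \<xi>) = e \<xi>) \<or> (\<forall>\<xi>. cell l (e \<xi>) = 0)"
  shows "e = (\<lambda>\<xi>. 0)"
proof (rule ccontr)
  assume ne: "e \<noteq> (\<lambda>\<xi>. 0)"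
  then obtain f where f: "sub_proj f e" "f \<noteq> (\<lambda>\<xi>. 0)" "f \<noteq> e"
    using p e by (auto simp: nonatomic_def)
  define g where "g = (\<lambda>\<xi>. e \<xi> - f \<xi>)"
  have ge: "sub_proj g e" unfolding g_def by (rule trace_sub_proj(2)[OF f(1) sub_projD(1)[OF e]])
  have g0: "g \<noteq> (\<lambda>\<xi>. 0)"
  proof
    assume "g = (\<lambda>\<xi>. 0)"
    then have "e \<xi> - f \<xi> = 0" for \<xi> unfolding g_def by meson
    then show False using f(3) by auto
  qed
  define m where "m = min (mass f) (mass g)"
  have m: "m > 0"
    using mass_pos[OF sub_proj_trans[OF f(1) e] f(2)] mass_pos[OF sub_proj_trans[OF ge e] g0]
    by (simp add: m_def)
  have "\<exists>l. sub_proj e (cell l) \<and> mass (cell l) \<le> mass p - real n * (m / 2)" for n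
  proof (induction n)
    case 0
    then show ?case using e by (intro exI[of _ "[]"]) simp
  next
    case (Suc n)
    then obtain l where l: "sub_proj e (cell l)" "mass (cell l) \<le> mass p - real n * (m / 2)" by blast
    let ?q = "cell l" let ?r = "split (cell l)" let ?r' = "\<lambda>\<xi>. cell l \<xi> - split (cell l) \<xi>"
    note q = cell_sub[of l] and r = split(1)[OF cell_sub[of l]]
    have r': "sub_proj ?r' ?q" by (rule trace_sub_proj(2)[OF r sub_projD(1)[OF q]])
    have fq: "sub_proj f ?q" by (rule sub_proj_trans[OF f(1) l(1)])
    have "sub_proj g (\<lambda>\<xi>. ?q \<xi> - f \<xi>)"
      unfolding sub_proj_def
    proof (intro conjI allI sub_projD(1)[OF ge])
      fix \<xi>
      have "f (g \<xi>) = 0"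
        using sub_proj_right[OF f(1) sub_projD(1)[OF e]] projD(2)[OF sub_projD(1)[OF f(1)]]
          bounded_ops_diff[OF proj_bounded[OF sub_projD(1)[OF f(1)]]] by (simp add: g_def)
      then show "?q (g \<xi>) - f (g \<xi>) = g \<xi>" using sub_projD(2)[OF sub_proj_trans[OF ge l(1)]] by simp
    qed
    moreover have "sub_proj (\<lambda>\<xi>. ?q \<xi> - f \<xi>) p"
      using sub_proj_trans[OF trace_sub_proj(2)[OF fq sub_projD(1)[OF q]] q] .
    ultimately have "mass g \<le> mass (\<lambda>\<xi>. ?q \<xi> - f \<xi>)" by (rule mass_mono)
    then have "m \<le> 2 * min (mass ?r) (mass ?r')"
      using split(2)[OF q fq] by (simp add: m_def min_def split: if_splits)
    then have big: "m / 2 \<le> mass ?r" "m / 2 \<le> mass ?r'" by auto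
    have sum: "mass ?q = mass ?r + mass ?r'" by (rule mass_add[OF r q])
    show ?case
    proof (cases "\<forall>\<xi>. cell (True # l) (e \<xi>) = e \<xi>")
      case True
      then have "sub_proj e (cell (True # l))" using sub_projD(1)[OF e] by (simp add: sub_proj_def)
      moreover have "mass (cell (True # l)) \<le> mass p - real (Suc n) * (m / 2)"
        using big sum l(2) by (simp add: field_simps)
      ultimately show ?thesis by blast
    next
      case False
      then have "\<forall>\<xi>. cell (True # l) (e \<xi>) = 0" using dec[of "True # l"] by blast
      then have "\<forall>\<xi>. ?r (e \<xi>) = 0" by simp
      then have "sub_proj e (cell (False # l))"
        using sub_projD[OF l(1)] by (simp add: sub_proj_def)
      moreover have "mass (cell (False # l)) \<le> mass p - real (Suc n) * (m / 2)"
        using big sum l(2) by (simp add: field_simps)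
      ultimately show ?thesis by blast
    qed
  qed
  note shrink = this
  obtain n where "mass p < real n * (m / 2)" using m reals_Archimedean3[of "m / 2"] by auto
  moreover obtain l where "mass (cell l) \<le> mass p - real n * (m / 2)" using shrink by blast
  ultimately show False using mass_nonneg[of "cell l"] by simp
qed

text \<open>
  The element \<open>z\<close> is the sum of \<open>3\<^sup>-\<^sup>n g n\<close>, where \<open>g\<close> enumerates the cells.  If \<open>z\<close> is constant on \<open>e\<close>,
  then by uniqueness of ternary expansions with digits \<open>0\<close> and \<open>1\<close>, every digit \<open>g n\<close> is constant on
  \<open>e\<close>, that is, \<open>e\<close> lies inside or outside of every cell.
\<close>

lemma nowhere_constant_exists:
  obtains z where "z \<in> M" "\<And>\<xi>. p (z \<xi>) = z \<xi>"
    "\<forall>e c. sub_proj e p \<longrightarrow> (\<forall>\<xi>. z (e \<xi>) = c *\<^sub>C e \<xi>) \<longrightarrow> e = (\<lambda>\<xi>. 0)"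
proof -
  define g where "g n = cell (from_nat n)" for n
  have gs: "sub_proj (g n) p" for n by (simp add: g_def cell_sub)
  note gM = sub_projD(1)[OF gs]
  define t :: "nat \<Rightarrow> real" where "t n = (1/3) ^ n" for n
  have tsum: "summable t" unfolding t_def by (rule summable_geometric) simp
  have tn: "t n > 0" for n by (simp add: t_def)
  have sn: "summable (\<lambda>n. norm (t n *\<^sub>R g n \<xi>))" for \<xi>
  proof (rule summable_comparison_test')
    show "summable (\<lambda>n. t n * norm \<xi>)" by (rule summable_mult2[OF tsum])
    show "norm (norm (t n *\<^sub>R g n \<xi>)) \<le> t n * norm \<xi>" for n
      using norm_proj_le[OF gM] tn[of n] by (simp add: mult_left_mono)
  qed
  define z where "z \<xi> = (\<Sum>n. t n *\<^sub>R g n \<xi>)" for \<xi>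
  have zs: "(\<lambda>n. t n *\<^sub>R g n \<xi>) sums z \<xi>" for \<xi>
    unfolding z_def by (rule summable_sums[OF summable_norm_cancel[OF sn]])
  have part: "(\<lambda>\<xi>. \<Sum>i<n. t i *\<^sub>R g i \<xi>) \<in> M" for n
  proof (induction n)
    case (Suc n)
    then show ?case using M_closure(3)[OF Suc M_scaleR[OF projD(1)[OF gM]]] by simp
  qed (simp add: M_closure)
  have zM: "z \<in> M"
  proof (rule M_limit[OF part])
    show "(\<lambda>n. \<Sum>i<n. t i *\<^sub>R g i \<xi>) \<longlonglongrightarrow> z \<xi>" for \<xi> using zs by (simp add: sums_def)
    show "norm (z \<xi>) \<le> suminf t * norm \<xi>" for \<xi>
    proof -
      have "norm (z \<xi>) \<le> (\<Sum>n. norm (t n *\<^sub>R g n \<xi>))"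
        unfolding z_def by (rule summable_norm[OF sn])
      also have "\<dots> \<le> (\<Sum>n. t n * norm \<xi>)"
        using norm_proj_le[OF gM] tn less_imp_le
        by (intro suminf_le sn summable_mult2[OF tsum]) (simp add: mult_left_mono abs_of_pos[OF tn])
      also have "\<dots> = suminf t * norm \<xi>" by (rule suminf_mult2[OF tsum, symmetric])
      finally show ?thesis .
    qed
  qed
  have pz: "p (z \<xi>) = z \<xi>" for \<xi>
  proof -
    have "(\<lambda>n. p (t n *\<^sub>R g n \<xi>)) sums p (z \<xi>)"
      by (rule bounded_linear.sums[OF bounded_ops_bounded_linear[OF proj_bounded[OF p_proj]] zs])
    then have "(\<lambda>n. t n *\<^sub>R g n \<xi>) sums p (z \<xi>)"
      using sub_projD(2)[OF gs] by (simp add: bounded_ops_scaleR[OF proj_bounded[OF p_proj]])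
    then show ?thesis using zs sums_unique2 by blast
  qed
  have inner_z: "(\<lambda>n. t n * (norm (g n \<xi>))\<^sup>2) sums inner (z \<xi>) \<xi>" for \<xi>
  proof -
    have "(\<lambda>n. inner (t n *\<^sub>R g n \<xi>) \<xi>) sums inner (z \<xi>) \<xi>"
      by (rule bounded_linear.sums[OF bounded_linear_inner_left zs])
    moreover have "inner (g n \<xi>) \<xi> = (norm (g n \<xi>))\<^sup>2" for n
      using norm_proj_sq[OF gM, of n \<xi>] by (metis Re_complex_of_real Re_cinner)
    ultimately show ?thesis by simp
  qed
  have "e = (\<lambda>\<xi>. 0)" if e: "sub_proj e p" and const: "\<And>\<xi>. z (e \<xi>) = c *\<^sub>C e \<xi>" for e c
  proof (rule cells_separate[OF e])
    note eM = sub_projD(1)[OF e]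
    have unit: "(\<lambda>n. t n * (norm (g n \<xi>))\<^sup>2) sums Re c" if "e \<xi> = \<xi>" "norm \<xi> = 1" for \<xi>
    proof -
      have "inner (z \<xi>) \<xi> = Re (cinner (c *\<^sub>C \<xi>) \<xi>)" using const[of \<xi>] that by (simp add: Re_cinner)
      also have "\<dots> = Re c" using that by (simp add: cinner_scaleC_left cinner_self)
      finally show ?thesis using inner_z[of \<xi>] by simp
    qed
    have decided: "(\<forall>\<xi>. g n (e \<xi>) = e \<xi>) \<or> (\<forall>\<xi>. g n (e \<xi>) = 0)" for n
    proof (induction n rule: less_induct)
      case (less n)
      show ?case
      proof (rule ccontr)
        assume "\<not> ?case"
        then obtain \<xi>1 \<xi>2 where nz: "g n (e \<xi>1) \<noteq> 0" "g n (e \<xi>2) \<noteq> e \<xi>2" by blast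
        define u v where "u = g n (e \<xi>1)" and "v = perp (g n) (e \<xi>2)"
        have uv0: "u \<noteq> 0" "v \<noteq> 0" using nz by (auto simp: u_def v_def perp_def)
        have eu: "e u = u" "e v = v"
          using proj_commute[OF gM projD(1)[OF eM]] proj_commute[OF proj_perp[OF gM] projD(1)[OF eM]]
            projD(2)[OF eM] by (simp_all add: u_def v_def)
        have gu: "g n u = u" "g n v = 0" using projD(2)[OF gM] perp_orth(1)[OF gM] by (simp_all add: u_def v_def)
        define u' v' where "u' = (1 / norm u) *\<^sub>R u" and "v' = (1 / norm v) *\<^sub>R v"
        have n1: "norm u' = 1" "norm v' = 1" using uv0 by (simp_all add: u'_def v'_def)
        have eu': "e u' = u'" "e v' = v'" using eu by (simp_all add: u'_def v'_def bounded_ops_scaleR[OF proj_bounded[OF eM]])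
        have gu': "g n u' = u'" "g n v' = 0"
          using gu by (simp_all add: u'_def v'_def bounded_ops_scaleR[OF proj_bounded[OF gM]])
        define h where "h k = t k * (norm (g k u'))\<^sup>2 - t k * (norm (g k v'))\<^sup>2" for k
        have "h sums (Re c - Re c)"
          unfolding h_def by (intro sums_diff unit eu' n1)
        then have h: "h sums 0" by simp
        \<comment> \<open>a lower bound for \<open>h\<close> with positive sum: the tail cannot outweigh the digit \<open>n\<close>\<close>
        define b where "b k = (if k < n then 0 else if k = n then t n else - t k)" for k
        have hb: "b k \<le> h k" for k
        proof -
          consider "k < n" | "k = n" | "k > n" by linarith
          then show ?thesis
          proof cases
            case 1
            have "norm (g k u') = norm (g k v')"
              using less[OF 1] eu' n1 by (metis norm_zero)
            then show ?thesis using 1 by (simp add: b_def h_def)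
          next
            case 2
            then show ?thesis using gu' n1 by (simp add: b_def h_def)
          next
            case 3
            have "(norm (g k v'))\<^sup>2 \<le> 1" using norm_proj_le[OF gM, of k v'] n1 by (simp add: power_le_one)
            then have "t k * (norm (g k v'))\<^sup>2 \<le> t k * 1" using tn[of k] by (intro mult_left_mono) auto
            moreover have "t k * (norm (g k u'))\<^sup>2 \<ge> 0" using tn[of k] by simp
            ultimately show ?thesis using 3 by (simp add: b_def h_def)
          qed
        qed
        have "(\<lambda>k. t (k + Suc n)) sums (t (Suc n) * (1 / (1 - 1/3)))"
          unfolding t_def power_add mult.commute[of "(1/3) ^ _" "(1/3) ^ Suc n"]
          by (intro sums_mult geometric_sums) simp
        then have "(\<lambda>k. - t (k + Suc n)) sums - (t (Suc n) * (3 / 2))" by (intro sums_minus) simp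
        then have tail: "(\<lambda>k. b (k + Suc n)) sums - (t n / 2)" by (simp add: b_def t_def)
        have "(\<Sum>k<Suc n. b k) = t n" by (simp add: b_def)
        then have "b sums (t n / 2)" using sums_iff_shift[of b "Suc n" "- (t n / 2)"] tail by simp
        from sums_le[OF hb this h] show False using tn[of n] by simp
      qed
    qed
    show "(\<forall>\<xi>. cell l (e \<xi>) = e \<xi>) \<or> (\<forall>\<xi>. cell l (e \<xi>) = 0)" for l
      using decided[of "to_nat l"] by (simp add: g_def)
  qed
  then show ?thesis using that[OF zM pz] by blast
qed

end

end


section \<open>Derivations of algebras of measurable operators\<close>

context commutative_vna
begin

lemma meas_zero:
  assumes "x \<in> Meas"
  shows "op_zero \<oplus>\<^sub>m x = x" "x \<oplus>\<^sub>m op_zero = x" "x \<otimes>\<^sub>m op_zero = op_zero" "op_zero \<otimes>\<^sub>m x = op_zero"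
proof -
  show 1: "op_zero \<oplus>\<^sub>m x = x" "x \<otimes>\<^sub>m op_zero = op_zero"
    using cring.cring_simprules(8,27)[OF cring_meas, of x] assms by simp_all
  show "x \<oplus>\<^sub>m op_zero = x" "op_zero \<otimes>\<^sub>m x = op_zero"
    using 1 meas_ring_laws(1,5)[OF assms zero_measurable zero_measurable] by simp_all
qed

lemma id_dom_graph: "(\<lambda>\<xi>. \<xi>) \<in> dom_projs (graph_of T)"
  using proj_id by (simp add: dom_graph_of)

lemma graph_of_mult:
  assumes "S \<in> M" "T \<in> M" shows "graph_of S \<otimes>\<^sub>m graph_of T = graph_of (\<lambda>\<xi>. S (T \<xi>))"
proof (rule measurable_eqI[OF _ _ _ total_id])
  note S = graph_of_measurable[OF assms(1)] and T = graph_of_measurable[OF assms(2)]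
  show "graph_of S \<otimes>\<^sub>m graph_of T \<in> Meas" using mult_measurable[OF S T] .
  show "graph_of (\<lambda>\<xi>. S (T \<xi>)) \<in> Meas" using graph_of_measurable[OF M_closure(5)[OF assms]] .
  fix p :: "'h \<Rightarrow> 'h" assume "p \<in> {\<lambda>\<xi>. \<xi>}"
  then show "p \<in> dom_projs (graph_of S \<otimes>\<^sub>m graph_of T) \<and> p \<in> dom_projs (graph_of (\<lambda>\<xi>. S (T \<xi>))) \<and>
      res (graph_of S \<otimes>\<^sub>m graph_of T) p = res (graph_of (\<lambda>\<xi>. S (T \<xi>))) p"
    using dom_mult[OF S T id_dom_graph id_dom_graph] id_dom_graph by (simp add: res_graph_of)
qed simp

lemma graph_of_add:
  assumes "S \<in> M" "T \<in> M" shows "graph_of S \<oplus>\<^sub>m graph_of T = graph_of (\<lambda>\<xi>. S \<xi> + T \<xi>)"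
proof (rule measurable_eqI[OF _ _ _ total_id])
  note S = graph_of_measurable[OF assms(1)] and T = graph_of_measurable[OF assms(2)]
  show "graph_of S \<oplus>\<^sub>m graph_of T \<in> Meas" using add_measurable[OF S T] .
  show "graph_of (\<lambda>\<xi>. S \<xi> + T \<xi>) \<in> Meas" using graph_of_measurable[OF M_closure(3)[OF assms]] .
  fix p :: "'h \<Rightarrow> 'h" assume "p \<in> {\<lambda>\<xi>. \<xi>}"
  then show "p \<in> dom_projs (graph_of S \<oplus>\<^sub>m graph_of T) \<and> p \<in> dom_projs (graph_of (\<lambda>\<xi>. S \<xi> + T \<xi>)) \<and>
      res (graph_of S \<oplus>\<^sub>m graph_of T) p = res (graph_of (\<lambda>\<xi>. S \<xi> + T \<xi>)) p"
    using dom_add[OF S T id_dom_graph id_dom_graph] id_dom_graph by (simp add: res_graph_of)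
qed simp

lemma dom_graph_mult:
  assumes T: "T \<in> M" and x: "x \<in> Meas" and s: "s \<in> dom_projs x"
  shows "s \<in> dom_projs (graph_of T \<otimes>\<^sub>m x)" "res (graph_of T \<otimes>\<^sub>m x) s = (\<lambda>\<xi>. T (res x s \<xi>))"
proof -
  have sg: "s \<in> dom_projs (graph_of T)" using proj_in_dom[OF s] by (simp add: dom_graph_of)
  note d = dom_mult[OF graph_of_measurable[OF T] x sg s]
  show "s \<in> dom_projs (graph_of T \<otimes>\<^sub>m x)" by (rule d)
  show "res (graph_of T \<otimes>\<^sub>m x) s = (\<lambda>\<xi>. T (res x s \<xi>))"
    unfolding d(2) res_graph_of res_fixed(1)[OF x s] ..
qed

text \<open>
  Restrict \<open>w\<close> to a nonzero bounded operator \<open>a\<close>, and invert \<open>a\<close> on the projection \<open>e\<close> where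
  \<open>a\<^sup>* a \<ge> \<delta>\<close>.
\<close>

lemma local_inverse_meas:
  assumes w: "w \<in> Meas" "w \<noteq> op_zero"
  obtains b e where "b \<in> M" "e \<in> projections M" "e \<noteq> (\<lambda>\<xi>. 0)" "w \<otimes>\<^sub>m graph_of b = graph_of e"
proof -
  obtain P where P: "countable P" "total P" "P \<subseteq> dom_projs w"
    using countably_totalD[OF measurableD(3)[OF w(1)]] by blast
  have "\<exists>q\<in>P. res w q \<noteq> (\<lambda>\<xi>. 0)"
  proof (rule ccontr)
    assume none: "\<not> ?thesis"
    have "w = op_zero"
    proof (rule measurable_eqI[OF w(1) zero_measurable P(1,2)])
      fix q assume "q \<in> P"
      then show "q \<in> dom_projs w \<and> q \<in> dom_projs op_zero \<and> res w q = res op_zero q"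
        using none P(3) proj_in_dom by (auto simp: op_zero_graph dom_graph_of res_graph_of)
    qed
    then show False using w(2) by blast
  qed
  then obtain q where q: "q \<in> dom_projs w" "res w q \<noteq> (\<lambda>\<xi>. 0)" using P(3) by blast
  note qM = proj_in_dom[OF q(1)]
  define a where "a = res w q"
  have aM: "a \<in> M" unfolding a_def using res_in_M measurableD w(1) q(1) by blast
  note ab = bounded[OF aM]
  obtain \<xi>0 where \<xi>0: "a \<xi>0 \<noteq> 0" using q(2) by (auto simp: a_def)
  then have \<xi>0n: "\<xi>0 \<noteq> 0" using bounded_ops_zero[OF ab] by auto
  obtain s where s: "s \<in> M" "is_adjoint a s" using adjoint_in_M[OF aM] by blast
  \<comment> \<open>so small that \<open>T\<close> is positive at \<open>\<xi>0\<close>, which makes \<open>e\<close> nonzero\<close>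
  define \<delta> where "\<delta> = (norm (a \<xi>0) / norm \<xi>0)\<^sup>2 / 2"
  have \<delta>: "\<delta> > 0" using \<xi>0 \<xi>0n by (simp add: \<delta>_def)
  define T where "T = (\<lambda>\<xi>. s (a \<xi>) - \<delta> *\<^sub>R \<xi>)"
  have TM: "T \<in> M" unfolding T_def by (rule M_closure(4)[OF M_closure(5)[OF s(1) aM] M_scaleR[OF M_closure(1)]])
  have sa: "cinner (s (a \<xi>)) \<eta> = cinner (a \<xi>) (a \<eta>)" for \<xi> \<eta>
    using is_adjoint_sym[OF s(2)] by (simp add: is_adjoint_def)
  have as: "cinner \<xi> (s (a \<eta>)) = cinner (a \<xi>) (a \<eta>)" for \<xi> \<eta>
    using s(2) by (simp add: is_adjoint_def)
  have Ta: "is_adjoint T T"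
    by (simp add: is_adjoint_def T_def cinner_diff_left cinner_diff_right cinner_scaleR_left
        cinner_scaleR_right sa as)
  have Ti: "inner (T \<xi>) \<xi> = (norm (a \<xi>))\<^sup>2 - \<delta> * (norm \<xi>)\<^sup>2" for \<xi>
  proof -
    have "inner (s (a \<xi>)) \<xi> = (norm (a \<xi>))\<^sup>2"
      using sa[of \<xi> \<xi>] by (metis Re_cinner power2_norm_eq_inner)
    then show ?thesis by (simp add: T_def inner_diff_left dot_square_norm)
  qed
  obtain e where e: "e \<in> projections M" "\<And>\<xi>. inner (T (e \<xi>)) (e \<xi>) \<ge> 0"
    "\<And>\<xi>. inner (T (perp e \<xi>)) (perp e \<xi>) \<le> 0" by (rule spectral_cut[OF TM Ta]) (rule that)
  have e0: "e \<noteq> (\<lambda>\<xi>. 0)"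
  proof
    assume "e = (\<lambda>\<xi>. 0)"
    then have "inner (T \<xi>0) \<xi>0 \<le> 0" using e(3)[of \<xi>0] by (simp add: perp_def)
    then have "(norm (a \<xi>0))\<^sup>2 \<le> \<delta> * (norm \<xi>0)\<^sup>2" unfolding Ti by simp
    also have "\<dots> = (norm (a \<xi>0))\<^sup>2 / 2" using \<xi>0n by (simp add: \<delta>_def power_divide)
    finally show False using \<xi>0 by simp
  qed
  have "norm (a (e \<xi>)) \<ge> sqrt \<delta> * norm (e \<xi>)" for \<xi>
  proof -
    have "\<delta> * (norm (e \<xi>))\<^sup>2 \<le> (norm (a (e \<xi>)))\<^sup>2" using e(2)[of \<xi>] unfolding Ti by simp
    then have "(sqrt \<delta> * norm (e \<xi>))\<^sup>2 \<le> (norm (a (e \<xi>)))\<^sup>2" using \<delta> by (simp add: power_mult_distrib)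
    then show ?thesis by (rule power2_le_imp_le) simp
  qed
  then obtain b where b: "b \<in> M" "\<And>\<xi>. a (b \<xi>) = e \<xi>" "\<And>\<xi>. e (b \<xi>) = b \<xi>"
    using bounded_below_inverse[OF aM e(1), of "sqrt \<delta>"] \<delta> by auto
  have qe: "q (e \<xi>) = e \<xi>" for \<xi> using res_fixed(1)[OF w(1) q(1), of "b \<xi>"] b(2) by (simp add: a_def)
  have qb: "q (b \<xi>) = b \<xi>" for \<xi> using b(3)[of \<xi>] qe by metis
  have "w \<otimes>\<^sub>m graph_of b = graph_of e"
  proof (rule measurable_eqI[OF _ _ P(1,2)])
    note bm = graph_of_measurable[OF b(1)]
    show "w \<otimes>\<^sub>m graph_of b \<in> Meas" using mult_measurable[OF w(1) bm] .
    show "graph_of e \<in> Meas" using graph_of_measurable[OF projD(1)[OF e(1)]] .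
    fix r assume "r \<in> P"
    then have r: "r \<in> dom_projs w" using P(3) by blast
    note rM = proj_in_dom[OF r]
    have rg: "r \<in> dom_projs (graph_of T)" for T using rM by (simp add: dom_graph_of)
    have "res w r (b (r \<xi>)) = e (r \<xi>)" for \<xi>
    proof -
      have "res w r (b (r \<xi>)) = res w r (q (b (r \<xi>)))" by (simp add: qb)
      also have "\<dots> = r (a (b (r \<xi>)))"
        unfolding a_def using res_compat[OF measurableD(1,2)[OF w(1)] q(1) r] by simp
      also have "\<dots> = e (r \<xi>)"
        using b(2) proj_commute[OF rM projD(1)[OF e(1)]] projD(2)[OF rM] by simp
      finally show ?thesis .
    qed
    then show "r \<in> dom_projs (w \<otimes>\<^sub>m graph_of b) \<and> r \<in> dom_projs (graph_of e) \<and>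
        res (w \<otimes>\<^sub>m graph_of b) r = res (graph_of e) r"
      using dom_mult[OF w(1) bm r rg] rg by (simp add: res_graph_of)
  qed
  then show ?thesis using that b(1) e(1) e0 by blast
qed

text \<open>
  The patched operator is given by its graph: \<open>e\<close> maps it into \<open>c e\<close> for each \<open>e\<close> in \<open>F\<close>, and it
  vanishes on the complement \<open>r\<close> of \<open>F\<close>.  Countability of \<open>F\<close> provides a countable total family of
  projections below its domain.
\<close>

lemma glue_meas:
  assumes F: "countable F" "F \<subseteq> projections M" and below: "\<And>e \<xi>. e \<in> F \<Longrightarrow> p (e \<xi>) = e \<xi>"
    and disj: "\<And>e f \<xi>. e \<in> F \<Longrightarrow> f \<in> F \<Longrightarrow> e \<noteq> f \<Longrightarrow> e (f \<xi>) = 0"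
    and c: "\<And>e. e \<in> F \<Longrightarrow> c e \<in> Meas" and p: "p \<in> projections M"
  obtains x where "x \<in> Meas" "graph_of p \<otimes>\<^sub>m x = x"
    "\<And>e. e \<in> F \<Longrightarrow> graph_of e \<otimes>\<^sub>m x = graph_of e \<otimes>\<^sub>m c e"
proof -
  have FM: "F \<subseteq> M" using F(2) projD(1) by blast
  obtain r where r: "r \<in> projections M" "\<And>\<eta>. r \<eta> = \<eta> \<longleftrightarrow> (\<forall>e\<in>F. e \<eta> = 0)"
    using kernel_projection[OF FM] by blast
  have er: "e (r \<xi>) = 0" if "e \<in> F" for e \<xi> using r(2)[of "r \<xi>"] projD(2)[OF r(1)] that by simp
  have re: "r (e \<xi>) = 0" if "e \<in> F" for e \<xi>
    using er[OF that] proj_commute[OF r(1), of e] FM that by auto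
  have tot: "total (insert r F)"
    unfolding total_def
  proof (intro conjI ballI impI allI)
    show "insert r F \<subseteq> projections M" using F r by blast
    fix s \<xi> assume s: "s \<in> projections M" "\<forall>p\<in>insert r F. \<forall>\<xi>. p (s \<xi>) = 0"
    then have "r (s \<xi>) = s \<xi>" using r(2) by blast
    then show "s \<xi> = 0" using s(2) by simp
  qed
  define x where "x = {(\<xi>, \<eta>). r \<eta> = 0 \<and> (\<forall>e\<in>F. (e \<xi>, e \<eta>) \<in> c e)}"
  have aff: "affiliated_operator M (c e)" "closed (c e)" if "e \<in> F" for e
    using measurableD[OF c[OF that]] by auto
  note lin = linear_operatorD[OF affiliated_linear[OF aff(1)]]
  have eb: "e \<in> bounded_ops" if "e \<in> F" for e using FM bounded that by blast
  note rb = proj_bounded[OF r(1)]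
  have sv: "\<eta> = \<eta>'" if "(\<xi>, \<eta>) \<in> x" "(\<xi>, \<eta>') \<in> x" for \<xi> \<eta> \<eta>'
  proof -
    have "\<eta> - \<eta>' = 0"
    proof (rule total_separates[OF tot])
      fix s assume "s \<in> insert r F"
      then consider "s = r" | "s \<in> F" by blast
      then show "s (\<eta> - \<eta>') = 0"
      proof cases
        case 1
        then show ?thesis using that bounded_ops_diff[OF rb] by (simp add: x_def)
      next
        case 2
        then have "s \<eta> = s \<eta>'" using lin(1)[OF 2, of "s \<xi>"] that by (simp add: x_def)
        then show ?thesis using bounded_ops_diff[OF eb[OF 2]] by simp
      qed
    qed
    then show ?thesis by simp
  qed
  have xa: "affiliated_operator M x"
  proof (rule affiliatedI)
    show "linear_operator x"
      unfolding linear_operator_def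
    proof (intro conjI allI)
      show "single_valued x" using sv by (auto simp: single_valued_def)
      show "(0, 0) \<in> x" 
      proof -
        have "(e 0, e 0) \<in> c e" if "e \<in> F" for e
          unfolding bounded_ops_zero[OF eb[OF that]] using lin(2)[OF that] .
        then show ?thesis using bounded_ops_zero[OF rb] by (simp add: x_def)
      qed
      show "\<forall>(\<xi>, \<xi>')\<in>x. \<forall>(\<eta>, \<eta>')\<in>x. (\<xi> + \<eta>, \<xi>' + \<eta>') \<in> x"
        using lin(3) by (auto simp: x_def bounded_ops_add[OF eb] bounded_ops_add[OF rb])
      show "\<forall>(\<xi>, \<xi>')\<in>x. (k *\<^sub>C \<xi>, k *\<^sub>C \<xi>') \<in> x" for k
        using lin(4) by (auto simp: x_def bounded_ops_scaleC[OF eb] bounded_ops_scaleC[OF rb])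
    qed
    fix u \<xi> \<eta> assume u: "u \<in> commutant M" and m: "(\<xi>, \<eta>) \<in> x"
    have "r (u \<eta>) = 0"
      using commutantD[OF u projD(1)[OF r(1)], of \<eta>] m bounded_ops_zero[OF commutant_bounded[OF u]]
      by (simp add: x_def)
    moreover have "(e (u \<xi>), e (u \<eta>)) \<in> c e" if "e \<in> F" for e
    proof -
      have eM: "e \<in> M" using FM that by blast
      have "(u (e \<xi>), u (e \<eta>)) \<in> c e"
        using affiliated_commutant[OF aff(1)[OF that] u] m that by (simp add: x_def)
      then show ?thesis using commutantD[OF u eM] by simp
    qed
    ultimately show "(u \<xi>, u \<eta>) \<in> x" by (simp add: x_def)
  qed
  have xc: "closed x"
  proof -
    have "x = {z. r (snd z) = 0} \<inter> (\<Inter>e\<in>F. (\<lambda>z. (e (fst z), e (snd z))) -` c e)"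
      by (auto simp: x_def)
    moreover have "closed {z::'h\<times>'h. r (snd z) = 0}"
      by (rule closed_Collect_eq)
        (simp_all add: bounded_linear.continuous_on[OF bounded_ops_bounded_linear[OF rb]] continuous_on_snd)
    moreover have "closed ((\<lambda>z. (e (fst z), e (snd z))) -` c e)" if "e \<in> F" for e
      by (rule closed_vimage[OF aff(2)[OF that]])
        (simp add: bounded_linear.continuous_on[OF bounded_ops_bounded_linear[OF eb[OF that]]]
          continuous_on_fst continuous_on_snd continuous_on_Pair)
    ultimately show ?thesis by auto
  qed
  have "\<forall>e\<in>F. \<exists>Q. countable Q \<and> total Q \<and> Q \<subseteq> dom_projs (c e)"
    using measurableD(3)[OF c] by (auto simp: countably_total_def)
  then obtain Q where Q: "\<And>e. e \<in> F \<Longrightarrow> countable (Q e)" "\<And>e. e \<in> F \<Longrightarrow> total (Q e)"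
    "\<And>e. e \<in> F \<Longrightarrow> Q e \<subseteq> dom_projs (c e)" by metis
  define P where "P = insert r (\<Union>e\<in>F. (\<lambda>q \<xi>. e (q \<xi>)) ` Q e)"
  have Pc: "countable P" using F(1) Q(1) by (simp add: P_def)
  have rdom: "r \<in> dom_projs x"
  proof -
    have "(r \<xi>, 0) \<in> x" for \<xi>

    proof -
      have "(e (r \<xi>), e 0) \<in> c e" if "e \<in> F" for e
        unfolding bounded_ops_zero[OF eb[OF that]] er[OF that] using lin(2)[OF that] .
      then show ?thesis using bounded_ops_zero[OF rb] by (simp add: x_def)
    qed
    then show ?thesis using r(1) by (auto simp: dom_projs_def)
  qed
  have eqdom: "(\<lambda>\<xi>. e (q \<xi>)) \<in> dom_projs x" if eF: "e \<in> F" and q: "q \<in> Q e" for e q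
  proof -
    have eM: "e \<in> projections M" using F(2) eF by blast
    have qd: "q \<in> dom_projs (c e)" using Q(3)[OF eF] q by blast
    have "(e (q \<xi>), e (res (c e) q \<xi>)) \<in> x" for \<xi>
    proof -
      have m: "(e (q \<xi>), e (res (c e) q \<xi>)) \<in> c e"
        by (rule affiliated_commutant[OF aff(1)[OF eF] M_sub_commutant[OF projD(1)[OF eM]] res_mem[OF aff[OF eF] qd]])
      have "(f (e (q \<xi>)), f (e (res (c e) q \<xi>))) \<in> c f" if fF: "f \<in> F" for f
      proof (cases "f = e")
        case True
        then show ?thesis using m projD(2)[OF eM] by simp
      next
        case False
        then show ?thesis using disj[OF fF eF] lin(2)[OF fF] by simp
      qed
      then show ?thesis using re[OF eF] by (simp add: x_def)
    qed
    then have "range (\<lambda>\<xi>. e (q \<xi>)) \<subseteq> Domain x" by blast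
    then show ?thesis using proj_comp[OF eM proj_in_dom[OF qd]] by (simp add: dom_projs_def)
  qed
  have Pd: "P \<subseteq> dom_projs x" unfolding P_def using rdom eqdom by blast
  have Pt: "total P"
    unfolding total_def
  proof (intro conjI ballI impI)
    show "P \<subseteq> projections M" using Pd proj_in_dom by blast
    fix s assume s: "s \<in> projections M" "\<forall>p\<in>P. \<forall>\<xi>. p (s \<xi>) = 0"
    have rs: "r (s \<xi>) = 0" for \<xi> using s(2) by (simp add: P_def)
    have es: "e (s \<xi>) = 0" if eF: "e \<in> F" for e \<xi>
    proof -
      have eM: "e \<in> projections M" using F(2) eF by blast
      have "q (e (s \<zeta>)) = 0" if q: "q \<in> Q e" for q \<zeta>
      proof -
        have "(\<lambda>\<xi>. e (q \<xi>)) \<in> P" using eF q by (auto simp: P_def)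
        then have "e (q (s \<zeta>)) = 0" using s(2) by fastforce
        moreover have "q \<in> projections M" using Q(3)[OF eF] q proj_in_dom by blast
        ultimately show ?thesis using proj_commute[OF _ projD(1)[OF eM]] by simp
      qed
      then show ?thesis using Q(2)[OF eF] proj_comp[OF eM s(1)] unfolding total_def by fastforce
    qed
    then show "\<forall>\<xi>. s \<xi> = 0" using tot s(1) rs unfolding total_def by blast
  qed
  have xM: "x \<in> Meas" using xa xc Pc Pt Pd by (auto simp: measurable_iff countably_total_def)
  note X = xa xc
  have "graph_of p \<otimes>\<^sub>m x = x"
  proof (rule measurable_eqI[OF mult_measurable[OF graph_of_measurable[OF projD(1)[OF p]] xM] xM Pc Pt])
    fix s assume "s \<in> P"
    then have s: "s \<in> dom_projs x" using Pd by blast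
    have "p (res x s \<xi>) = res x s \<xi>" for \<xi>
    proof -
      have m: "(s \<xi>, res x s \<xi>) \<in> x" by (rule res_mem[OF X s])
      have "perp p (res x s \<xi>) = 0"
      proof (rule total_separates[OF tot])
        fix f assume "f \<in> insert r F"
        then consider "f = r" | "f \<in> F" by blast
        then show "f (perp p (res x s \<xi>)) = 0"
        proof cases
          case 1
          have "r (perp p (res x s \<xi>)) = perp p (r (res x s \<xi>))"
            using proj_commute[OF proj_perp[OF p] projD(1)[OF r(1)]] .
          then show ?thesis using m 1 bounded_ops_zero[OF proj_bounded[OF proj_perp[OF p]]] by (simp add: x_def)
        next
          case 2
          have "f (perp p (res x s \<xi>)) = perp p (f (res x s \<xi>))"
            using proj_commute[OF proj_perp[OF p], of f] FM 2 by blast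
          then show ?thesis using below[OF 2] by (simp add: perp_def)
        qed
      qed
      then show ?thesis by (simp add: perp_def)
    qed
    then show "s \<in> dom_projs (graph_of p \<otimes>\<^sub>m x) \<and> s \<in> dom_projs x \<and> res (graph_of p \<otimes>\<^sub>m x) s = res x s"
      using dom_graph_mult[OF projD(1)[OF p] xM s] s by simp
  qed
  moreover have "graph_of e \<otimes>\<^sub>m x = graph_of e \<otimes>\<^sub>m c e" if eF: "e \<in> F" for e
  proof -
    have eM: "e \<in> M" using FM eF by blast
    obtain S where S: "countable S" "total S" "S \<subseteq> dom_projs x \<inter> dom_projs (c e)"
      using countably_totalD[OF common_dom[OF xM c[OF eF]]] by blast
    show ?thesis
    proof (rule measurable_eqI[OF _ _ S(1,2)])
      show "graph_of e \<otimes>\<^sub>m x \<in> Meas" "graph_of e \<otimes>\<^sub>m c e \<in> Meas"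
        using mult_measurable graph_of_measurable[OF eM] xM c[OF eF] by blast+
      fix s assume "s \<in> S"
      then have s: "s \<in> dom_projs x" "s \<in> dom_projs (c e)" using S(3) by blast+
      have "e (res x s \<xi>) = e (res (c e) s \<xi>)" for \<xi>
      proof (rule lin(1)[OF eF])
        show "(e (s \<xi>), e (res x s \<xi>)) \<in> c e" using res_mem[OF X s(1), of \<xi>] eF by (simp add: x_def)
        show "(e (s \<xi>), e (res (c e) s \<xi>)) \<in> c e"
          by (rule affiliated_commutant[OF aff(1)[OF eF] M_sub_commutant[OF eM] res_mem[OF aff[OF eF] s(2)]])
      qed
      then show "s \<in> dom_projs (graph_of e \<otimes>\<^sub>m x) \<and> s \<in> dom_projs (graph_of e \<otimes>\<^sub>m c e) \<and>
          res (graph_of e \<otimes>\<^sub>m x) s = res (graph_of e \<otimes>\<^sub>m c e) s"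
        using dom_graph_mult[OF eM xM s(1)] dom_graph_mult[OF eM c[OF eF] s(2)] by simp
    qed
  qed
  ultimately show ?thesis using that xM by blast
qed

text \<open>
  What the two algebras of the theorem have in common.
\<close>

definition measurable_algebra :: "'h graph set \<Rightarrow> bool" where
  "measurable_algebra A \<longleftrightarrow> A \<subseteq> Meas \<and> (\<forall>x\<in>A. \<forall>y\<in>A. x \<oplus>\<^sub>m y \<in> A \<and> x \<otimes>\<^sub>m y \<in> A) \<and>
     (\<forall>c. \<forall>x\<in>A. c \<odot>\<^sub>m x \<in> A) \<and> graph_of ` M \<subseteq> A"

lemma measurable_algebra_Meas: "measurable_algebra Meas"
  using add_measurable mult_measurable scale_measurable graph_of_measurable
  by (auto simp: measurable_algebra_def)

lemma scale_zero: "c \<odot>\<^sub>m op_zero = (op_zero :: 'h graph)"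
proof -
  have "graph_of (\<lambda>\<xi>. c *\<^sub>C \<xi>) \<in> Meas" using graph_of_measurable[OF M_closure(6)[OF M_closure(1)]] .
  then show ?thesis
    using meas_ring_laws(9)[OF zero_measurable zero_measurable zero_measurable] meas_zero(3) by simp
qed

context
  fixes A assumes A: "measurable_algebra A"
begin

lemma A_Meas: "x \<in> A \<Longrightarrow> x \<in> Meas" and A_add: "x \<in> A \<Longrightarrow> y \<in> A \<Longrightarrow> x \<oplus>\<^sub>m y \<in> A"
  and A_mult: "x \<in> A \<Longrightarrow> y \<in> A \<Longrightarrow> x \<otimes>\<^sub>m y \<in> A" and A_scale: "x \<in> A \<Longrightarrow> c \<odot>\<^sub>m x \<in> A"
  and A_graph: "T \<in> M \<Longrightarrow> graph_of T \<in> A"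
  using A by (auto simp: measurable_algebra_def)

lemma A_zero: "op_zero \<in> A"
  unfolding op_zero_graph by (rule A_graph[OF M_closure(2)])

text \<open>
  The algebra is commutative.
\<close>

lemma inner_zero:
  assumes "inner_on A D" "x \<in> A" shows "D x = op_zero"
proof -
  obtain a where a: "a \<in> A" "\<And>x. x \<in> A \<Longrightarrow> D x = a \<otimes>\<^sub>m x \<oplus>\<^sub>m (- 1) \<odot>\<^sub>m (x \<otimes>\<^sub>m a)"
    using assms(1) by (auto simp: inner_on_def)
  note m = A_Meas[OF a(1)] A_Meas[OF assms(2)]
  have ax: "a \<otimes>\<^sub>m x = x \<otimes>\<^sub>m a" and xa: "x \<otimes>\<^sub>m a \<in> Meas"
    using meas_ring_laws(5)[OF m zero_measurable] mult_measurable[OF m(2,1)] by auto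
  show ?thesis
    unfolding a(2)[OF assms(2)] ax
    using meas_ring_laws(1)[OF xa scale_measurable[OF xa] zero_measurable]
      meas_ring_laws(4)[OF xa zero_measurable zero_measurable] by metis
qed

lemma zero_derivation:
  assumes "\<And>x. x \<in> A \<Longrightarrow> D x = op_zero" shows "derivation_on A D" "inner_on A D"
proof -
  note m = A_Meas zero_measurable
  have z: "op_zero \<oplus>\<^sub>m op_zero = (op_zero :: 'h graph)" "x \<in> A \<Longrightarrow> op_zero \<otimes>\<^sub>m x = op_zero" "x \<in> A \<Longrightarrow> x \<otimes>\<^sub>m op_zero = op_zero" for x
    using meas_zero m by auto
  show "derivation_on A D"
    unfolding derivation_on_def linear_map_on_def
    using assms A_zero A_add A_mult A_scale z scale_zero by auto
  show "inner_on A D"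
    unfolding inner_on_def using assms A_zero z scale_zero by (intro bexI[of _ op_zero]) auto
qed

end

subsection \<open>Atoms\<close>

text \<open>
  Each spectral cut of \<open>T - s\<close> meets the atom in \<open>0\<close> or in \<open>q\<close>, so on \<open>q\<close> either \<open>T \<ge> s\<close> or \<open>T \<le> s\<close>, for
  every \<open>s\<close>.  Therefore \<open>T\<close> equals on \<open>q\<close> its mean value \<open>r\<close> at any vector.
\<close>

lemma atom_scalar_self_adjoint:
  assumes q: "atom M q" and T: "T \<in> M" "is_adjoint T T"
  obtains r where "\<And>\<xi>. T (q \<xi>) = r *\<^sub>R q \<xi>"
proof -
  have qM: "q \<in> projections M" and q0: "q \<noteq> (\<lambda>\<xi>. 0)"
    and min: "\<And>e. e \<in> projections M \<Longrightarrow> e \<noteq> (\<lambda>\<xi>. 0) \<Longrightarrow> e \<le>\<^sub>o\<^sub>p q \<Longrightarrow> e = q"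
    using q by (auto simp: atom_def)
  note qb = proj_bounded[OF qM]
  define f where "f \<xi> = inner (T (q \<xi>)) (q \<xi>)" for \<xi>
  have dich: "(\<forall>\<xi>. f \<xi> \<ge> s * (norm (q \<xi>))\<^sup>2) \<or> (\<forall>\<xi>. f \<xi> \<le> s * (norm (q \<xi>))\<^sup>2)" for s
  proof -
    define B where "B = (\<lambda>\<xi>. T \<xi> - s *\<^sub>R \<xi>)"
    have BM: "B \<in> M" unfolding B_def by (rule M_closure(4)[OF T(1) M_scaleR[OF M_closure(1)]])
    have Ba: "is_adjoint B B"
      using T(2) by (simp add: is_adjoint_def B_def cinner_diff_left cinner_diff_right
          cinner_scaleR_left cinner_scaleR_right)
    obtain e where e: "e \<in> projections M" "\<And>\<xi>. inner (B (e \<xi>)) (e \<xi>) \<ge> 0"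
      "\<And>\<xi>. inner (B (perp e \<xi>)) (perp e \<xi>) \<le> 0" by (rule spectral_cut[OF BM Ba]) (rule that)
    have Bf: "inner (B (q \<xi>)) (q \<xi>) = f \<xi> - s * (norm (q \<xi>))\<^sup>2" for \<xi>
      by (simp add: B_def f_def inner_diff_left dot_square_norm)
    have eq: "(\<lambda>\<xi>. e (q \<xi>)) \<in> projections M" by (rule proj_comp[OF e(1) qM])
    show ?thesis
    proof (cases "(\<lambda>\<xi>. e (q \<xi>)) = (\<lambda>\<xi>. 0)")
      case True
      then have "perp e (q \<xi>) = q \<xi>" for \<xi> by (simp add: perp_def fun_eq_iff)
      then have "inner (B (q \<xi>)) (q \<xi>) \<le> 0" for \<xi> using e(3)[of "q \<xi>"] by simp
      then show ?thesis unfolding Bf by simp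
    next
      case False
      have "(\<lambda>\<xi>. e (q \<xi>)) \<le>\<^sub>o\<^sub>p q"
        unfolding proj_le_iff[OF eq qM]
        using proj_commute[OF qM projD(1)[OF e(1)]] projD(2)[OF qM] by simp
      then have "(\<lambda>\<xi>. e (q \<xi>)) = q" using min[OF eq False] by blast
      then have "e (q \<xi>) = q \<xi>" for \<xi> by metis
      then have "inner (B (q \<xi>)) (q \<xi>) \<ge> 0" for \<xi> using e(2)[of "q \<xi>"] by simp
      then show ?thesis unfolding Bf by simp
    qed
  qed
  obtain \<xi>0 where \<xi>0: "q \<xi>0 \<noteq> 0" using q0 by auto
  define r where "r = f \<xi>0 / (norm (q \<xi>0))\<^sup>2"
  have fr: "f \<xi>0 = r * (norm (q \<xi>0))\<^sup>2" using \<xi>0 by (simp add: r_def)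
  have lower: "f \<xi> \<ge> s * (norm (q \<xi>))\<^sup>2" if "s < r" for s \<xi>
  proof -
    have "s * (norm (q \<xi>0))\<^sup>2 < f \<xi>0" unfolding fr using that \<xi>0 by (intro mult_strict_right_mono) auto
    then show ?thesis using dich[of s] by (meson linorder_not_le)
  qed
  have upper: "f \<xi> \<le> s * (norm (q \<xi>))\<^sup>2" if "s > r" for s \<xi>
  proof -
    have "f \<xi>0 < s * (norm (q \<xi>0))\<^sup>2" unfolding fr using that \<xi>0 by (intro mult_strict_right_mono) auto
    then show ?thesis using dich[of s] by (meson linorder_not_le)
  qed
  have eq: "f \<xi> = r * (norm (q \<xi>))\<^sup>2" for \<xi>
  proof (cases "q \<xi> = 0")
    case True
    then show ?thesis using lower[of "r - 1" \<xi>] upper[of "r + 1" \<xi>] by simp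
  next
    case False
    then have n: "(norm (q \<xi>))\<^sup>2 > 0" by simp
    have "f \<xi> / (norm (q \<xi>))\<^sup>2 \<ge> r"
      by (rule dense_le) (use lower n in \<open>auto simp: pos_le_divide_eq\<close>)
    moreover have "f \<xi> / (norm (q \<xi>))\<^sup>2 \<le> r"
      by (rule dense_ge) (use upper n in \<open>auto simp: pos_divide_le_eq\<close>)
    ultimately show ?thesis using n by (simp add: field_simps)
  qed
  define C where "C = (\<lambda>\<xi>. T (q \<xi>) - r *\<^sub>R q \<xi>)"
  have CM: "C \<in> M" unfolding C_def
    by (rule M_closure(4)[OF M_closure(5)[OF T(1) projD(1)[OF qM]] M_scaleR[OF projD(1)[OF qM]]])
  have Ca: "is_adjoint C C"
    unfolding is_adjoint_def C_def
    using T(2) projD(3)[OF qM] proj_commute[OF qM T(1)]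
    by (simp add: is_adjoint_def cinner_diff_left cinner_diff_right cinner_scaleR_left cinner_scaleR_right)
  have "inner (C \<xi>) \<xi> = 0" for \<xi>
  proof -
    have "C \<xi> = q (C \<xi>)"
      using proj_commute[OF qM T(1)] projD(2)[OF qM]
      by (simp add: C_def bounded_ops_diff[OF qb] bounded_ops_scaleR[OF qb])
    then have "inner (C \<xi>) \<xi> = inner (C \<xi>) (q \<xi>)" using projD(3)[OF qM] by (metis Re_cinner)
    then show ?thesis using eq[of \<xi>] by (simp add: C_def f_def inner_diff_left dot_square_norm)
  qed
  then have "C = (\<lambda>\<xi>. 0)" using self_adjoint_zero[OF bounded[OF CM] Ca] by blast
  then have "T (q \<xi>) - r *\<^sub>R q \<xi> = 0" for \<xi> unfolding C_def by meson
  then show ?thesis using that[of r] by simp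
qed

lemma atom_scalar:
  assumes q: "atom M q" and T: "T \<in> M"
  obtains c where "\<And>\<xi>. T (q \<xi>) = c *\<^sub>C q \<xi>"
proof -
  obtain S where S: "S \<in> M" "is_adjoint T S" using adjoint_in_M[OF T] by blast
  have TS: "cinner (T \<xi>) \<eta> = cinner \<xi> (S \<eta>)" "cinner (S \<xi>) \<eta> = cinner \<xi> (T \<eta>)" for \<xi> \<eta>
    using S(2) is_adjoint_sym[OF S(2)] by (auto simp: is_adjoint_def)
  have "(\<lambda>\<xi>. T \<xi> + S \<xi>) \<in> M" "is_adjoint (\<lambda>\<xi>. T \<xi> + S \<xi>) (\<lambda>\<xi>. T \<xi> + S \<xi>)"
    using M_closure(3)[OF T S(1)]
    by (auto simp: is_adjoint_def cinner_add_left cinner_add_right TS)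
  then obtain r1 where r1: "\<And>\<xi>. T (q \<xi>) + S (q \<xi>) = r1 *\<^sub>R q \<xi>" using atom_scalar_self_adjoint[OF q] by blast
  have "(\<lambda>\<xi>. \<i> *\<^sub>C (T \<xi> - S \<xi>)) \<in> M" "is_adjoint (\<lambda>\<xi>. \<i> *\<^sub>C (T \<xi> - S \<xi>)) (\<lambda>\<xi>. \<i> *\<^sub>C (T \<xi> - S \<xi>))"
    using M_closure(6)[OF M_closure(4)[OF T S(1)]]
    by (auto simp: is_adjoint_def cinner_diff_left cinner_diff_right cinner_scaleC_left cinner_scaleC_right TS algebra_simps)
  then obtain r2 where r2: "\<And>\<xi>. \<i> *\<^sub>C (T (q \<xi>) - S (q \<xi>)) = r2 *\<^sub>R q \<xi>"
    using atom_scalar_self_adjoint[OF q] by blast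
  have "T (q \<xi>) = ((of_real r1 - \<i> * of_real r2) / 2) *\<^sub>C q \<xi>" for \<xi>
  proof -
    have "T (q \<xi>) - S (q \<xi>) = (- \<i>) *\<^sub>C (\<i> *\<^sub>C (T (q \<xi>) - S (q \<xi>)))" by (simp add: scaleC_scaleC)
    also have "\<dots> = (- \<i> * of_real r2) *\<^sub>C q \<xi>" by (simp add: r2 scaleR_scaleC scaleC_scaleC)
    finally have d: "T (q \<xi>) - S (q \<xi>) = (- \<i> * of_real r2) *\<^sub>C q \<xi>" .
    have "2 *\<^sub>R T (q \<xi>) = (T (q \<xi>) + S (q \<xi>)) + (T (q \<xi>) - S (q \<xi>))" by (simp add: scaleR_2)
    also have "\<dots> = (of_real r1 - \<i> * of_real r2) *\<^sub>C q \<xi>"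
      unfolding r1 d by (simp add: scaleR_scaleC flip: scaleC_add_left)
    finally have "(1/2) *\<^sub>C (2 *\<^sub>R T (q \<xi>)) = (1/2) *\<^sub>C ((of_real r1 - \<i> * of_real r2) *\<^sub>C q \<xi>)" by simp
    then show ?thesis by (simp add: scaleR_scaleC scaleC_scaleC)
  qed
  then show ?thesis using that by blast
qed

abbreviation "\<iota> \<equiv> embed meas_ring"
abbreviation "\<pi> \<equiv> component meas_ring"

lemma \<iota>_simps:
  "x \<in> Meas \<Longrightarrow> y \<in> Meas \<Longrightarrow> \<iota> (x \<oplus>\<^sub>m y) = \<iota> x + \<iota> y"
  "x \<in> Meas \<Longrightarrow> y \<in> Meas \<Longrightarrow> \<iota> (x \<otimes>\<^sub>m y) = \<iota> x * \<iota> y"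
  "\<iota> op_zero = 0" "x \<in> Meas \<Longrightarrow> \<pi> (\<iota> x) = x"
  using embed_hom[OF cring_meas, of x y] embed_hom(3)[OF cring_meas, of op_zero op_zero]
    embed_sel(2)[OF cring_meas, of x] zero_measurable by auto

lemma \<iota>_inj: "\<iota> x = \<iota> y \<Longrightarrow> x \<in> Meas \<Longrightarrow> y \<in> Meas \<Longrightarrow> x = y"
  using embed_inj[OF cring_meas, of x y] by simp

lemma \<pi>_Meas: "\<pi> u \<in> Meas"
  using component_closed[OF cring_meas] by simp

lemma \<pi>_simps: "\<pi> 0 = op_zero" "\<pi> (u + v) = \<pi> u \<oplus>\<^sub>m \<pi> v" "\<pi> (u * v) = \<pi> u \<otimes>\<^sub>m \<pi> v"
  using component_simps[OF cring_meas] by auto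

lemma \<iota>_\<pi>: assumes "\<iota> x * u = u" "x \<in> Meas" shows "\<iota> (\<pi> u) = u"
proof -
  have "\<iota> (\<pi> u) = \<iota> (graph_of (\<lambda>\<xi>. \<xi>)) * (\<iota> x * u)" using embed_component[OF cring_meas, of u] assms(1) by simp
  also have "\<dots> = \<iota> (graph_of (\<lambda>\<xi>. \<xi>) \<otimes>\<^sub>m x) * u"
    using \<iota>_simps(2)[OF one_measurable assms(2)] by (simp add: mult.assoc)
  also have "\<dots> = u" using meas_ring_laws(7)[OF assms(2,2,2)] assms(1) by simp
  finally show ?thesis .
qed

text \<open>
  From \<open>q q = q\<close> follows \<open>D q = 2 q (D q)\<close>; multiplication by \<open>q\<close> gives \<open>q (D q) = 0\<close>.
\<close>

lemma derivation_idempotent: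
  assumes A: "measurable_algebra A" and D: "derivation_on A D" and q: "q \<in> projections M"
  shows "D (graph_of q) = op_zero"
proof -
  let ?q = "graph_of q"
  have qA: "?q \<in> A" by (rule A_graph[OF A projD(1)[OF q]])
  have DA: "D ?q \<in> A" using D qA by (simp add: derivation_on_def linear_map_on_def)
  have qq: "?q \<otimes>\<^sub>m ?q = ?q" using graph_of_mult[OF projD(1)[OF q] projD(1)[OF q]] projD(2)[OF q] by simp
  note m = A_Meas[OF A qA] A_Meas[OF A DA]
  define e d where "e = \<iota> ?q" and "d = \<iota> (D ?q)"
  have "D (?q \<otimes>\<^sub>m ?q) = D ?q \<otimes>\<^sub>m ?q \<oplus>\<^sub>m ?q \<otimes>\<^sub>m D ?q"
    using D qA by (simp add: derivation_on_def)
  then have 1: "d = d * e + e * d"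
    using qq m by (simp add: e_def d_def mult_measurable flip: \<iota>_simps(1,2))
  have 2: "e * e = e" using qq \<iota>_simps(2)[OF m(1,1)] by (simp add: e_def)
  have "e * d = e * (d * e + e * d)" using 1 by simp
  also have "\<dots> = (e * e) * d + (e * e) * d" by (simp add: algebra_simps)
  also have "\<dots> = e * d + e * d" by (simp only: 2)
  finally have ed: "e * d = 0" by (metis add_cancel_left_right)
  have "d = e * d + e * d" using 1 by (metis mult.commute)
  then have "d = 0" unfolding ed by simp
  then show ?thesis using \<iota>_inj[OF _ m(2) zero_measurable] \<iota>_simps(3) by (simp add: d_def)
qed

text \<open>
  An atom \<open>q\<close> lies below some projection in the domain of \<open>x\<close>, so \<open>q x\<close> is a scalar multiple of \<open>q\<close>
  and \<open>q (D x) = D (q x) = 0\<close>.  Atoms form a total family.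
\<close>

lemma atomic_derivation_zero:
  assumes at: "atomic_projections M" and A: "measurable_algebra A" and D: "derivation_on A D" and x: "x \<in> A"
  shows "D x = op_zero"
proof -
  have DA: "D x \<in> A" using D x by (simp add: derivation_on_def linear_map_on_def)
  note xM = A_Meas[OF A x] and DM = A_Meas[OF A DA]
  have qD: "graph_of q \<otimes>\<^sub>m D x = op_zero" if q: "atom M q" for q
  proof -
    have qM: "q \<in> projections M" and q0: "q \<noteq> (\<lambda>\<xi>. 0)"
      and min: "\<And>e. e \<in> projections M \<Longrightarrow> e \<noteq> (\<lambda>\<xi>. 0) \<Longrightarrow> e \<le>\<^sub>o\<^sub>p q \<Longrightarrow> e = q"
      using q by (auto simp: atom_def)
    obtain P where P: "countable P" "total P" "P \<subseteq> dom_projs x"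
      using countably_totalD[OF measurableD(3)[OF xM]] by blast
    have "\<not> (\<forall>\<xi>. q \<xi> = 0)" using q0 by auto
    then obtain p \<xi>1 where p: "p \<in> P" "p (q \<xi>1) \<noteq> 0" using P(2) qM unfolding total_def by blast
    have pd: "p \<in> dom_projs x" using p P by blast
    note pM = proj_in_dom[OF pd]
    have pqM: "(\<lambda>\<xi>. p (q \<xi>)) \<in> projections M" by (rule proj_comp[OF pM qM])
    have "(\<lambda>\<xi>. p (q \<xi>)) \<le>\<^sub>o\<^sub>p q"
      unfolding proj_le_iff[OF pqM qM]
      using proj_commute[OF qM projD(1)[OF pM]] projD(2)[OF qM] by simp
    moreover have "(\<lambda>\<xi>. p (q \<xi>)) \<noteq> (\<lambda>\<xi>. 0)" using p(2) by meson
    ultimately have pq: "(\<lambda>\<xi>. p (q \<xi>)) = q" using min[OF pqM] by blast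
    note dq = dom_projs_comp[OF measurableD(1,2)[OF xM] pd qM, unfolded pq]
    have resM: "res x p \<in> M" by (rule res_in_M[OF measurableD(1,2)[OF xM] pd])
    obtain c where c: "\<And>\<xi>. res x p (q \<xi>) = c *\<^sub>C q \<xi>" using atom_scalar[OF q resM] by blast
    have cq: "(\<lambda>\<xi>. c *\<^sub>C q \<xi>) \<in> M" by (rule M_closure(6)[OF projD(1)[OF qM]])
    have "graph_of q \<otimes>\<^sub>m x = graph_of (\<lambda>\<xi>. c *\<^sub>C q \<xi>)"
    proof (rule measurable_eqI[OF _ _ P(1,2)])
      show "graph_of q \<otimes>\<^sub>m x \<in> Meas" by (rule mult_measurable[OF graph_of_measurable[OF projD(1)[OF qM]] xM])
      show "graph_of (\<lambda>\<xi>. c *\<^sub>C q \<xi>) \<in> Meas" by (rule graph_of_measurable[OF cq])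
      fix s assume "s \<in> P"
      then have s: "s \<in> dom_projs x" using P by blast
      have "q (res x s \<xi>) = c *\<^sub>C q (s \<xi>)" for \<xi>
        using res_compat[OF measurableD(1,2)[OF xM] s dq(1)] dq(2) c by simp
      then show "s \<in> dom_projs (graph_of q \<otimes>\<^sub>m x) \<and> s \<in> dom_projs (graph_of (\<lambda>\<xi>. c *\<^sub>C q \<xi>)) \<and>
          res (graph_of q \<otimes>\<^sub>m x) s = res (graph_of (\<lambda>\<xi>. c *\<^sub>C q \<xi>)) s"
        using dom_graph_mult[OF projD(1)[OF qM] xM s] proj_in_dom[OF s]
        by (simp add: dom_graph_of res_graph_of)
    qed
    also have "\<dots> = c \<odot>\<^sub>m graph_of q"
      using meas_ring_laws(9)[OF graph_of_measurable[OF projD(1)[OF qM]] zero_measurable zero_measurable]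
        graph_of_mult[OF M_closure(6)[OF M_closure(1)] projD(1)[OF qM]] by simp
    finally have qx: "graph_of q \<otimes>\<^sub>m x = c \<odot>\<^sub>m graph_of q" .
    have qA: "graph_of q \<in> A" by (rule A_graph[OF A projD(1)[OF qM]])
    have Dq: "D (graph_of q) = op_zero" by (rule derivation_idempotent[OF A D qM])
    have "D (graph_of q \<otimes>\<^sub>m x) = c \<odot>\<^sub>m D (graph_of q)"
      unfolding qx using D qA by (simp add: derivation_on_def linear_map_on_def)
    then have "op_zero = D (graph_of q) \<otimes>\<^sub>m x \<oplus>\<^sub>m graph_of q \<otimes>\<^sub>m D x"
      using D qA x Dq scale_zero by (simp add: derivation_on_def)
    also have "\<dots> = graph_of q \<otimes>\<^sub>m D x"
      unfolding Dq using xM A_Meas[OF A qA] DM by (simp add: meas_zero mult_measurable)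
    finally show ?thesis by simp
  qed
  have tot: "total {q. atom M q}"
    unfolding total_def
  proof (intro conjI ballI impI)
    show "{q. atom M q} \<subseteq> projections M" by (auto simp: atom_def)
    fix r assume r: "r \<in> projections M" "\<forall>p\<in>{q. atom M q}. \<forall>\<xi>. p (r \<xi>) = 0"
    show "\<forall>\<xi>. r \<xi> = 0"
    proof (rule ccontr)
      assume "\<not> ?thesis"
      then have "r \<noteq> (\<lambda>\<xi>. 0)" by auto
      then obtain q where q: "atom M q" "q \<le>\<^sub>o\<^sub>p r" using at r(1) unfolding atomic_projections_def by blast
      then have qM: "q \<in> projections M" by (simp add: atom_def)
      have "q \<xi> = 0" for \<xi>
      proof -
        have "q \<xi> = r (q \<xi>)" using q(2) proj_le_iff[OF qM r(1)] by simp
        also have "\<dots> = q (r \<xi>)" by (rule proj_commute[OF qM projD(1)[OF r(1)]])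
        also have "\<dots> = 0" using r(2) q(1) by simp
        finally show ?thesis .
      qed
      then show False using q(1) by (auto simp: atom_def)
    qed
  qed
  obtain P where P: "countable P" "total P" "P \<subseteq> dom_projs (D x)"
    using countably_totalD[OF measurableD(3)[OF DM]] by blast
  show ?thesis
  proof (rule measurable_eqI[OF DM zero_measurable P(1,2)])
    fix s assume "s \<in> P"
    then have s: "s \<in> dom_projs (D x)" using P by blast
    have "res (D x) s \<xi> = 0" for \<xi>
    proof (rule total_separates[OF tot])
      fix q assume "q \<in> {q. atom M q}"
      then have q: "atom M q" "q \<in> M" using projD(1) by (auto simp: atom_def)
      have "q (res (D x) s \<xi>) = res op_zero s \<xi>"
        using dom_graph_mult(2)[OF q(2) DM s] qD[OF q(1)] by metis
      then show "q (res (D x) s \<xi>) = 0" by (simp add: op_zero_graph res_graph_of)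
    qed
    then show "s \<in> dom_projs (D x) \<and> s \<in> dom_projs op_zero \<and> res (D x) s = res op_zero s"
      using s proj_in_dom[OF s] by (auto simp: op_zero_graph dom_graph_of res_graph_of)
  qed
qed

end


section \<open>Local derivations\<close>

context traced_vna
begin

lemma tau_measurable_iff:
  "x \<in> tau_measurable_ops M \<tau> \<longleftrightarrow> affiliated_operator M x \<and> closed x \<and>
    (\<forall>\<epsilon>::real. \<epsilon> > 0 \<longrightarrow> (\<exists>q\<in>dom_projs x. \<tau> (perp q) < ennreal \<epsilon>))"
proof -
  have "(\<exists>p\<in>projections M. range p \<subseteq> Domain x \<and> \<tau> (perp p) < ennreal \<epsilon>) \<longleftrightarrow>
      (\<exists>q\<in>dom_projs x. \<tau> (perp q) < ennreal \<epsilon>)" for \<epsilon>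
    unfolding dom_projs_def by blast
  then show ?thesis by (auto simp: tau_measurable_ops_def tau_dense_def affiliated_operator_def)
qed

text \<open>
  Projections \<open>q n\<close> below the domain with \<open>\<tau> (perp (q n)) < 1/(n+1)\<close> form a total family, since a
  projection orthogonal to all of them has trace \<open>0\<close>.
\<close>

lemma tau_measurable_Meas: "tau_measurable_ops M \<tau> \<subseteq> Meas"
proof
  fix x assume x: "x \<in> tau_measurable_ops M \<tau>"
  then have "\<forall>n. \<exists>q\<in>dom_projs x. \<tau> (perp q) < ennreal (inverse (real (Suc n)))"
    by (auto simp: tau_measurable_iff simp del: of_nat_Suc)
  then obtain q where q: "\<And>n. q n \<in> dom_projs x" "\<And>n. \<tau> (perp (q n)) < ennreal (inverse (real (Suc n)))"
    by metis
  note qM = proj_in_dom[OF q(1)]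
  have "total (range q)"
    unfolding total_def
  proof (intro conjI ballI impI)
    show "range q \<subseteq> projections M" using qM by blast
    fix r assume r: "r \<in> projections M" "\<forall>p\<in>range q. \<forall>\<xi>. p (r \<xi>) = 0"
    have le: "\<tau> r \<le> ennreal (inverse (real (Suc n)))" for n
    proof -
      have "sub_proj r (perp (q n))" using r by (simp add: sub_proj_def perp_def)
      from trace_sub_proj(3)[OF this proj_perp[OF qM]] show ?thesis using q(2)[of n] by simp
    qed
    have "\<tau> r \<le> 0"
    proof (rule ennreal_le_epsilon)
      fix \<epsilon> :: real assume "\<epsilon> > 0"
      then obtain n where "inverse (real (Suc n)) < \<epsilon>" using reals_Archimedean by blast
      then have "ennreal (inverse (real (Suc n))) \<le> ennreal \<epsilon>" by (simp add: ennreal_leI)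
      then show "\<tau> r \<le> 0 + ennreal \<epsilon>" using le[of n] by simp
    qed
    then show "\<forall>\<xi>. r \<xi> = 0" using trace_pos[OF r(1)] by simp
  qed
  moreover have "range q \<subseteq> dom_projs x" using q(1) by blast
  ultimately show "x \<in> Meas"
    using x by (auto simp: measurable_iff tau_measurable_iff countably_total_def intro: exI[of _ "range q"])
qed

lemma tau_common:
  assumes x: "x \<in> tau_measurable_ops M \<tau>" and y: "y \<in> tau_measurable_ops M \<tau>" and \<epsilon>: "(\<epsilon>::real) > 0"
  shows "\<exists>q\<in>dom_projs x \<inter> dom_projs y. \<tau> (perp q) < ennreal \<epsilon>"
proof -
  have "\<epsilon> / 2 > 0" using \<epsilon> by simp
  then obtain p q where pq: "p \<in> dom_projs x" "\<tau> (perp p) < ennreal (\<epsilon> / 2)"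
    "q \<in> dom_projs y" "\<tau> (perp q) < ennreal (\<epsilon> / 2)"
    using x y unfolding tau_measurable_iff by metis
  note M = proj_in_dom[OF pq(1)] proj_in_dom[OF pq(3)]
  have "\<tau> (perp (\<lambda>\<xi>. p (q \<xi>))) \<le> \<tau> (perp p) + \<tau> (perp q)" by (rule trace_join_perp[OF M])
  also have "\<dots> < ennreal (\<epsilon> / 2) + ennreal (\<epsilon> / 2)" using pq by (intro add_strict_mono)
  also have "\<dots> = ennreal \<epsilon>" using \<epsilon> by (simp flip: ennreal_plus)
  finally have "\<tau> (perp (\<lambda>\<xi>. p (q \<xi>))) < ennreal \<epsilon>" .
  moreover have "(\<lambda>\<xi>. p (q \<xi>)) = (\<lambda>\<xi>. q (p \<xi>))" using proj_commute[OF M(1) projD(1)[OF M(2)]] by simp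
  moreover have "(\<lambda>\<xi>. p (q \<xi>)) \<in> dom_projs x" "(\<lambda>\<xi>. q (p \<xi>)) \<in> dom_projs y"
    using dom_projs_comp(1) x y pq(1,3) M unfolding tau_measurable_iff by blast+
  ultimately show ?thesis by (metis IntI)
qed

lemma measurable_algebra_tau: "measurable_algebra (tau_measurable_ops M \<tau>)"
  unfolding measurable_algebra_def
proof (intro conjI ballI allI)
  show sub: "tau_measurable_ops M \<tau> \<subseteq> Meas" by (rule tau_measurable_Meas)
  fix x assume x: "x \<in> tau_measurable_ops M \<tau>"
  then have xM: "x \<in> Meas" using sub by blast
  show "c \<odot>\<^sub>m x \<in> tau_measurable_ops M \<tau>" for c
    using x measurableD(1,2)[OF scale_measurable[OF xM]] dom_scale(1)[OF xM]
    unfolding tau_measurable_iff by metis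
  fix y assume y: "y \<in> tau_measurable_ops M \<tau>"
  then have yM: "y \<in> Meas" using sub by blast
  show "x \<oplus>\<^sub>m y \<in> tau_measurable_ops M \<tau>"
    using tau_common[OF x y] measurableD(1,2)[OF add_measurable[OF xM yM]] dom_add(1)[OF xM yM]
    unfolding tau_measurable_iff by (metis IntD1 IntD2)
  show "x \<otimes>\<^sub>m y \<in> tau_measurable_ops M \<tau>"
    using tau_common[OF x y] measurableD(1,2)[OF mult_measurable[OF xM yM]] dom_mult(1)[OF xM yM]
    unfolding tau_measurable_iff by (metis IntD1 IntD2)
next
  show "graph_of ` M \<subseteq> tau_measurable_ops M \<tau>"
  proof
    fix x assume "x \<in> graph_of ` M"
    then obtain T where T: "T \<in> M" "x = graph_of T" by blast
    have "\<tau> (perp (\<lambda>\<xi>. \<xi>)) = 0" using trace_zero by (simp add: perp_def)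
    then show "x \<in> tau_measurable_ops M \<tau>"
      using measurableD(1,2)[OF graph_of_measurable[OF T(1)]] proj_id
      unfolding tau_measurable_iff T(2) dom_graph_of by (auto intro!: bexI[of _ "\<lambda>\<xi>. \<xi>"])
  qed
qed

text \<open>
  The operator \<open>x\<close> is zero on the complement of \<open>p\<close>.  With \<open>J n\<close> an increasing sequence of
  projections below its domain, normality gives \<open>\<tau> (p J n) \<rightarrow> \<tau> p\<close>; as \<open>\<tau> p\<close> is finite, the complement
  of the join of \<open>perp p\<close> and \<open>J n\<close> has small trace.
\<close>

lemma corner_tau_measurable:
  assumes p: "p \<in> projections M" "\<tau> p < \<infinity>" and x: "x \<in> Meas" and px: "graph_of p \<otimes>\<^sub>m x = x"
  shows "x \<in> tau_measurable_ops M \<tau>"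
proof -
  note X = measurableD(1,2)[OF x]
  obtain P where P: "countable P" "total P" "P \<subseteq> dom_projs x"
    using countably_totalD[OF measurableD(3)[OF x]] by blast
  have "(perp p \<xi>, 0) \<in> x" for \<xi>
  proof (subst graph_mem_res_iff[OF X P], intro ballI)
    fix s assume "s \<in> P"
    then have s: "s \<in> dom_projs x" using P by blast
    have sM: "res x s \<in> M" by (rule res_in_M[OF X s])
    have "res x s (perp p \<xi>) = p (res x s (perp p \<xi>))"
      using dom_graph_mult(2)[OF projD(1)[OF p(1)] x s] px by metis
    also have "\<dots> = res x s (p (perp p \<xi>))" using proj_commute[OF p(1) sM] by simp
    also have "\<dots> = 0" using perp_orth(1)[OF p(1)] bounded_ops_zero[OF bounded[OF sM]] by simp
    finally show "s 0 = res x s (perp p \<xi>)" using bounded_ops_zero[OF proj_bounded'[OF s]] by simp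
  qed
  then have pd: "perp p \<in> dom_projs x" using proj_perp[OF p(1)] by (auto simp: dom_projs_def)
  obtain J where J: "\<And>n. J n \<in> projections M" "\<And>n \<xi>. J (Suc n) (J n \<xi>) = J n \<xi>"
    "\<And>\<xi>. (\<lambda>n. J n \<xi>) \<longlonglongrightarrow> \<xi>" "\<And>n. J n \<in> join_hull P"
    by (rule total_sequence[OF P(1,2)]) (rule that)
  have linD: "linear_subspace (Domain x)"
    using X(1) by (simp add: affiliated_operator_def affiliated_subspace_def)
  have join_dom: "join a b \<in> dom_projs x" if "a \<in> dom_projs x" "b \<in> dom_projs x" for a b
    using that join_in_subspace[OF linD] proj_join by (simp add: dom_projs_def)
  have "s \<in> dom_projs x" if "s \<in> join_hull P" for s
    using that
  proof (induction rule: join_hull.induct)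
    case hull_zero
    then show ?case using proj_zero linear_operatorD(2)[OF affiliated_linear[OF X(1)]]
      by (auto simp: dom_projs_def)
  next
    case (hull_base p)
    then show ?case using P(3) by blast
  next
    case (hull_join p q)
    then show ?case using join_dom by blast
  qed
  then have Jd: "J n \<in> dom_projs x" for n using J(4) by blast
  define K where "K n = (\<lambda>\<xi>. p (J n \<xi>))" for n
  have KM: "K n \<in> projections M" for n unfolding K_def by (rule proj_comp[OF p(1) J(1)])
  have Kp: "sub_proj (K n) p" for n using KM projD(2)[OF p(1)] by (simp add: sub_proj_def K_def)
  have upm: "J m (J n \<xi>) = J n \<xi>" if "n \<le> m" for m n \<xi>
    using that
  proof (induction m rule: dec_induct)
    case (step m)
    then show ?case using J(2)[of m "J n \<xi>"] by simp
  qed (simp add: projD(2)[OF J(1)])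
  have Kle: "K n \<le>\<^sub>o\<^sub>p K m" if "n \<le> m" for m n
    unfolding proj_le_iff[OF KM KM]
  proof
    fix \<xi>
    have "K m (K n \<xi>) = p (p (J m (J n \<xi>)))"
      unfolding K_def by (simp only: proj_commute[OF p(1) projD(1)[OF J(1)]])
    then show "K m (K n \<xi>) = K n \<xi>" by (simp add: upm[OF that] projD(2)[OF p(1)] K_def)
  qed
  have lub: "is_lub_in (positive_part M) (range K) p"
    unfolding is_lub_in_def
  proof (intro conjI ballI impI)
    show "p \<in> positive_part M" by (rule proj_positive[OF p(1)])
    show "k \<le>\<^sub>o\<^sub>p p" if "k \<in> range K" for k using that sub_proj_op_le[OF Kp p(1)] by blast
    fix y assume y: "y \<in> positive_part M" "\<forall>k\<in>range K. k \<le>\<^sub>o\<^sub>p y"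
    show "p \<le>\<^sub>o\<^sub>p y"
      unfolding op_le_def positive_op_iff
    proof (intro allI conjI)
      fix \<xi>
      have yi: "Im (cinner (y \<xi>) \<xi>) = 0" using y(1) by (simp add: positive_part_def positive_op_iff)
      have "(norm (K n \<xi>))\<^sup>2 \<le> Re (cinner (y \<xi>) \<xi>)" for n
      proof -
        have "Re (cinner (y \<xi> - K n \<xi>) \<xi>) \<ge> 0" using y(2) by (auto simp: op_le_def positive_op_iff)
        then show ?thesis using norm_proj_sq[OF KM, of n \<xi>] by (simp add: cinner_diff_left)
      qed
      moreover have "(\<lambda>n. (norm (K n \<xi>))\<^sup>2) \<longlonglongrightarrow> (norm (p \<xi>))\<^sup>2"
        unfolding K_def by (intro tendsto_power tendsto_norm bounded_ops_continuous[OF proj_bounded[OF p(1)] J(3)])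
      ultimately have "(norm (p \<xi>))\<^sup>2 \<le> Re (cinner (y \<xi>) \<xi>)" by (meson LIMSEQ_le_const2)
      then show "Re (cinner (y \<xi> - p \<xi>) \<xi>) \<ge> 0" "Im (cinner (y \<xi> - p \<xi>) \<xi>) = 0"
        using norm_proj_sq[OF p(1), of \<xi>] yi by (simp_all add: cinner_diff_left)
    qed
  qed
  have dir: "\<forall>a\<in>range K. \<forall>b\<in>range K. \<exists>k\<in>range K. a \<le>\<^sub>o\<^sub>p k \<and> b \<le>\<^sub>o\<^sub>p k"
  proof (intro ballI)
    fix a b assume "a \<in> range K" "b \<in> range K"
    then obtain m n where "a = K m" "b = K n" by blast
    then show "\<exists>k\<in>range K. a \<le>\<^sub>o\<^sub>p k \<and> b \<le>\<^sub>o\<^sub>p k"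
      using Kle[of m "max m n"] Kle[of n "max m n"] by auto
  qed
  have Kpos: "range K \<subseteq> positive_part M" using proj_positive[OF KM] by blast
  have sup: "\<tau> p = (SUP k\<in>range K. \<tau> k)"
    using normal[unfolded normal_trace_def, rule_format, of "range K" p] Kpos dir lub by blast
  have "\<exists>q\<in>dom_projs x. \<tau> (perp q) < ennreal \<epsilon>" if \<epsilon>: "\<epsilon> > 0" for \<epsilon> :: real
  proof -
    have "\<exists>n. \<tau> (\<lambda>\<xi>. p \<xi> - K n \<xi>) < ennreal \<epsilon>"
    proof (rule ccontr)
      assume "\<not> ?thesis"
      then have ge: "\<tau> (\<lambda>\<xi>. p \<xi> - K n \<xi>) \<ge> ennreal \<epsilon>" for n by (simp add: not_less)
      have le: "\<tau> (K n) + ennreal \<epsilon> \<le> \<tau> p" for n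
        using trace_sub_proj(1)[OF Kp p(1), of n] add_left_mono[OF ge, of "\<tau> (K n)" n] by simp
      define t where "t = enn2real (\<tau> p)"
      have t: "\<tau> p = ennreal t" using p(2) by (simp add: t_def)
      have K: "\<tau> (K n) \<le> ennreal (t - \<epsilon>) \<and> 0 \<le> t - \<epsilon>" for n
      proof -
        define k where "k = enn2real (\<tau> (K n))"
        have "\<tau> (K n) < \<infinity>" using trace_sub_proj(3)[OF Kp[of n] p(1)] p(2) by simp
        then have k: "\<tau> (K n) = ennreal k" "0 \<le> k" by (simp_all add: k_def)
        then have "ennreal (k + \<epsilon>) \<le> ennreal t" using le[of n] \<epsilon> by (simp add: t)
        moreover have "0 \<le> t" by (simp add: t_def)
        ultimately have "k + \<epsilon> \<le> t" by (simp add: ennreal_le_iff)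
        then show ?thesis using k by (simp add: ennreal_leI)
      qed
      have "ennreal t \<le> ennreal (t - \<epsilon>)"
        unfolding t[symmetric] sup using K by (auto intro: SUP_least)
      then have "t \<le> t - \<epsilon>" using K by (simp add: ennreal_le_iff)
      then show False using \<epsilon> by simp
    qed
    then obtain n where n: "\<tau> (\<lambda>\<xi>. p \<xi> - K n \<xi>) < ennreal \<epsilon>" by blast
    have "perp (join (perp p) (J n)) = (\<lambda>\<xi>. p \<xi> - K n \<xi>)"
      by (auto simp: join_def K_def) (auto simp: perp_def)
    then show ?thesis using join_dom[OF pd Jd[of n]] n by (intro bexI[of _ "join (perp p) (J n)"]) simp_all
  qed
  then show ?thesis using X by (simp add: tau_measurable_iff)
qed

subsection \<open>The corner below a projection of finite trace\<close>

context
  fixes p assumes p: "p \<in> projections M" "\<tau> p < \<infinity>"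
begin

definition unit where "unit = \<iota> (graph_of p)"
definition corner_idempotents where "corner_idempotents = {\<iota> (graph_of e) |e. sub_proj e p}"
definition scalar where "scalar c = \<iota> (graph_of (\<lambda>\<xi>. c *\<^sub>C p \<xi>))"

lemma graph_M: "T \<in> M \<Longrightarrow> graph_of T \<in> Meas" by (rule graph_of_measurable)

lemma \<iota>_mult_graph: "S \<in> M \<Longrightarrow> T \<in> M \<Longrightarrow> \<iota> (graph_of S) * \<iota> (graph_of T) = \<iota> (graph_of (\<lambda>\<xi>. S (T \<xi>)))"
  using \<iota>_simps(2)[OF graph_M graph_M] graph_of_mult by simp

lemma \<iota>_add_graph: "S \<in> M \<Longrightarrow> T \<in> M \<Longrightarrow> \<iota> (graph_of S) + \<iota> (graph_of T) = \<iota> (graph_of (\<lambda>\<xi>. S \<xi> + T \<xi>))"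
  using \<iota>_simps(1)[OF graph_M graph_M] graph_of_add by simp

lemma \<iota>_graph_inj: "\<iota> (graph_of S) = \<iota> (graph_of T) \<Longrightarrow> S \<in> M \<Longrightarrow> T \<in> M \<Longrightarrow> S = T"
  using \<iota>_inj graph_M graph_of_inj by metis

lemma \<iota>_graph_zero: "\<iota> (graph_of (\<lambda>\<xi>. 0)) = 0"
  using \<iota>_simps(3) by (simp add: op_zero_graph)

lemmas pM = projD(1)[OF p(1)]

lemma scalar_M: "(\<lambda>\<xi>. c *\<^sub>C p \<xi>) \<in> M" by (rule M_closure(6)[OF pM])

lemma in_corner:
  assumes "unit * w = w"
  shows "\<iota> (\<pi> w) = w" "graph_of p \<otimes>\<^sub>m \<pi> w = \<pi> w"
proof -
  show "\<iota> (\<pi> w) = w" using \<iota>_\<pi>[OF _ graph_M[OF pM]] assms by (simp add: unit_def)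
  have "\<pi> (unit * w) = graph_of p \<otimes>\<^sub>m \<pi> w" by (simp add: \<pi>_simps unit_def \<iota>_simps(4)[OF graph_M[OF pM]])
  then show "graph_of p \<otimes>\<^sub>m \<pi> w = \<pi> w" using assms by simp
qed

lemma corner_patchable: "patchable_algebra unit corner_idempotents scalar"
proof
  fix e assume "e \<in> corner_idempotents"
  then obtain f where f: "sub_proj f p" "e = \<iota> (graph_of f)" by (auto simp: corner_idempotents_def)
  note fM = projD(1)[OF sub_projD(1)[OF f(1)]]
  show "e * e = e" using \<iota>_mult_graph[OF fM fM] projD(2)[OF sub_projD(1)[OF f(1)]] f(2) by simp
  show "unit * e = e" using \<iota>_mult_graph[OF pM fM] sub_projD(2)[OF f(1)] f(2) by (simp add: unit_def)
next
  show "unit \<in> corner_idempotents"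
    using p(1) projD(2)[OF p(1)] by (auto simp: corner_idempotents_def unit_def sub_proj_def)
  show "scalar (a + b) = scalar a + scalar b" for a b
    using \<iota>_add_graph[OF scalar_M scalar_M] by (simp add: scalar_def scaleC_add_left)
  show "scalar (a * b) = scalar a * scalar b" for a b
    using \<iota>_mult_graph[OF scalar_M scalar_M, of a b] projD(2)[OF p(1)]
    by (simp add: scalar_def bounded_ops_scaleC[OF proj_bounded[OF p(1)]] scaleC_scaleC)
  show "scalar 1 = unit" by (simp add: scalar_def unit_def)
next
  fix w assume w: "unit * w = w" "w \<noteq> 0"
  note c = in_corner[OF w(1)]
  have "\<pi> w \<noteq> op_zero" using c(1) w(2) \<iota>_simps(3) by metis
  then obtain b e where b: "b \<in> M" "e \<in> projections M" "e \<noteq> (\<lambda>\<xi>. 0)" "\<pi> w \<otimes>\<^sub>m graph_of b = graph_of e"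
    using local_inverse_meas[OF \<pi>_Meas] by metis
  note eM = projD(1)[OF b(2)]
  have we: "w * \<iota> (graph_of b) = \<iota> (graph_of e)"
    using \<iota>_simps(2)[OF \<pi>_Meas graph_M[OF b(1)], of w] b(4) c(1) by simp
  have "\<iota> (graph_of p) * \<iota> (graph_of e) = \<iota> (graph_of e)"
    using w(1) by (simp add: unit_def flip: we mult.assoc)
  then have "(\<lambda>\<xi>. p (e \<xi>)) = e"
    using \<iota>_mult_graph[OF pM eM] \<iota>_graph_inj[OF _ M_closure(5)[OF pM eM] eM] by simp
  then have "sub_proj e p" using b(2) unfolding sub_proj_def by metis
  moreover have "\<iota> (graph_of e) \<noteq> 0"
    using \<iota>_graph_inj[OF _ eM M_closure(2)] b(3) \<iota>_graph_zero by metis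
  ultimately show "\<exists>y. w * y \<in> corner_idempotents \<and> w * y \<noteq> 0"
    using we unfolding corner_idempotents_def by (intro exI[of _ "\<iota> (graph_of b)"]) auto
next
  fix F c assume F: "F \<subseteq> corner_idempotents" and disj: "\<And>e f. e \<in> F \<Longrightarrow> f \<in> F \<Longrightarrow> e \<noteq> f \<Longrightarrow> e * f = 0"
    and c: "\<And>e. e \<in> F \<Longrightarrow> unit * c e = c e"
  define F' where "F' = {e. sub_proj e p \<and> \<iota> (graph_of e) \<in> F}"
  have F'M: "e \<in> projections M" "e \<in> M" "p (e \<xi>) = e \<xi>" if "e \<in> F'" for e \<xi>
    using that sub_projD projD(1) by (auto simp: F'_def)
  have disj': "e (f \<xi>) = 0" if "e \<in> F'" "f \<in> F'" "e \<noteq> f" for e f \<xi>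
  proof -
    have "\<iota> (graph_of e) \<noteq> \<iota> (graph_of f)" using \<iota>_graph_inj F'M(2) that by blast
    then have "\<iota> (graph_of e) * \<iota> (graph_of f) = 0" using disj that by (simp add: F'_def)
    then have "\<iota> (graph_of (\<lambda>\<xi>. e (f \<xi>))) = \<iota> (graph_of (\<lambda>\<xi>. 0))"
      using \<iota>_mult_graph F'M(2) that \<iota>_graph_zero by simp
    then have "(\<lambda>\<xi>. e (f \<xi>)) = (\<lambda>\<xi>. 0)"
      by (rule \<iota>_graph_inj[OF _ M_closure(5)[OF F'M(2)[OF that(1)] F'M(2)[OF that(2)]] M_closure(2)])
    then show ?thesis by meson
  qed
  have "countable F'"
  proof (rule countable_disjoint[OF p])
    show "sub_proj e p" if "e \<in> F'" for e using that by (simp add: F'_def)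
  qed (fact disj')
  define c' where "c' e = \<pi> (c (\<iota> (graph_of e)))" for e
  have "\<exists>x\<in>Meas. graph_of p \<otimes>\<^sub>m x = x \<and> (\<forall>e\<in>F'. graph_of e \<otimes>\<^sub>m x = graph_of e \<otimes>\<^sub>m c' e)"
  proof (rule glue_meas[of F' p c'])
    show "countable F'" by fact
    show "F' \<subseteq> projections M" using F'M(1) by blast
    show "p (e \<xi>) = e \<xi>" if "e \<in> F'" for e \<xi> using F'M(3) that by blast
    show "e (f \<xi>) = 0" if "e \<in> F'" "f \<in> F'" "e \<noteq> f" for e f \<xi> using disj' that by blast
    show "c' e \<in> Meas" for e by (simp add: c'_def \<pi>_Meas)
  qed (use p(1) in auto)
  then obtain x where x: "x \<in> Meas" "graph_of p \<otimes>\<^sub>m x = x"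
    "\<And>e. e \<in> F' \<Longrightarrow> graph_of e \<otimes>\<^sub>m x = graph_of e \<otimes>\<^sub>m \<pi> (c (\<iota> (graph_of e)))"
    unfolding c'_def by blast
  have "unit * \<iota> x = \<iota> x" using \<iota>_simps(2)[OF graph_M[OF pM] x(1)] x(2) by (simp add: unit_def)
  moreover have "e * \<iota> x = e * c e" if "e \<in> F" for e
  proof -
    obtain f where f: "sub_proj f p" "e = \<iota> (graph_of f)" using F \<open>e \<in> F\<close> by (auto simp: corner_idempotents_def)
    then have fF: "f \<in> F'" using \<open>e \<in> F\<close> by (simp add: F'_def)
    have "\<iota> (graph_of f \<otimes>\<^sub>m x) = \<iota> (graph_of f \<otimes>\<^sub>m \<pi> (c e))" using x(3)[OF fF] f(2) by simp
    then show ?thesis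
      using \<iota>_simps(2)[OF graph_M[OF F'M(2)[OF fF]]] x(1) \<pi>_Meas in_corner(1)[OF c[OF \<open>e \<in> F\<close>]] f(2) by simp
  qed
  ultimately show "\<exists>x. unit * x = x \<and> (\<forall>e\<in>F. e * x = e * c e)" by blast
qed

context
  fixes A assumes A: "measurable_algebra A"
    and corner: "\<And>x. x \<in> Meas \<Longrightarrow> graph_of p \<otimes>\<^sub>m x = x \<Longrightarrow> x \<in> A"
begin

text \<open>
  Maps of the product ring with values in the corner become maps of \<open>A\<close>, which contains the
  corner.
\<close>

lemma transfer_linear_map:
  assumes below: "\<And>u. unit * D u = D u" and add: "\<And>u v. D (u + v) = D u + D v"
    and scale: "\<And>c u. D (scalar c * u) = scalar c * D u"
  shows "linear_map_on A (\<lambda>x. \<pi> (D (\<iota> x)))"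
  unfolding linear_map_on_def
proof (intro conjI ballI allI)
  fix x assume x: "x \<in> A"
  note xM = A_Meas[OF A x]
  show "\<pi> (D (\<iota> x)) \<in> A" using corner[OF \<pi>_Meas in_corner(2)[OF below]] .
  show "\<pi> (D (\<iota> (c \<odot>\<^sub>m x))) = c \<odot>\<^sub>m \<pi> (D (\<iota> x))" for c
  proof -
    let ?c = "\<lambda>\<xi>. c *\<^sub>C \<xi>"
    have cM: "?c \<in> M" by (rule M_closure(6)[OF M_closure(1)])
    have s1: "scalar 1 = unit" by (simp add: scalar_def unit_def)
    have pD: "D (unit * u) = D u" for u using scale[of 1 u] below[of u] by (simp add: s1)
    have uc: "unit * \<iota> (graph_of ?c) = scalar c"
      using \<iota>_mult_graph[OF pM cM] by (simp add: unit_def scalar_def bounded_ops_scaleC[OF proj_bounded[OF p(1)]])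
    have "\<iota> (c \<odot>\<^sub>m x) = \<iota> (graph_of ?c) * \<iota> x"
      using meas_ring_laws(9)[OF xM xM xM] \<iota>_simps(2)[OF graph_M[OF cM] xM] by simp
    then have "D (\<iota> (c \<odot>\<^sub>m x)) = D (scalar c * \<iota> x)"
      using pD[of "\<iota> (graph_of ?c) * \<iota> x"] uc by (simp flip: mult.assoc)
    also have "\<dots> = scalar c * D (\<iota> x)" by (rule scale)
    also have "\<dots> = \<iota> (graph_of ?c) * (unit * D (\<iota> x))" by (simp add: mult_ac flip: uc)
    also have "unit * D (\<iota> x) = D (\<iota> x)" by (rule below)
    finally have "\<pi> (D (\<iota> (c \<odot>\<^sub>m x))) = graph_of ?c \<otimes>\<^sub>m \<pi> (D (\<iota> x))"
      by (simp add: \<pi>_simps \<iota>_simps(4)[OF graph_M[OF cM]])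
    then show ?thesis using meas_ring_laws(9)[OF \<pi>_Meas \<pi>_Meas \<pi>_Meas] by simp
  qed
  fix y assume y: "y \<in> A"
  show "\<pi> (D (\<iota> (x \<oplus>\<^sub>m y))) = \<pi> (D (\<iota> x)) \<oplus>\<^sub>m \<pi> (D (\<iota> y))"
    by (simp add: \<iota>_simps(1)[OF xM A_Meas[OF A y]] add \<pi>_simps)
qed

lemma transfer_derivation:
  assumes below: "\<And>u. unit * D u = D u" and add: "\<And>u v. D (u + v) = D u + D v"
    and scale: "\<And>c u. D (scalar c * u) = scalar c * D u"
    and mult: "\<And>u v. D (u * v) = D u * v + u * D v"
  shows "derivation_on A (\<lambda>x. \<pi> (D (\<iota> x)))"
  unfolding derivation_on_def
proof (intro conjI ballI transfer_linear_map below add scale)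
  fix x y assume "x \<in> A" "y \<in> A"
  note M = A_Meas[OF A this(1)] A_Meas[OF A this(2)]
  show "\<pi> (D (\<iota> (x \<otimes>\<^sub>m y))) = \<pi> (D (\<iota> x)) \<otimes>\<^sub>m y \<oplus>\<^sub>m x \<otimes>\<^sub>m \<pi> (D (\<iota> y))"
    by (simp add: \<iota>_simps(2,4) M mult \<pi>_simps)
qed

text \<open>
  The local derivation is \<open>D \<circ> D\<close>, where \<open>D z\<close> is the unit of the corner.
\<close>

lemma local_derivation_not_derivation:
  assumes na: "nonatomic p" and p0: "p \<noteq> (\<lambda>\<xi>. 0)"
  obtains \<Delta> where "local_derivation_on A \<Delta>" "\<not> derivation_on A \<Delta>"
proof -
  interpret patchable_algebra unit corner_idempotents scalar by (rule corner_patchable)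
  obtain z where z: "z \<in> M" "\<And>\<xi>. p (z \<xi>) = z \<xi>"
    "\<forall>e c. sub_proj e p \<longrightarrow> (\<forall>\<xi>. z (e \<xi>) = c *\<^sub>C e \<xi>) \<longrightarrow> e = (\<lambda>\<xi>. 0)"
    using nowhere_constant_exists[OF na] by blast
  define Z where "Z = \<iota> (graph_of z)"
  have uZ: "unit * Z = Z" using \<iota>_mult_graph[OF pM z(1)] z(2) by (simp add: unit_def Z_def)
  have nc: "e = 0" if e: "e \<in> corner_idempotents" and eq: "e * Z = e * scalar a" for e a
  proof -
    obtain f where f: "sub_proj f p" "e = \<iota> (graph_of f)" using e by (auto simp: corner_idempotents_def)
    note fP = sub_projD(1)[OF f(1)] and fM = projD(1)[OF sub_projD(1)[OF f(1)]]
    have "\<iota> (graph_of (\<lambda>\<xi>. f (z \<xi>))) = \<iota> (graph_of (\<lambda>\<xi>. f (a *\<^sub>C p \<xi>)))"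
      using eq \<iota>_mult_graph[OF fM z(1)] \<iota>_mult_graph[OF fM scalar_M] f(2) by (simp add: Z_def scalar_def)
    then have "(\<lambda>\<xi>. f (z \<xi>)) = (\<lambda>\<xi>. f (a *\<^sub>C p \<xi>))"
      by (rule \<iota>_graph_inj[OF _ M_closure(5)[OF fM z(1)] M_closure(5)[OF fM scalar_M]])
    then have "f (z \<xi>) = f (a *\<^sub>C p \<xi>)" for \<xi> by meson
    then have "z (f \<xi>) = a *\<^sub>C f \<xi>" for \<xi>
      using proj_commute[OF fP z(1)] sub_proj_right[OF f(1) p(1)] by (simp add: bounded_ops_scaleC[OF proj_bounded[OF fP]])
    then have "f = (\<lambda>\<xi>. 0)" using z(3) f(1) by blast
    then show ?thesis using f(2) \<iota>_graph_zero by simp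
  qed
  obtain D where D: "\<And>x. unit * D x = D x" "\<And>x y. D (x + y) = D x + D y"
    "\<And>x y. D (x * y) = D x * y + x * D y" "\<And>a x. D (scalar a * x) = scalar a * D x"
    "\<And>e. e \<in> corner_idempotents \<Longrightarrow> D e = 0" "D Z = unit"
    by (rule derivation_exists[OF uZ nc]) (assumption, assumption, rule that)
  define \<Delta> where "\<Delta> = (\<lambda>x. \<pi> (D (D (\<iota> x))))"
  have "local_derivation_on A \<Delta>"
    unfolding local_derivation_on_def
  proof (intro conjI ballI)
    show "linear_map_on A \<Delta>"
      unfolding \<Delta>_def
    proof (rule transfer_linear_map)
      show "unit * D (D u) = D (D u)" for u by (rule D(1))
      show "D (D (u + v)) = D (D u) + D (D v)" for u v by (simp only: D(2))
      show "D (D (scalar c * u)) = scalar c * D (D u)" for c u by (simp only: D(4))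
    qed
    fix x assume "x \<in> A"
    have supp: "e * D (D (\<iota> x)) = 0" if "e \<in> corner_idempotents" "e * D (\<iota> x) = 0" for e
    proof -
      have "D (e * D (\<iota> x)) = e * D (D (\<iota> x))" using D(3)[of e] D(5)[OF that(1)] by simp
      moreover have "D 0 = 0" using D(2)[of 0 0] by simp
      ultimately show ?thesis using that(2) by simp
    qed
    obtain c where c: "unit * c = c" "c * D (\<iota> x) = D (D (\<iota> x))"
      by (rule divide[OF D(1) D(1) supp]) (assumption, assumption, rule that)
    have "derivation_on A (\<lambda>y. \<pi> (c * D (\<iota> y)))"
    proof (rule transfer_derivation)
      show "unit * (c * D u) = c * D u" for u using c(1) by (simp flip: mult.assoc)
      show "c * D (u + v) = c * D u + c * D v" for u v by (simp add: D(2) distrib_left)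
      show "c * D (scalar a * u) = scalar a * (c * D u)" for a u
        by (simp only: D(4) mult.left_commute)
      show "c * D (u * v) = c * D u * v + u * (c * D v)" for u v
        by (simp add: D(3) algebra_simps)
    qed
    then show "\<exists>D'. derivation_on A D' \<and> \<Delta> x = D' x"
      using c(2) by (intro exI[of _ "\<lambda>y. \<pi> (c * D (\<iota> y))"]) (simp add: \<Delta>_def)
  qed
  moreover have "\<not> derivation_on A \<Delta>"
  proof
    assume der: "derivation_on A \<Delta>"
    let ?z = "graph_of z"
    have zA: "?z \<in> A" by (rule A_graph[OF A z(1)])
    note zM = A_Meas[OF A zA]
    have Du: "D unit = 0" using D(5) p_mem by blast
    have dz: "\<Delta> ?z = op_zero" using D(6) Du by (simp add: \<Delta>_def Z_def \<pi>_simps)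
    have "\<Delta> (?z \<otimes>\<^sub>m ?z) = \<Delta> ?z \<otimes>\<^sub>m ?z \<oplus>\<^sub>m ?z \<otimes>\<^sub>m \<Delta> ?z"
      using der zA by (simp add: derivation_on_def)
    then have z0: "\<pi> (D (D (Z * Z))) = op_zero"
      unfolding dz by (simp add: \<Delta>_def \<iota>_simps(2)[OF zM zM] Z_def meas_zero zM zero_measurable)
    have uu: "unit * unit = unit" using idem p_mem by blast
    have "D (D (Z * Z)) = D (unit * Z + Z * unit)" by (simp add: D(3,6))
    also have "\<dots> = D Z + D Z" by (simp only: D(2) uZ mult.commute[of Z unit])
    also have "\<dots> = of_nat 2 * unit" by (simp only: D(6) of_nat_numeral mult_2)
    finally have DD: "D (D (Z * Z)) = of_nat 2 * unit" .
    have "\<pi> (of_nat 2 * unit) = op_zero" using z0 unfolding DD .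
    then have "\<iota> (\<pi> (of_nat 2 * unit)) = 0" by (simp only: \<iota>_simps(3))
    moreover have "unit * (of_nat 2 * unit) = of_nat 2 * unit"
      by (simp only: uu mult.left_commute[of unit "of_nat 2"])
    ultimately have "of_nat 2 * unit = 0" by (simp only: in_corner(1))
    then have "unit = 0" by (intro of_nat_cancel[OF uu, of 2]) simp_all
    then have "p = (\<lambda>\<xi>. 0)" using \<iota>_graph_inj[OF _ pM M_closure(2)] \<iota>_graph_zero by (simp add: unit_def)
    then show False using p0 by simp
  qed
  ultimately show ?thesis using that by blast
qed

end

end

lemma characterization:
  assumes A: "measurable_algebra A"
    and corner: "\<And>p x. p \<in> projections M \<Longrightarrow> \<tau> p < \<infinity> \<Longrightarrow> x \<in> Meas \<Longrightarrow> graph_of p \<otimes>\<^sub>m x = x \<Longrightarrow> x \<in> A"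
  shows "(\<not> atomic_projections M \<longleftrightarrow> (\<exists>D. derivation_on A D \<and> \<not> inner_on A D)) \<and>
      (\<not> atomic_projections M \<longleftrightarrow>
         (\<exists>\<Delta>. local_derivation_on A \<Delta> \<and> (\<exists>x\<in>A. \<Delta> x \<noteq> op_zero))) \<and>
      (\<not> atomic_projections M \<longleftrightarrow>
         (\<exists>\<Delta>. local_derivation_on A \<Delta> \<and> \<not> derivation_on A \<Delta>))"
proof (cases "atomic_projections M")
  case True
  have zero: "D x = op_zero" if "derivation_on A D" "x \<in> A" for D x
    by (rule atomic_derivation_zero[OF True A that])
  have local_zero: "\<Delta> x = op_zero" if "local_derivation_on A \<Delta>" "x \<in> A" for \<Delta> x
    using that zero by (metis local_derivation_on_def)
  have "inner_on A D" if "derivation_on A D" for D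
    by (rule zero_derivation(2)[OF A zero[OF that]])
  moreover have "derivation_on A \<Delta>" if "local_derivation_on A \<Delta>" for \<Delta>
    by (rule zero_derivation(1)[OF A local_zero[OF that]])
  ultimately show ?thesis using True local_zero by blast
next
  case False
  obtain p where p: "nonatomic p" "p \<noteq> (\<lambda>\<xi>. 0)" using nonatomic_exists[OF False] by blast
  have pf: "p \<in> projections M" "\<tau> p < \<infinity>" using p(1) by (auto simp: nonatomic_def)
  obtain \<Delta> where \<Delta>: "local_derivation_on A \<Delta>" "\<not> derivation_on A \<Delta>"
    using local_derivation_not_derivation[OF pf A corner[OF pf] p] by blast
  obtain x where x: "x \<in> A" "\<Delta> x \<noteq> op_zero" using \<Delta>(2) zero_derivation(1)[OF A] by blast
  obtain D where D: "derivation_on A D" "\<Delta> x = D x" using \<Delta>(1) x(1) by (auto simp: local_derivation_on_def)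
  have "\<not> inner_on A D" using inner_zero[OF A _ x(1)] x(2) D(2) by metis
  then show ?thesis using False \<Delta> x D(1) by blast
qed

end

theorem theorem3p8:
  fixes M :: "('h::complex_hilbert_space \<Rightarrow> 'h) set"
    and \<tau> :: "('h \<Rightarrow> 'h) \<Rightarrow> ennreal"
  assumes "von_neumann_algebra M" and "commutative M"
    and "is_trace M \<tau>" and "faithful_trace M \<tau>"
    and "normal_trace M \<tau>" and "semifinite_trace M \<tau>"
  shows "\<forall>A \<in> {measurable_ops M, tau_measurable_ops M \<tau>}.
      (\<not> atomic_projections M \<longleftrightarrow> (\<exists>D. derivation_on A D \<and> \<not> inner_on A D)) \<and>
      (\<not> atomic_projections M \<longleftrightarrow>
         (\<exists>\<Delta>. local_derivation_on A \<Delta> \<and> (\<exists>x\<in>A. \<Delta> x \<noteq> op_zero))) \<and>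
      (\<not> atomic_projections M \<longleftrightarrow>
         (\<exists>\<Delta>. local_derivation_on A \<Delta> \<and> \<not> derivation_on A \<Delta>))"
proof
  interpret traced_vna M \<tau>
    by unfold_locales (use assms in auto)
  fix A assume "A \<in> {measurable_ops M, tau_measurable_ops M \<tau>}"
  then have "measurable_algebra A \<and> (\<forall>p x. p \<in> projections M \<longrightarrow> \<tau> p < \<infinity> \<longrightarrow> x \<in> Meas \<longrightarrow>
      graph_of p \<otimes>\<^sub>m x = x \<longrightarrow> x \<in> A)"
    using measurable_algebra_Meas measurable_algebra_tau corner_tau_measurable by blast
  then show "(\<not> atomic_projections M \<longleftrightarrow> (\<exists>D. derivation_on A D \<and> \<not> inner_on A D)) \<and>
      (\<not> atomic_projections M \<longleftrightarrow>
         (\<exists>\<Delta>. local_derivation_on A \<Delta> \<and> (\<exists>x\<in>A. \<Delta> x \<noteq> op_zero))) \<and>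
      (\<not> atomic_projections M \<longleftrightarrow>
         (\<exists>\<Delta>. local_derivation_on A \<Delta> \<and> \<not> derivation_on A \<Delta>))"
    using characterization[of A] by blast
qed


end
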